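(* Assume $\Omega_i=(i-1,i)\times(0,1)$ for $i=1,\dots,N$. There exists $C>0$ such that for every $n_s\in\mathbb N=\{0,1,2,\dots\}$, every $f\in L^2(\Omega)$ and every $y\in D$, the interface solution $u_\Gamma(y)$ and the approximate interface solution $\tilde u_\Gamma(y)$ associated with the sinusoidal slow–fast decomposition with parameter $n_s$ satisfy $$\|u_\Gamma(y)-\tilde u_\Gamma(y)\|_E\le C e^{-\pi(n_s+1)}\|u_\Gamma(y)\|_E .$$ (That is, $C$ is independent of $n_s$, $y$, $f$ and $u$.)
   Context: Let $N>2$, $\Omega_i=(i-1,i)\times(0,1)$, $\Gamma_i=\partial\Omega_i\cap\partial\Omega_{i+1}=\{i\}\times[0,1]$ for $i=1,\dots,N-1$, $\Omega=\mathrm{int}(\bigcup_{i=1}^N\overline\Omega_i)=(0,N)\times(0,1)$. $(\cdot,\cdot)_\omega$ is the $L^2(\omega)$ inner product. $D\subset(m,M)^N$ with $m,M>0$; $L(v)=(f,v)_\Omega$; for $y\in D$, $a(z,v)=\sum_{i=1}^N y_i(\nabla z,\nabla v)_{\Omega_i}$ and $\|v\|_E=a(v,v)^{1/2}$ (both depend on $y$). $V_{\Omega_i}$ is the space of extensions by zero to $\Omega$ of functions in $H^1_0(\Omega_i)$; $V_\Gamma=\{u\in H^1_0(\Omega): (\nabla u,\nabla v)_\Omega=0\ \forall v\in V_{\Omega_j},\ j=1,\dots,N\}$. The traces on $\Gamma_i$ of functions in $H^1_0(\Omega)$ form $H^{1/2}_{00}(\Gamma_i)$. Sinusoidal decomposition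 with parameter $n_s$: $Y_{si}=\{\sum_{n=1}^{n_s}\alpha_n\sin(\pi n x_2):\alpha_n\in\mathbb R\}$ and $Y_{fi}$ is the set of all elements of $H^{1/2}_{00}(\Gamma_i)$ of the form $\sum_{n=n_s+1}^\infty\alpha_n\sin(\pi n x_2)$, $\alpha_n\in\mathbb R$. Put $V_{fi}=\{v\in V_\Gamma: v|_{\Gamma_i}\in Y_{fi},\ v|_{\Gamma_j}=0\ \text{for } j\neq i\}$, $V_{si}=\{v\in V_\Gamma: v|_{\Gamma_i}\in Y_{si},\ v|_{\Gamma_j}=0\ \text{for } j\neq i\}$, $V_s=\bigoplus_{i=1}^{N-1}V_{si}$. $u_\Gamma(y)\in V_\Gamma$ satisfies $a(u_\Gamma(y),v)=L(v)$ for all $v\in V_\Gamma$. The approximate interface solution is $\tilde u_\Gamma(y)=\sum_{i=1}^{N-1}\tilde u_{fi}(y)+\tilde u_s(y)$, with $\tilde u_{fi}(y)\in V_{fi}$ satisfying $a(\tilde u_{fi}(y),v)=L(v)$ for all $v\in V_{fi}$, and $\tilde u_s(y)\in V_s$ satisfying $a(\tilde u_s(y),v)=L(v)$ for all $v\in V_s$. *)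

theory Defs
  imports "HOL-Analysis.Analysis"
begin

section \<open>Lebesgue and Sobolev spaces\<close>

text \<open>Elements of \<open>L\<^sup>2\<close> and \<open>H\<^sup>1\<close> are represented by functions rather than by classes modulo null
  sets; only the values almost everywhere on \<open>S\<close> matter.\<close>

definition L2_space :: "'a::euclidean_space set \<Rightarrow> ('a \<Rightarrow> 'b::euclidean_space) set"
  where "L2_space S =
    {f. f \<in> borel_measurable (lebesgue_on S) \<and> integrable (lebesgue_on S) (\<lambda>x. (norm (f x))\<^sup>2)}"

definition L2_inner :: "'a::euclidean_space set \<Rightarrow> ('a \<Rightarrow> 'b::euclidean_space) \<Rightarrow> ('a \<Rightarrow> 'b) \<Rightarrow> real"
  where "L2_inner S f g = (LINT x|lebesgue_on S. f x \<bullet> g x)"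

definition L2_norm :: "'a::euclidean_space set \<Rightarrow> ('a \<Rightarrow> 'b::euclidean_space) \<Rightarrow> real"
  where "L2_norm S f = sqrt (L2_inner S f f)"

primrec C_k :: "nat \<Rightarrow> ('a::euclidean_space \<Rightarrow> real) \<Rightarrow> bool"
  where
    "C_k 0 f \<longleftrightarrow> continuous_on UNIV f"
  | "C_k (Suc k) f \<longleftrightarrow> f differentiable_on UNIV \<and>
       (\<forall>b\<in>Basis. C_k k (\<lambda>x. frechet_derivative f (at x) b))"

definition test_functions :: "'a::euclidean_space set \<Rightarrow> ('a \<Rightarrow> real) set"
  where "test_functions S =
    {\<phi>. (\<forall>k. C_k k \<phi>) \<and> (\<exists>K. compact K \<and> K \<subseteq> S \<and> (\<forall>x. x \<notin> K \<longrightarrow> \<phi> x = 0))}"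

definition has_weak_gradient ::
    "'a::euclidean_space set \<Rightarrow> ('a \<Rightarrow> real) \<Rightarrow> ('a \<Rightarrow> 'a) \<Rightarrow> bool"
  where "has_weak_gradient S u g \<longleftrightarrow> g \<in> L2_space S \<and>
    (\<forall>\<phi>\<in>test_functions S. \<forall>b\<in>Basis.
       L2_inner S u (\<lambda>x. frechet_derivative \<phi> (at x) b) = - L2_inner S (\<lambda>x. g x \<bullet> b) \<phi>)"

text \<open>For open \<open>S\<close> the weak gradient is unique up to a null set.\<close>

definition weak_gradient :: "'a::euclidean_space set \<Rightarrow> ('a \<Rightarrow> real) \<Rightarrow> 'a \<Rightarrow> 'a"
  where "weak_gradient S u = (SOME g. has_weak_gradient S u g)"

definition H1_space :: "'a::euclidean_space set \<Rightarrow> ('a \<Rightarrow> real) set"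
  where "H1_space S = {u \<in> L2_space S. \<exists>g. has_weak_gradient S u g}"

definition H1_norm :: "'a::euclidean_space set \<Rightarrow> ('a \<Rightarrow> real) \<Rightarrow> real"
  where "H1_norm S u = sqrt ((L2_norm S u)\<^sup>2 + (L2_norm S (weak_gradient S u))\<^sup>2)"

text \<open>\<open>H\<^sup>1\<^sub>0\<close> is the closure of the test functions in \<open>H\<^sup>1\<close>.\<close>

definition H10_space :: "'a::euclidean_space set \<Rightarrow> ('a \<Rightarrow> real) set"
  where "H10_space S = {u \<in> H1_space S.
    \<exists>\<phi>. (\<forall>k. \<phi> k \<in> test_functions S) \<and> (\<lambda>k. H1_norm S (\<lambda>x. \<phi> k x - u x)) \<longlonglongrightarrow> 0}"


section \<open>The domain and the bilinear form\<close>

definition Omega_sub :: "nat \<Rightarrow> (real \<times> real) set"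
  where "Omega_sub i = {real i - 1<..<real i} \<times> {0<..<1}"

definition Omega :: "nat \<Rightarrow> (real \<times> real) set"
  where "Omega N = interior (\<Union>i\<in>{1..N}. closure (Omega_sub i))"

lemma Omega_eq: "Omega N = {0<..<real N} \<times> {0<..<1}"
proof -
  have "(\<Union>i\<in>{1..N}. closure (Omega_sub i)) = (\<Union>i\<in>{1..N}. {real i - 1..real i}) \<times> {0..1}"
    by (auto simp: Omega_sub_def closure_Times)
  also have "interior \<dots> = {0<..<real N} \<times> {0<..<1}"
  proof (cases "N = 0")
    case True
    then show ?thesis by simp
  next
    case False
    have "\<exists>i\<in>{1..N}. real i - 1 \<le> x \<and> x \<le> real i" if "0 \<le> x" "x \<le> real N" for x :: real
    proof (cases "x = 0")
      case True
      then show ?thesis using False by (intro bexI[of _ 1]) auto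
    next
      case neq: False
      have "1 \<le> nat \<lceil>x\<rceil>" "nat \<lceil>x\<rceil> \<le> N" "real (nat \<lceil>x\<rceil>) - 1 \<le> x" "x \<le> real (nat \<lceil>x\<rceil>)"
        using that neq by linarith+
      then show ?thesis by (intro bexI[of _ "nat \<lceil>x\<rceil>"]) auto
    qed
    then have "(\<Union>i\<in>{1..N}. {real i - 1..real i}) = {0..real N}"
      by (fastforce simp: Bex_def)
    then show ?thesis by (simp add: interior_Times)
  qed
  finally show ?thesis by (simp add: Omega_def)
qed

definition bilinear_form ::
    "nat \<Rightarrow> (nat \<Rightarrow> real) \<Rightarrow> (real \<times> real \<Rightarrow> real) \<Rightarrow> (real \<times> real \<Rightarrow> real) \<Rightarrow> real"
  where "bilinear_form N y z v =
    (\<Sum>i=1..N. y i * L2_inner (Omega_sub i) (weak_gradient (Omega N) z) (weak_gradient (Omega N) v))"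

definition energy_norm :: "nat \<Rightarrow> (nat \<Rightarrow> real) \<Rightarrow> (real \<times> real \<Rightarrow> real) \<Rightarrow> real"
  where "energy_norm N y v = sqrt (bilinear_form N y v v)"


section \<open>Traces and the interface spaces\<close>

text \<open>Functions on the interface \<open>\<Gamma>\<^sub>i = {i} \<times> [0,1]\<close> between subdomains \<open>i\<close> and \<open>i + 1\<close> are
  identified with functions of the second coordinate on \<open>(0,1)\<close>. The trace of \<open>u \<in> H\<^sup>1\<^sub>0(\<Omega>)\<close> is the
  value at \<open>u\<close> of the continuous extension of \<open>\<phi> \<mapsto> \<phi>(i, \<cdot>)\<close> from test functions to \<open>H\<^sup>1\<^sub>0(\<Omega>)\<close>,
  with values in \<open>L\<^sup>2(0,1)\<close>; it is a relation since it is unique only up to a null set.\<close>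

definition has_trace :: "nat \<Rightarrow> nat \<Rightarrow> (real \<times> real \<Rightarrow> real) \<Rightarrow> (real \<Rightarrow> real) \<Rightarrow> bool"
  where "has_trace N i u g \<longleftrightarrow> u \<in> H10_space (Omega N) \<and> g \<in> L2_space {0<..<1} \<and>
    (\<exists>\<phi>. (\<forall>k. \<phi> k \<in> test_functions (Omega N)) \<and>
         (\<lambda>k. H1_norm (Omega N) (\<lambda>x. \<phi> k x - u x)) \<longlonglongrightarrow> 0 \<and>
         (\<lambda>k. L2_norm {0<..<1} (\<lambda>t. \<phi> k (real i, t) - g t)) \<longlonglongrightarrow> 0)"

definition H_half_00 :: "nat \<Rightarrow> nat \<Rightarrow> (real \<Rightarrow> real) set"
  where "H_half_00 N i = {g. \<exists>u. has_trace N i u g}"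

definition Y_slow :: "nat \<Rightarrow> (real \<Rightarrow> real) set"
  where "Y_slow ns = {g. \<exists>\<alpha>::nat \<Rightarrow> real. g = (\<lambda>t. \<Sum>n=1..ns. \<alpha> n * sin (pi * real n * t))}"

text \<open>The infinite sine series converges in \<open>L\<^sup>2(0,1)\<close>.\<close>

definition Y_fast :: "nat \<Rightarrow> nat \<Rightarrow> nat \<Rightarrow> (real \<Rightarrow> real) set"
  where "Y_fast N ns i = {g \<in> H_half_00 N i. \<exists>\<alpha>::nat \<Rightarrow> real.
    (\<lambda>k. L2_norm {0<..<1} (\<lambda>t. (\<Sum>n=ns+1..k. \<alpha> n * sin (pi * real n * t)) - g t)) \<longlonglongrightarrow> 0}"

definition V_sub :: "nat \<Rightarrow> (real \<times> real \<Rightarrow> real) set"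
  where "V_sub j = {v. \<exists>w\<in>H10_space (Omega_sub j). v = (\<lambda>x. if x \<in> Omega_sub j then w x else 0)}"

definition V_Gamma :: "nat \<Rightarrow> (real \<times> real \<Rightarrow> real) set"
  where "V_Gamma N = {u \<in> H10_space (Omega N). \<forall>j\<in>{1..N}. \<forall>v\<in>V_sub j.
    L2_inner (Omega N) (weak_gradient (Omega N) u) (weak_gradient (Omega N) v) = 0}"

definition V_fast_i :: "nat \<Rightarrow> nat \<Rightarrow> nat \<Rightarrow> (real \<times> real \<Rightarrow> real) set"
  where "V_fast_i N ns i = {v \<in> V_Gamma N. (\<exists>g\<in>Y_fast N ns i. has_trace N i v g) \<and>
    (\<forall>j\<in>{1..N-1}. j \<noteq> i \<longrightarrow> has_trace N j v (\<lambda>_. 0))}"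

definition V_slow_i :: "nat \<Rightarrow> nat \<Rightarrow> nat \<Rightarrow> (real \<times> real \<Rightarrow> real) set"
  where "V_slow_i N ns i = {v \<in> V_Gamma N. (\<exists>g\<in>Y_slow ns. has_trace N i v g) \<and>
    (\<forall>j\<in>{1..N-1}. j \<noteq> i \<longrightarrow> has_trace N j v (\<lambda>_. 0))}"

definition V_slow :: "nat \<Rightarrow> nat \<Rightarrow> (real \<times> real \<Rightarrow> real) set"
  where "V_slow N ns =
    {v. \<exists>w. (\<forall>i\<in>{1..N-1}. w i \<in> V_slow_i N ns i) \<and> v = (\<lambda>x. \<Sum>i=1..N-1. w i x)}"


section \<open>Interface solutions\<close>

definition galerkin_solution ::
    "nat \<Rightarrow> (nat \<Rightarrow> real) \<Rightarrow> (real \<times> real \<Rightarrow> real) \<Rightarrow> (real \<times> real \<Rightarrow> real) set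
      \<Rightarrow> (real \<times> real \<Rightarrow> real) \<Rightarrow> bool"
  where "galerkin_solution N y f V u \<longleftrightarrow>
    u \<in> V \<and> (\<forall>v\<in>V. bilinear_form N y u v = L2_inner (Omega N) f v)"

definition interface_solution ::
    "nat \<Rightarrow> (nat \<Rightarrow> real) \<Rightarrow> (real \<times> real \<Rightarrow> real) \<Rightarrow> (real \<times> real \<Rightarrow> real) \<Rightarrow> bool"
  where "interface_solution N y f u \<longleftrightarrow> galerkin_solution N y f (V_Gamma N) u"

definition approx_interface_solution ::
    "nat \<Rightarrow> nat \<Rightarrow> (nat \<Rightarrow> real) \<Rightarrow> (real \<times> real \<Rightarrow> real) \<Rightarrow> (real \<times> real \<Rightarrow> real) \<Rightarrow> bool"
  where "approx_interface_solution N ns y f ut \<longleftrightarrow>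
    (\<exists>uf us. (\<forall>i\<in>{1..N-1}. galerkin_solution N y f (V_fast_i N ns i) (uf i)) \<and>
             galerkin_solution N y f (V_slow N ns) us \<and>
             ut = (\<lambda>x. (\<Sum>i=1..N-1. uf i x) + us x))"

end

theory Submission
  imports Defs "HOL-Computational_Algebra.Polynomial" "HOL-Real_Asymp.Real_Asymp"
begin

text \<open>Expanding the traces on the interfaces in sines decouples the energy form on \<open>V_Gamma\<close>:
  different frequencies are orthogonal, and the block of frequency \<open>n\<close> is a tridiagonal matrix over
  the interfaces with diagonal entries proportional to \<open>(y\<^sub>i + y\<^sub>i\<^sub>+\<^sub>1) cosh (\<pi> n)\<close> and off-diagonal
  entries \<open>- y\<^sub>i\<close>. The slow part of the approximate solution solves the blocks \<open>n \<le> ns\<close> exactly; the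
  fast part solves the other blocks with the off-diagonal entries dropped. The diagonal dominates the
  rest of the block up to the factor \<open>1 / cosh (\<pi> n) \<le> 2 exp (- \<pi> n)\<close>, which bounds the relative error
  of each block in the energy norm by \<open>4 exp (- \<pi> (ns + 1))\<close>.\<close>

section \<open>Smooth functions\<close>

text \<open>Elements of \<open>V_Gamma\<close> are known only as limits of test functions, so every
  quantity is made a bounded linear functional of the gradient. The sine coefficient of a trace
  becomes the pairing of the gradient with a fixed square integrable field (\<open>coef\<close>);
  identities are checked on test functions by Green's formula and carried over by density, which
  bypasses a trace inequality. Bounds for truncated expansions are finite algebra. Removing the
  truncation needs completeness of the modes, which comes from approximation: the mixed derivative
  of a test function is approximated by polynomials times cosines and integrated back, and a
  discrete harmonic field whose coefficients vanish up to frequency K is orthogonal to all resulting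
  fields of frequency at most K. Origin of the constant, with C = cosh (\<pi> n): up to a common
  factor, a block lies between (C - 1) and (C + 1) times the weighted sum of squares
  \<open>diag\<close>, and dropping the off-diagonal entries costs 1 / C^2 in \<open>diag\<close>.
  As (C + 1) / (C - 1) \<le> 4 for C \<ge> 5/3, the squared relative error is at most 4 / C^2, so
  the relative error is at most 2 / C.\<close>

lemma C_k_SucI:
  assumes "\<And>x. (f has_derivative f' x) (at x)"
    and "\<And>b. b \<in> Basis \<Longrightarrow> C_k k (\<lambda>x. f' x b)"
  shows "C_k (Suc k) f"
proof -
  have "frechet_derivative f (at x) = f' x" for x
    using frechet_derivative_at[OF assms(1)] by simp
  then show ?thesis
    using assms by (auto simp: differentiable_on_def differentiable_def C_k.simps(2))
qed

lemma C_k_SucD: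
  assumes "C_k (Suc k) f"
  shows "(f has_derivative frechet_derivative f (at x)) (at x)"
    and "b \<in> Basis \<Longrightarrow> C_k k (\<lambda>x. frechet_derivative f (at x) b)"
  using assms by (auto simp: differentiable_on_def frechet_derivative_works)

declare C_k.simps(2) [simp del]

lemma C_k_lower: "C_k (Suc k) f \<Longrightarrow> C_k k f"
proof (induction k arbitrary: f)
  case 0
  then show ?case by (auto simp: C_k.simps(2) intro: differentiable_imp_continuous_on)
next
  case (Suc k)
  show ?case
    by (rule C_k_SucI[where f' = "\<lambda>x. frechet_derivative f (at x)"])
      (use C_k_SucD[OF Suc.prems] Suc.IH in auto)
qed

lemma C_k_continuous: "C_k k f \<Longrightarrow> continuous_on UNIV f"
  by (cases k) (auto simp: C_k.simps(2) intro: differentiable_imp_continuous_on)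

lemma C_k_const: "C_k k (\<lambda>x. c)"
proof (induction k arbitrary: c)
  case (Suc k)
  show ?case by (rule C_k_SucI[where f' = "\<lambda>x h. 0"]) (use Suc in auto)
qed auto

lemma C_k_add: "C_k k f \<Longrightarrow> C_k k g \<Longrightarrow> C_k k (\<lambda>x. f x + g x)"
proof (induction k arbitrary: f g)
  case (Suc k)
  show ?case
    by (rule C_k_SucI[where f' = "\<lambda>x h. frechet_derivative f (at x) h + frechet_derivative g (at x) h"])
      (use C_k_SucD[OF Suc.prems(1)] C_k_SucD[OF Suc.prems(2)] Suc.IH in
        \<open>auto intro!: derivative_intros\<close>)
qed (auto intro: continuous_on_add)

lemma C_k_mult: "C_k k f \<Longrightarrow> C_k k g \<Longrightarrow> C_k k (\<lambda>x. f x * g x)"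
proof (induction k arbitrary: f g)
  case (Suc k)
  show ?case
    by (rule C_k_SucI[where f' = "\<lambda>x h. f x * frechet_derivative g (at x) h
          + frechet_derivative f (at x) h * g x"])
      (use C_k_SucD[OF Suc.prems(1)] C_k_SucD[OF Suc.prems(2)] Suc.IH Suc.prems in
        \<open>auto intro!: derivative_intros C_k_add dest: C_k_lower\<close>)
qed (auto intro: continuous_on_mult)

lemma C_k_deriv:
  fixes f :: "real \<Rightarrow> real"
  assumes "\<And>x. (f has_real_derivative f' x) (at x)" and "C_k k f'"
  shows "C_k (Suc k) f"
  by (rule C_k_SucI[where f' = "\<lambda>x h. f' x * h"])
    (use assms in \<open>auto simp: has_field_derivative_def\<close>)

lemma C_k_Suc_real:
  fixes f :: "real \<Rightarrow> real"
  assumes "C_k (Suc k) f"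
  shows "(f has_real_derivative deriv f x) (at x)" and "C_k k (deriv f)"
proof -
  have d: "(f has_real_derivative deriv f x) (at x)" for x
    using C_k_SucD(1)[OF assms, of x] by (auto simp: DERIV_deriv_iff_real_differentiable differentiable_def)
  then show "(f has_real_derivative deriv f x) (at x)" .
  have "frechet_derivative f (at x) = (\<lambda>h. deriv f x * h)" for x
    using frechet_derivative_at[of f "\<lambda>h. deriv f x * h"] d[of x]
    by (simp add: has_field_derivative_def)
  then show "C_k k (deriv f)" using C_k_SucD(2)[OF assms, of 1] by simp
qed

lemma C_k_compose_linear:
  fixes \<alpha> :: "real \<Rightarrow> real" and l :: "'a::euclidean_space \<Rightarrow> real"
  assumes l: "bounded_linear l"
  shows "C_k k \<alpha> \<Longrightarrow> C_k k (\<lambda>x. \<alpha> (l x + c))"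
proof (induction k arbitrary: \<alpha>)
  case 0
  have "continuous_on UNIV (\<alpha> \<circ> (\<lambda>x. l x + c))"
    using 0 linear_continuous_on[OF l, of UNIV] by (intro continuous_on_compose)
      (auto intro!: continuous_on_add intro: continuous_on_subset)
  then show ?case by (simp add: o_def)
next
  case (Suc k)
  note d = C_k_Suc_real[OF Suc.prems]
  show ?case
  proof (rule C_k_SucI[where f' = "\<lambda>x h. deriv \<alpha> (l x + c) * l h"])
    fix x
    have "((\<lambda>x. l x + c) has_derivative l) (at x)"
      by (auto intro!: derivative_eq_intros bounded_linear_imp_has_derivative l)
    then show "((\<lambda>x. \<alpha> (l x + c)) has_derivative (\<lambda>h. deriv \<alpha> (l x + c) * l h)) (at x)"
      using has_derivative_compose[of "\<lambda>x. l x + c" l x UNIV \<alpha> "\<lambda>h. deriv \<alpha> (l x + c) * h"] d(1)[of "l x + c"]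
      by (simp add: has_field_derivative_def)
  qed (use Suc.IH[OF d(2)] in \<open>auto intro!: C_k_mult C_k_const\<close>)
qed

definition smooth :: "('a::euclidean_space \<Rightarrow> real) \<Rightarrow> bool"
  where "smooth f \<longleftrightarrow> (\<forall>k. C_k k f)"

lemma smooth_const [simp, intro]: "smooth (\<lambda>x. c)"
  and smooth_add [intro]: "smooth f \<Longrightarrow> smooth g \<Longrightarrow> smooth (\<lambda>x. f x + g x)"
  and smooth_mult [intro]: "smooth f \<Longrightarrow> smooth g \<Longrightarrow> smooth (\<lambda>x. f x * g x)"
  by (auto simp: smooth_def intro: C_k_const C_k_add C_k_mult)

lemma smooth_diff [intro]: "smooth f \<Longrightarrow> smooth g \<Longrightarrow> smooth (\<lambda>x. f x - g x)"
  using smooth_add[OF _ smooth_mult[OF smooth_const[of "-1"]], of f g] by simp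

lemma smooth_continuous: "smooth f \<Longrightarrow> continuous_on A f"
  by (auto simp: smooth_def intro: C_k_continuous continuous_on_subset)

lemma smooth_fst : "smooth \<alpha> \<Longrightarrow> smooth (\<lambda>x::real\<times>real. \<alpha> (fst x))"
  and smooth_snd : "smooth \<alpha> \<Longrightarrow> smooth (\<lambda>x::real\<times>real. \<alpha> (snd x))"
  using C_k_compose_linear[of fst _ \<alpha> 0] C_k_compose_linear[of snd _ \<alpha> 0]
  by (auto simp: smooth_def bounded_linear_fst bounded_linear_snd)

lemma smooth_affine:
  fixes \<alpha> :: "real \<Rightarrow> real"
  shows "smooth \<alpha> \<Longrightarrow> smooth (\<lambda>x. \<alpha> (c * x + d))"
  using C_k_compose_linear[of "\<lambda>x. c * x" _ \<alpha> d] by (auto simp: smooth_def bounded_linear_mult_right)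

lemma smooth_deriv:
  fixes f :: "real \<Rightarrow> real"
  assumes "smooth f"
  shows "(f has_real_derivative deriv f x) (at x)" and "smooth (deriv f)"
  using assms by (auto simp: smooth_def intro: C_k_Suc_real)

lemma smooth_if_smooth_deriv:
  fixes f :: "real \<Rightarrow> real"
  assumes "\<And>x. (f has_real_derivative f' x) (at x)" "smooth f'"
  shows "smooth f"
  using assms C_k_deriv[OF assms(1)] C_k_lower unfolding smooth_def by blast

lemma smooth_id: "smooth (\<lambda>x::real. x)"
  by (rule smooth_if_smooth_deriv[where f' = "\<lambda>_. 1"]) auto

lemma smooth_sin_cos: "smooth (sin :: real \<Rightarrow> real)" "smooth (cos :: real \<Rightarrow> real)"
proof -
  have "C_k k (sin :: real \<Rightarrow> real) \<and> C_k k (cos :: real \<Rightarrow> real)" for k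
  proof (induction k)
    case (Suc k)
    have "C_k k (\<lambda>x::real. (-1) * sin x)" using Suc by (intro C_k_mult C_k_const) auto
    then show ?case using Suc
      by (auto intro!: C_k_deriv[of sin cos] C_k_deriv[of cos "\<lambda>x. - sin x"] derivative_eq_intros
          simp del: C_k.simps)
  qed (auto intro: continuous_intros)
  then show "smooth (sin :: real \<Rightarrow> real)" "smooth (cos :: real \<Rightarrow> real)" by (auto simp: smooth_def)
qed

lemma smooth_sinh_cosh: "smooth (sinh :: real \<Rightarrow> real)" "smooth (cosh :: real \<Rightarrow> real)"
proof -
  have "C_k k (sinh :: real \<Rightarrow> real) \<and> C_k k (cosh :: real \<Rightarrow> real)" for k
  proof (induction k)
    case (Suc k)
    then show ?case
      by (auto intro!: C_k_deriv[of sinh cosh] C_k_deriv[of cosh sinh] derivative_eq_intros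
          simp del: C_k.simps)
  qed (auto intro!: continuous_intros)
  then show "smooth (sinh :: real \<Rightarrow> real)" "smooth (cosh :: real \<Rightarrow> real)" by (auto simp: smooth_def)
qed

lemma smooth_poly: "smooth (poly (p :: real poly))"
proof (induction p)
  case (pCons a p)
  then show ?case using smooth_id by (auto simp: poly_pCons)
qed simp

section \<open>Smooth cutoff functions on an interval\<close>

definition bump :: "real \<Rightarrow> real"
  where "bump x = (if 0 < x then exp (- (1 / x)) else 0)"

text \<open>The functions p(1/x) exp (-1/x) on the positive axis, extended by zero, with p any
  polynomial, are closed under differentiation: the derivative belongs to the polynomial X^2 (p -
  p'). Continuity of all of them therefore gives smoothness of all of them by induction.\<close>

lemma smooth_bump: "smooth bump"
proof -
  let ?e = "\<lambda>p x. if 0 < x then poly p (1/x) * exp (- (1 / x)) else (0::real)"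
  have lim0: "((\<lambda>t. poly p t * exp (- t)) \<longlongrightarrow> 0) at_top" for p :: "real poly"
  proof -
    have "((\<lambda>t. t ^ n * exp (- t)) \<longlongrightarrow> (0::real)) at_top" for n
      using tendsto_power_div_exp_0[of n] by (simp add: exp_minus field_simps)
    then have "((\<lambda>t. \<Sum>i\<le>degree p. coeff p i * (t ^ i * exp (- t))) \<longlongrightarrow> (\<Sum>i\<le>degree p. coeff p i * 0)) at_top"
      by (intro tendsto_intros)
    then show ?thesis by (simp add: poly_altdef sum_distrib_right mult.assoc)
  qed
  have d: "(?e p has_real_derivative ?e ([:0,0,1:] * (p - pderiv p)) x) (at x)" for p x
  proof (cases "x = 0")
    case False
    show ?thesis
    proof (cases "x > 0")
      case True
      have "((\<lambda>x. poly p (1/x) * exp (- (1 / x))) has_real_derivative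
          ?e ([:0,0,1:] * (p - pderiv p)) x) (at x)"
        using True
        by (auto intro!: derivative_eq_intros DERIV_chain2[where f = "poly p"] poly_DERIV
            simp: field_simps power2_eq_square)
      moreover have "eventually (\<lambda>y. y > 0) (nhds x)"
        using True by (intro eventually_nhds_in_open[of "{0<..}" x, simplified]) auto
      then have "eventually (\<lambda>y. ?e p y = poly p (1/y) * exp (- (1 / y))) (nhds x)"
        by eventually_elim auto
      ultimately show ?thesis by (simp only: DERIV_cong_ev[OF refl _ refl])
    next
      case neg: False
      have "eventually (\<lambda>y. y < 0) (nhds x)"
        using neg False by (intro eventually_nhds_in_open[of "{..<0}" x, simplified]) auto
      then have "eventually (\<lambda>y. ?e p y = 0) (nhds x)" by eventually_elim auto
      then show ?thesis using neg DERIV_cong_ev[OF refl _ refl, of "?e p" "\<lambda>_. 0" x 0] by simp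
    qed
  next
    case True
    \<comment> \<open>With t = 1/y the difference quotient at 0 is again a polynomial in t times exp
      (-t); dividing by y multiplies the polynomial by X, which is \<open>pCons 0 p\<close>.\<close>
    have "((\<lambda>y. ?e p y / y) \<longlongrightarrow> 0) (at_right 0)"
    proof (rule Lim_transform_eventually)
      show "((\<lambda>y. poly (pCons 0 p) (inverse y) * exp (- inverse y)) \<longlongrightarrow> 0) (at_right 0)"
        using filterlim_compose[OF lim0 filterlim_inverse_at_top_right] .
      show "\<forall>\<^sub>F y in at_right 0. poly (pCons 0 p) (inverse y) * exp (- inverse y) = ?e p y / y"
        by (rule eventually_at_rightI[of _ 1]) (auto simp: field_simps)
    qed
    moreover have "((\<lambda>y. ?e p y / y) \<longlongrightarrow> 0) (at_left 0)"
      by (rule tendsto_eventually) (auto simp: eventually_at_filter)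
    ultimately have "((\<lambda>y. ?e p y / y) \<longlongrightarrow> 0) (at 0)" by (simp add: filterlim_split_at)
    then show ?thesis using True by (simp add: DERIV_def cong: if_cong)
  qed
  have "C_k k (?e p)" for k p
  proof (induction k arbitrary: p)
    case 0
    show ?case using d[of p] by (auto intro!: continuous_at_imp_continuous_on DERIV_isCont)
  next
    case (Suc k)
    show ?case by (rule C_k_deriv[OF d]) (rule Suc)
  qed
  from this[of _ 1] have "smooth (?e 1)" by (auto simp: smooth_def)
  also have "?e 1 = bump" by (auto simp: bump_def)
  finally show ?thesis .
qed

lemma bump_bounds: "0 \<le> bump x" "bump x \<le> 1" by (auto simp: bump_def)

text \<open>The shift by 1 keeps the support at distance 1/k from both ends (and makes the function
  vanish for k = 0), while the factor k drives both arguments to infinity inside the interval, where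
  \<open>bump\<close> tends to 1.\<close>

definition plateau :: "real \<Rightarrow> real \<Rightarrow> nat \<Rightarrow> real \<Rightarrow> real"
  where "plateau a b k x = bump (real k * (x - a) - 1) * bump (real k * (b - x) - 1)"

lemma smooth_plateau: "smooth (plateau a b k)"
proof -
  have "smooth (\<lambda>x. bump (real k * x + (- real k * a - 1)) * bump (- real k * x + (real k * b - 1)))"
    by (intro smooth_mult smooth_affine smooth_bump)
  then show ?thesis by (simp add: plateau_def[abs_def] algebra_simps)
qed

lemma plateau_bounds: "0 \<le> plateau a b k x" "plateau a b k x \<le> 1"
  using bump_bounds by (auto simp: plateau_def intro: mult_le_one)

lemma plateau_support:
  assumes "x \<notin> {a + inverse (real k) .. b - inverse (real k)}"
  shows "plateau a b k x = 0"
proof (cases "k = 0")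
  case False
  have "1 \<le> real k * (x - a) \<longleftrightarrow> a + inverse (real k) \<le> x" "1 \<le> real k * (b - x) \<longleftrightarrow> x \<le> b - inverse (real k)"
    using False by (auto simp: field_simps)
  then show ?thesis using assms by (auto simp: plateau_def bump_def)
qed (simp add: plateau_def bump_def)

lemma plateau_support_outside:
  assumes "x \<notin> {a<..<b}"
  shows "plateau a b k x = 0"
proof -
  have "real k * (x - a) \<le> 0 \<or> real k * (b - x) \<le> 0"
    using assms by (auto simp: mult_nonneg_nonpos)
  then show ?thesis by (auto simp: plateau_def bump_def)
qed

lemma plateau_tendsto:
  assumes "x \<in> {a<..<b}"
  shows "(\<lambda>k. plateau a b k x) \<longlonglongrightarrow> 1"
proof -
  have "(\<lambda>k. bump (real k * c - 1)) \<longlonglongrightarrow> 1" if "c > 0" for c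
  proof -
    have top: "filterlim (\<lambda>k. real k * c - 1) at_top sequentially"
      using that by real_asymp
    have "((\<lambda>x::real. exp (- (1/x))) \<longlongrightarrow> 1) at_top" by real_asymp
    then have "(bump \<longlongrightarrow> 1) at_top"
      by (rule Lim_transform_eventually)
        (use eventually_gt_at_top[of 0] in eventually_elim, auto simp: bump_def)
    from filterlim_compose[OF this top] show ?thesis .
  qed
  from tendsto_mult[OF this[of "x - a"] this[of "b - x"]] assms show ?thesis
    by (simp add: plateau_def)
qed

section \<open>Square integrable functions\<close>

lemma L2_measurable: "f \<in> L2_space S \<Longrightarrow> f \<in> borel_measurable (lebesgue_on S)"
  by (simp add: L2_space_def)

lemma L2_integrable_inner:
  assumes "f \<in> L2_space S" "g \<in> L2_space S"
  shows "integrable (lebesgue_on S) (\<lambda>x. f x \<bullet> g x)"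
proof (rule Bochner_Integration.integrable_bound)
  show "integrable (lebesgue_on S) (\<lambda>x. (norm (f x))\<^sup>2 + (norm (g x))\<^sup>2)"
    using assms by (auto simp: L2_space_def)
  have "norm (f x \<bullet> g x) \<le> norm ((norm (f x))\<^sup>2 + (norm (g x))\<^sup>2)" for x
  proof -
    have "norm (f x \<bullet> g x) \<le> norm (f x) * norm (g x)" by (simp add: Cauchy_Schwarz_ineq2)
    also have "\<dots> \<le> (norm (f x))\<^sup>2 + (norm (g x))\<^sup>2"
      using sum_squares_bound[of "norm (f x)" "norm (g x)"] mult_nonneg_nonneg[of "norm (f x)" "norm (g x)"]
      using norm_ge_zero[of "f x"] norm_ge_zero[of "g x"] by linarith
    finally show ?thesis by simp
  qed
  then show "AE x in lebesgue_on S. norm (f x \<bullet> g x) \<le> norm ((norm (f x))\<^sup>2 + (norm (g x))\<^sup>2)"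
    by simp
qed (use assms in \<open>auto simp: L2_space_def\<close>)

lemma L2_scaleR: "f \<in> L2_space S \<Longrightarrow> (\<lambda>x. c *\<^sub>R f x) \<in> L2_space S"
  by (auto simp: L2_space_def power_mult_distrib)

lemma L2_add:
  assumes "f \<in> L2_space S" "g \<in> L2_space S"
  shows "(\<lambda>x. f x + g x) \<in> L2_space S"
proof -
  have "(norm (f x + g x))\<^sup>2 = (norm (f x))\<^sup>2 + 2 * (f x \<bullet> g x) + (norm (g x))\<^sup>2" for x
    unfolding power2_norm_eq_inner inner_add_left inner_add_right by (simp add: inner_commute)
  then show ?thesis
    using assms L2_integrable_inner[OF assms] by (auto simp: L2_space_def)
qed

lemma L2_diff: "f \<in> L2_space S \<Longrightarrow> g \<in> L2_space S \<Longrightarrow> (\<lambda>x. f x - g x) \<in> L2_space S"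
  using L2_add[OF _ L2_scaleR[of g S "-1"], of f] by simp

lemma L2_zero: "(\<lambda>x. 0) \<in> L2_space S"
  by (auto simp: L2_space_def)

lemma L2_sum: "(\<And>i. i \<in> I \<Longrightarrow> f i \<in> L2_space S) \<Longrightarrow> (\<lambda>x. \<Sum>i\<in>I. f i x) \<in> L2_space S"
  by (induction I rule: infinite_finite_induct) (auto intro: L2_zero L2_add)

lemma L2_component:
  assumes "f \<in> L2_space S"
  shows "(\<lambda>x. f x \<bullet> b) \<in> L2_space S"
proof -
  have "integrable (lebesgue_on S) (\<lambda>x. (f x \<bullet> b)\<^sup>2)"
  proof (rule Bochner_Integration.integrable_bound)
    show "integrable (lebesgue_on S) (\<lambda>x. (norm b)\<^sup>2 * (norm (f x))\<^sup>2)"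
      using assms by (auto simp: L2_space_def)
    have "norm ((f x \<bullet> b)\<^sup>2) \<le> norm ((norm b)\<^sup>2 * (norm (f x))\<^sup>2)" for x
      using power_mono[OF Cauchy_Schwarz_ineq2[of "f x" b], of 2]
      by (simp add: power_mult_distrib mult.commute)
    then show "AE x in lebesgue_on S. norm ((f x \<bullet> b)\<^sup>2) \<le> norm ((norm b)\<^sup>2 * (norm (f x))\<^sup>2)"
      by simp
  qed (use assms in \<open>auto simp: L2_space_def\<close>)
  then show ?thesis using assms by (auto simp: L2_space_def)
qed

lemma L2_inner_commute: "L2_inner S f g = L2_inner S g f"
  by (simp add: L2_inner_def inner_commute)

lemma L2_inner_add_left:
  assumes "f \<in> L2_space S" "g \<in> L2_space S" "h \<in> L2_space S"
  shows "L2_inner S (\<lambda>x. f x + g x) h = L2_inner S f h + L2_inner S g h"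
  using assms by (simp add: L2_inner_def inner_add_left L2_integrable_inner)

lemma L2_inner_scaleR_left: "L2_inner S (\<lambda>x. c *\<^sub>R f x) h = c * L2_inner S f h"
  by (simp add: L2_inner_def)

lemma L2_inner_diff_left:
  assumes "f \<in> L2_space S" "g \<in> L2_space S" "h \<in> L2_space S"
  shows "L2_inner S (\<lambda>x. f x - g x) h = L2_inner S f h - L2_inner S g h"
  using assms by (simp add: L2_inner_def inner_diff_left L2_integrable_inner)

lemma L2_inner_sum_left:
  assumes "\<And>i. i \<in> I \<Longrightarrow> f i \<in> L2_space S" "h \<in> L2_space S"
  shows "L2_inner S (\<lambda>x. \<Sum>i\<in>I. f i x) h = (\<Sum>i\<in>I. L2_inner S (f i) h)"
  using assms by (simp add: L2_inner_def inner_sum_left L2_integrable_inner)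

lemma L2_inner_nonneg: "0 \<le> L2_inner S f f"
  by (simp add: L2_inner_def)

lemma L2_norm_power2: "(L2_norm S f)\<^sup>2 = L2_inner S f f"
  and L2_norm_nonneg: "0 \<le> L2_norm S f"
  by (auto simp: L2_norm_def L2_inner_nonneg)

text \<open>The discriminant argument behind the Cauchy-Schwarz inequality, stated for bare numbers
  so that it serves both the L2 inner product and the energy form.\<close>

lemma abs_le_sqrt_mult_if_quadratic_nonneg:
  fixes a b c :: real
  assumes c: "0 \<le> c" and nn: "\<And>t. 0 \<le> a - 2 * t * b + t\<^sup>2 * c"
  shows "\<bar>b\<bar> \<le> sqrt a * sqrt c"
proof -
  have "b\<^sup>2 \<le> a * c"
  proof (cases "c = 0")
    case True
    have "b = 0"
    proof (rule ccontr)
      assume "b \<noteq> 0"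
      \<comment> \<open>For c = 0 the lower bound is affine in t; this t gives it the value
        -1.\<close>
      then have "2 * ((a + 1) / (2 * b)) * b = a + 1" by simp
      then show False using nn[of "(a + 1) / (2 * b)"] True by simp
    qed
    then show ?thesis using True by simp
  next
    case False
    then have "c > 0" using c by simp
    have "2 * (b / c) * b = 2 * (b\<^sup>2 / c)" "(b / c)\<^sup>2 * c = b\<^sup>2 / c"
      using False by (simp_all add: power2_eq_square)
    then have "b\<^sup>2 / c \<le> a" using nn[of "b / c"] by linarith
    then show ?thesis using \<open>c > 0\<close> by (simp add: pos_divide_le_eq)
  qed
  then have "sqrt (b\<^sup>2) \<le> sqrt (a * c)" by (rule real_sqrt_le_mono)
  then show ?thesis by (simp add: real_sqrt_mult)
qed

lemma L2_Cauchy_Schwarz: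
  assumes f: "f \<in> L2_space S" and g: "g \<in> L2_space S"
  shows "\<bar>L2_inner S f g\<bar> \<le> L2_norm S f * L2_norm S g"
  unfolding L2_norm_def
proof (rule abs_le_sqrt_mult_if_quadratic_nonneg[OF L2_inner_nonneg])
  fix t
  have "0 \<le> L2_inner S (\<lambda>x. f x - t *\<^sub>R g x) (\<lambda>x. f x - t *\<^sub>R g x)" by (rule L2_inner_nonneg)
  also have "\<dots> = L2_inner S f f - 2 * t * L2_inner S f g + t\<^sup>2 * L2_inner S g g"
    using L2_integrable_inner[OF f f] L2_integrable_inner[OF f g] L2_integrable_inner[OF g g]
    by (simp add: L2_inner_def inner_diff_left inner_diff_right inner_commute[of "g _" "f _"]
        algebra_simps power2_eq_square)
  finally show "0 \<le> L2_inner S f f - 2 * t * L2_inner S f g + t\<^sup>2 * L2_inner S g g" .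
qed

lemma L2_norm_triangle:
  assumes f: "f \<in> L2_space S" and g: "g \<in> L2_space S"
  shows "L2_norm S (\<lambda>x. f x + g x) \<le> L2_norm S f + L2_norm S g"
proof (rule power2_le_imp_le)
  have "(L2_norm S (\<lambda>x. f x + g x))\<^sup>2 = (L2_norm S f)\<^sup>2 + 2 * L2_inner S f g + (L2_norm S g)\<^sup>2"
    using L2_integrable_inner[OF f f] L2_integrable_inner[OF f g] L2_integrable_inner[OF g g]
    by (simp add: L2_norm_power2, simp add: L2_inner_def inner_add_left inner_add_right inner_commute[of "g _" "f _"])
  also have "\<dots> \<le> (L2_norm S f + L2_norm S g)\<^sup>2"
    using L2_Cauchy_Schwarz[OF f g] by (simp add: power2_sum)
  finally show "(L2_norm S (\<lambda>x. f x + g x))\<^sup>2 \<le> (L2_norm S f + L2_norm S g)\<^sup>2" .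
qed (simp add: L2_norm_nonneg)

lemma L2_norm_scaleR: "L2_norm S (\<lambda>x. c *\<^sub>R f x) = \<bar>c\<bar> * L2_norm S f"
  by (simp add: L2_norm_def L2_inner_def real_sqrt_mult mult.assoc[symmetric])

lemma L2_tendsto_add:
  assumes "\<And>k. f k \<in> L2_space S" "\<And>k. g k \<in> L2_space S" "F \<in> L2_space S" "G \<in> L2_space S"
    and "(\<lambda>k. L2_norm S (\<lambda>x. f k x - F x)) \<longlonglongrightarrow> 0" "(\<lambda>k. L2_norm S (\<lambda>x. g k x - G x)) \<longlonglongrightarrow> 0"
  shows "(\<lambda>k. L2_norm S (\<lambda>x. (f k x + g k x) - (F x + G x))) \<longlonglongrightarrow> 0"
proof (rule tendsto_sandwich[OF _ _ tendsto_const])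
  show "(\<lambda>k. L2_norm S (\<lambda>x. f k x - F x) + L2_norm S (\<lambda>x. g k x - G x)) \<longlonglongrightarrow> 0"
    using tendsto_add[OF assms(5,6)] by simp
  have "L2_norm S (\<lambda>x. (f k x + g k x) - (F x + G x)) \<le> L2_norm S (\<lambda>x. f k x - F x) + L2_norm S (\<lambda>x. g k x - G x)" for k
    using L2_norm_triangle[OF L2_diff[OF assms(1,3)] L2_diff[OF assms(2,4)], of k k]
    by (simp add: algebra_simps)
  then show "\<forall>\<^sub>F k in sequentially. L2_norm S (\<lambda>x. (f k x + g k x) - (F x + G x))
      \<le> L2_norm S (\<lambda>x. f k x - F x) + L2_norm S (\<lambda>x. g k x - G x)" by simp
qed (simp add: L2_norm_nonneg)

lemma L2_tendsto_scaleR: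
  assumes "(\<lambda>k. L2_norm S (\<lambda>x. f k x - F x)) \<longlonglongrightarrow> 0"
  shows "(\<lambda>k. L2_norm S (\<lambda>x. c *\<^sub>R f k x - c *\<^sub>R F x)) \<longlonglongrightarrow> 0"
  using tendsto_mult[OF tendsto_const[of "\<bar>c\<bar>"] assms]
  by (simp add: L2_norm_scaleR flip: scaleR_diff_right)

lemma L2_tendsto_inner:
  assumes f: "\<And>k. f k \<in> L2_space S" "F \<in> L2_space S" and g: "g \<in> L2_space S"
    and lim: "(\<lambda>k. L2_norm S (\<lambda>x. f k x - F x)) \<longlonglongrightarrow> 0"
  shows "(\<lambda>k. L2_inner S (f k) g) \<longlonglongrightarrow> L2_inner S F g"
proof -
  have "(\<lambda>k. L2_inner S (f k) g - L2_inner S F g) \<longlonglongrightarrow> 0"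
  proof (rule Lim_null_comparison)
    show "\<forall>\<^sub>F k in sequentially. norm (L2_inner S (f k) g - L2_inner S F g)
        \<le> L2_norm S (\<lambda>x. f k x - F x) * L2_norm S g"
      using L2_Cauchy_Schwarz[OF L2_diff[OF f] g] by (simp add: L2_inner_diff_left f g)
    show "(\<lambda>k. L2_norm S (\<lambda>x. f k x - F x) * L2_norm S g) \<longlonglongrightarrow> 0"
      using tendsto_mult[OF lim tendsto_const[of "L2_norm S g"]] by simp
  qed
  then show ?thesis by (simp add: LIM_zero_iff)
qed

lemma L2_inner_cong_AE:
  assumes "f \<in> borel_measurable (lebesgue_on S)" "f' \<in> borel_measurable (lebesgue_on S)"
    "g \<in> borel_measurable (lebesgue_on S)" "g' \<in> borel_measurable (lebesgue_on S)"
    "AE x in lebesgue_on S. f x = f' x" "AE x in lebesgue_on S. g x = g' x"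
  shows "L2_inner S f g = L2_inner S f' g'"
  unfolding L2_inner_def
proof (rule integral_cong_AE)
  show "AE x in lebesgue_on S. f x \<bullet> g x = f' x \<bullet> g' x" using assms(5,6) by eventually_elim simp
qed (use assms(1-4) in auto)

lemma L2_norm_cong_AE:
  assumes "f \<in> borel_measurable (lebesgue_on S)" "f' \<in> borel_measurable (lebesgue_on S)"
    "AE x in lebesgue_on S. f x = f' x"
  shows "L2_norm S f = L2_norm S f'"
  unfolding L2_norm_def using L2_inner_cong_AE[OF assms(1,2,1,2,3,3)] by simp

lemma L2_space_bounded:
  assumes "S \<in> lmeasurable" "f \<in> borel_measurable (lebesgue_on S)"
    "AE x in lebesgue_on S. norm (f x) \<le> B"
  shows "f \<in> L2_space S"
proof -
  have fin: "finite_measure (lebesgue_on S)"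
    using assms(1) by (simp add: fmeasurableD2 finite_measure_lebesgue_on)
  have "integrable (lebesgue_on S) (\<lambda>x. (norm (f x))\<^sup>2)"
  proof (rule finite_measure.integrable_const_bound[OF fin, where B = "B\<^sup>2"])
    show "AE x in lebesgue_on S. norm ((norm (f x))\<^sup>2) \<le> B\<^sup>2"
      using assms(3) by eventually_elim (auto intro: power_mono)
  qed (use assms(2) in auto)
  then show ?thesis using assms(2) by (auto simp: L2_space_def)
qed

text \<open>On a set of finite measure a uniform pointwise bound is square integrable, so the
  constant serves as the dominating function.\<close>

lemma L2_dominated_convergence:
  assumes S: "S \<in> lmeasurable" and f: "\<And>k. f k \<in> borel_measurable (lebesgue_on S)"
    and F: "F \<in> borel_measurable (lebesgue_on S)"
    and bd: "\<And>k x. x \<in> S \<Longrightarrow> norm (f k x) \<le> B"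
    and lim: "AE x in lebesgue_on S. (\<lambda>k. f k x) \<longlonglongrightarrow> F x"
  shows "F \<in> L2_space S" and "(\<lambda>k. L2_norm S (\<lambda>x. f k x - F x)) \<longlonglongrightarrow> 0"
proof -
  have fin: "finite_measure (lebesgue_on S)"
    using S by (simp add: fmeasurableD2 finite_measure_lebesgue_on)
  have sp: "space (lebesgue_on S) = S" by simp
  have FB: "AE x in lebesgue_on S. x \<in> S \<longrightarrow> norm (F x) \<le> B"
    using lim
  proof eventually_elim
    case (elim x)
    show ?case
      using Lim_bounded[OF tendsto_norm[OF elim], of 0 B] bd[of x] by blast
  qed
  then have FB': "AE x in lebesgue_on S. norm (F x) \<le> B"
    using AE_space[of "lebesgue_on S"] by eventually_elim simp
  show "F \<in> L2_space S" by (rule L2_space_bounded[OF S F FB'])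
  have "(\<lambda>k. LINT x|lebesgue_on S. (f k x - F x) \<bullet> (f k x - F x)) \<longlonglongrightarrow> (LINT x|lebesgue_on S. 0)"
  proof (rule integral_dominated_convergence)
    show "integrable (lebesgue_on S) (\<lambda>x. (2 * B)\<^sup>2)"
      using fin by (simp add: finite_measure.integrable_const)
    show "AE x in lebesgue_on S. (\<lambda>k. (f k x - F x) \<bullet> (f k x - F x)) \<longlonglongrightarrow> 0"
      using lim
    proof eventually_elim
      case (elim x)
      then have "(\<lambda>k. f k x - F x) \<longlonglongrightarrow> 0" by (simp add: LIM_zero)
      from tendsto_inner[OF this this] show ?case by simp
    qed
    fix k
    show "AE x in lebesgue_on S. norm ((f k x - F x) \<bullet> (f k x - F x)) \<le> (2 * B)\<^sup>2"
      using FB' AE_space[of "lebesgue_on S"]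
    proof eventually_elim
      case (elim x)
      have "norm (f k x - F x) \<le> 2 * B"
        using norm_triangle_ineq4[of "f k x" "F x"] elim bd[of x k] by simp
      from power_mono[OF this, of 2] show ?case by (simp add: power2_norm_eq_inner)
    qed
  qed (use f F in auto)
  then have "(\<lambda>k. sqrt (L2_inner S (\<lambda>x. f k x - F x) (\<lambda>x. f k x - F x))) \<longlonglongrightarrow> sqrt 0"
    by (intro tendsto_real_sqrt) (simp add: L2_inner_def)
  then show "(\<lambda>k. L2_norm S (\<lambda>x. f k x - F x)) \<longlonglongrightarrow> 0" by (simp add: L2_norm_def)
qed

lemma L2_inner_superset:
  assumes "T \<subseteq> S" "T \<in> sets lebesgue" "S \<in> sets lebesgue" "\<And>x. x \<in> S - T \<Longrightarrow> f x \<bullet> g x = 0"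
  shows "L2_inner S f g = L2_inner T f g"
  unfolding L2_inner_def using assms
  by (auto simp: integral_restrict_space indicator_def intro!: Bochner_Integration.integral_cong)

lemma L2_norm_superset:
  assumes "T \<subseteq> S" "T \<in> sets lebesgue" "S \<in> sets lebesgue" "\<And>x. x \<in> S - T \<Longrightarrow> f x = 0"
  shows "L2_norm S f = L2_norm T f"
  unfolding L2_norm_def using assms by (subst L2_inner_superset[of T S]) auto

lemma measurable_lebesgue_on_subset:
  "T \<subseteq> S \<Longrightarrow> f \<in> borel_measurable (lebesgue_on S) \<Longrightarrow> f \<in> borel_measurable (lebesgue_on T)"
  by (rule measurable_restrict_mono)

lemma L2_subset:
  assumes "T \<subseteq> S" "T \<in> sets lebesgue" "S \<in> sets lebesgue" "f \<in> L2_space S"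
  shows "f \<in> L2_space T"
proof -
  have "set_integrable lebesgue S (\<lambda>x. (norm (f x))\<^sup>2)"
    using assms by (auto simp: L2_space_def set_integrable_def integrable_restrict_space)
  then have "set_integrable lebesgue T (\<lambda>x. (norm (f x))\<^sup>2)"
    using set_integrable_subset assms by blast
  then have "integrable (lebesgue_on T) (\<lambda>x. (norm (f x))\<^sup>2)"
    using assms(2) by (simp add: set_integrable_def integrable_restrict_space)
  moreover have "f \<in> borel_measurable (lebesgue_on T)"
    by (rule measurable_lebesgue_on_subset[OF assms(1) L2_measurable[OF assms(4)]])
  ultimately show ?thesis by (simp add: L2_space_def)
qed

lemma L2_zero_extension:
  assumes "T \<subseteq> S" "T \<in> sets lebesgue" "S \<in> sets lebesgue" "f \<in> L2_space T"
  shows "(\<lambda>x. if x \<in> T then f x else 0) \<in> L2_space S"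
proof -
  have "(\<lambda>x. if x \<in> T then f x else 0) \<in> borel_measurable lebesgue"
    using assms L2_measurable[OF assms(4)] by (simp add: borel_measurable_if)
  then have m: "(\<lambda>x. if x \<in> T then f x else 0) \<in> borel_measurable (lebesgue_on S)"
    by (rule measurable_restrict_space1)
  have "integrable lebesgue (\<lambda>x. indicator T x *\<^sub>R (norm (f x))\<^sup>2)"
    using assms by (auto simp: L2_space_def integrable_restrict_space)
  moreover have "(\<lambda>x. indicator S x *\<^sub>R (norm (if x \<in> T then f x else 0))\<^sup>2) = (\<lambda>x. indicator T x *\<^sub>R (norm (f x))\<^sup>2)"
    using assms(1) by (auto simp: indicator_def fun_eq_iff)
  ultimately show ?thesis using m assms(3) by (simp add: L2_space_def integrable_restrict_space)
qed

lemma AE_lebesgue_on_subset: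
  assumes "T \<subseteq> S" "T \<in> sets lebesgue" "S \<in> sets lebesgue" "AE x in lebesgue_on S. P x"
  shows "AE x in lebesgue_on T. P x"
proof -
  have "AE x in lebesgue. x \<in> S \<longrightarrow> P x" using assms(3,4) by (simp add: AE_restrict_space_iff)
  then have "AE x in lebesgue. x \<in> T \<longrightarrow> P x" by eventually_elim (use assms(1) in auto)
  then show ?thesis using assms(2) by (simp add: AE_restrict_space_iff)
qed

lemma L2_norm_subset:
  assumes "T \<subseteq> S" "T \<in> sets lebesgue" "S \<in> sets lebesgue" "f \<in> L2_space S"
  shows "L2_norm T f \<le> L2_norm S f"
proof -
  have T: "f \<in> L2_space T" by (rule L2_subset[OF assms])
  have i: "integrable lebesgue (\<lambda>x. indicator T x *\<^sub>R (f x \<bullet> f x))"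
    "integrable lebesgue (\<lambda>x. indicator S x *\<^sub>R (f x \<bullet> f x))"
    using L2_integrable_inner[OF T T] L2_integrable_inner[OF assms(4,4)] assms(2,3)
    by (simp_all add: integrable_restrict_space)
  have "(\<integral>x. indicator T x *\<^sub>R (f x \<bullet> f x) \<partial>lebesgue) \<le> (\<integral>x. indicator S x *\<^sub>R (f x \<bullet> f x) \<partial>lebesgue)"
    by (rule integral_mono[OF i]) (use assms(1) in \<open>auto simp: indicator_def\<close>)
  then have "L2_inner T f f \<le> L2_inner S f f"
    using assms(2,3) by (simp add: L2_inner_def integral_restrict_space)
  then show ?thesis by (simp add: L2_norm_def)
qed

section \<open>Weak gradients on rectangles\<close>

text \<open>Both \<open>Omega N\<close> and every \<open>Omega_sub j\<close> are of this form, so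
  one theory of gradients and zero boundary values covers the whole domain and the
  subdomains.\<close>

definition rect :: "real \<Rightarrow> real \<Rightarrow> (real \<times> real) set"
  where "rect a b = {a<..<b} \<times> {0<..<1}"

lemma box_real_pair: "box (a, c) (b, d) = {a<..<b} \<times> {c<..<(d::real)}" for a b :: real
  by (auto simp: box_prod)

lemma rect_eq_box: "rect a b = box (a, 0) (b, 1)"
  by (simp add: rect_def box_real_pair)

lemma rect_measurable [simp, intro]: "rect a b \<in> sets lebesgue" "rect a b \<in> lmeasurable"
  by (simp_all add: rect_eq_box)

lemma rect_mono: "a' \<le> a \<Longrightarrow> b \<le> b' \<Longrightarrow> rect a b \<subseteq> rect a' b'"
  by (auto simp: rect_def)

lemma borel_measurable_lebesgue_on:
  "f \<in> borel_measurable borel \<Longrightarrow> f \<in> borel_measurable (lebesgue_on S)"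
  by (intro measurable_restrict_space1 measurable_completion) simp

lemma continuous_measurable_lebesgue_on:
  "continuous_on UNIV f \<Longrightarrow> f \<in> borel_measurable (lebesgue_on S)"
  by (intro borel_measurable_lebesgue_on borel_measurable_continuous_onI)

lemma Basis_real_pair: "(Basis :: (real \<times> real) set) = {(1, 0), (0, 1)}"
  by (auto simp: Basis_prod_def)

definition grad :: "(real \<times> real \<Rightarrow> real) \<Rightarrow> real \<times> real \<Rightarrow> real \<times> real"
  where "grad \<phi> x = (frechet_derivative \<phi> (at x) (1, 0), frechet_derivative \<phi> (at x) (0, 1))"

lemma inner_grad: "b \<in> Basis \<Longrightarrow> frechet_derivative \<phi> (at x) b = grad \<phi> x \<bullet> b"
  by (auto simp: Basis_real_pair grad_def)

lemma grad_eqI: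
  assumes "(\<phi> has_derivative (\<lambda>h. g \<bullet> h)) (at x)"
  shows "grad \<phi> x = g"
  using frechet_derivative_at[OF assms, symmetric] by (cases g) (simp add: grad_def)

lemma smooth_grad:
  assumes "smooth (\<phi> :: real \<times> real \<Rightarrow> real)"
  shows "(\<phi> has_derivative (\<lambda>h. grad \<phi> x \<bullet> h)) (at x)"
    and "smooth (\<lambda>x. fst (grad \<phi> x))" and "smooth (\<lambda>x. snd (grad \<phi> x))"
    and "continuous_on A (grad \<phi>)"
proof -
  note * = C_k_SucD[OF assms[unfolded smooth_def, rule_format]]
  have "frechet_derivative \<phi> (at x) = (\<lambda>h. grad \<phi> x \<bullet> h)"
  proof
    fix h :: "real \<times> real"
    interpret linear "frechet_derivative \<phi> (at x)"
      using *(1)[where x = x] by (rule has_derivative_linear)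
    have "frechet_derivative \<phi> (at x) h =
        frechet_derivative \<phi> (at x) (fst h *\<^sub>R (1, 0) + snd h *\<^sub>R (0, 1))"
      by (simp add: scaleR_Pair)
    then show "frechet_derivative \<phi> (at x) h = grad \<phi> x \<bullet> h"
      by (simp only: add scaleR) (simp add: grad_def inner_prod_def mult.commute)
  qed
  then show "(\<phi> has_derivative (\<lambda>h. grad \<phi> x \<bullet> h)) (at x)" using *(1)[where x = x] by simp
  show s: "smooth (\<lambda>x. fst (grad \<phi> x))" "smooth (\<lambda>x. snd (grad \<phi> x))"
    using *(2) by (auto simp: smooth_def grad_def Basis_real_pair)
  have "continuous_on A (\<lambda>x. (fst (grad \<phi> x), snd (grad \<phi> x)))"
    by (intro continuous_on_Pair smooth_continuous s)
  then show "continuous_on A (grad \<phi>)" by simp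
qed

lemma test_smooth: "\<phi> \<in> test_functions S \<Longrightarrow> smooth \<phi>"
  by (auto simp: test_functions_def smooth_def)

lemma test_mono: "T \<subseteq> S \<Longrightarrow> \<phi> \<in> test_functions T \<Longrightarrow> \<phi> \<in> test_functions S"
  by (auto simp: test_functions_def)

lemma test_zero_outside:
  assumes "\<phi> \<in> test_functions S" "x \<notin> S"
  shows "\<phi> x = 0" and "grad \<phi> x = 0"
proof -
  obtain K where K: "compact K" "K \<subseteq> S" "\<And>x. x \<notin> K \<Longrightarrow> \<phi> x = 0"
    using assms(1) unfolding test_functions_def by blast
  then show "\<phi> x = 0" using assms(2) by blast
  have "((\<lambda>x. 0) has_derivative (\<lambda>h. (0::real\<times>real) \<bullet> h)) (at x)" by simp
  then have "(\<phi> has_derivative (\<lambda>h. 0 \<bullet> h)) (at x)"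
    by (rule has_derivative_transform_within_open[of _ _ _ _ "- K"])
      (use K assms(2) in \<open>auto simp: compact_imp_closed\<close>)
  then show "grad \<phi> x = 0" by (rule grad_eqI)
qed

lemma test_bounded:
  assumes "\<phi> \<in> test_functions S"
  shows "\<exists>B. \<forall>x. \<bar>\<phi> x\<bar> \<le> B \<and> norm (grad \<phi> x) \<le> B"
proof -
  obtain K where K: "compact K" "\<And>x. x \<notin> K \<Longrightarrow> \<phi> x = 0"
    using assms unfolding test_functions_def by blast
  have "\<phi> \<in> test_functions K"
    using K assms by (auto simp: test_functions_def)
  note z = test_zero_outside[OF this]
  have "compact (\<phi> ` K)" "compact (grad \<phi> ` K)"
    using K test_smooth[OF assms] by (auto intro!: compact_continuous_image smooth_continuous smooth_grad)
  then obtain B1 B2 where "\<And>x. x \<in> K \<Longrightarrow> norm (\<phi> x) \<le> B1" "\<And>x. x \<in> K \<Longrightarrow> norm (grad \<phi> x) \<le> B2"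
    by (fastforce dest!: compact_imp_bounded simp: bounded_iff)
  then have "\<bar>\<phi> x\<bar> \<le> max 0 (max B1 B2)" "norm (grad \<phi> x) \<le> max 0 (max B1 B2)" for x
    using z[of x] by (cases "x \<in> K"; fastforce simp: le_max_iff_disj)+
  then show ?thesis by blast
qed

lemma test_L2:
  assumes "\<phi> \<in> test_functions S" "T \<in> lmeasurable"
  shows "\<phi> \<in> L2_space T" "grad \<phi> \<in> L2_space T"
proof -
  obtain B where B: "\<And>x. \<bar>\<phi> x\<bar> \<le> B" "\<And>x. norm (grad \<phi> x) \<le> B"
    using test_bounded[OF assms(1)] by blast
  show "\<phi> \<in> L2_space T" "grad \<phi> \<in> L2_space T"
    using test_smooth[OF assms(1)] B
    by (auto intro!: L2_space_bounded[OF assms(2), where B = B] continuous_measurable_lebesgue_on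
        smooth_continuous smooth_grad)
qed

lemma test_tensor:
  assumes "smooth \<alpha>" "smooth \<beta>" and "\<And>x. x \<notin> {a'..b'} \<Longrightarrow> \<alpha> x = 0" "\<And>x. x \<notin> {c'..d'} \<Longrightarrow> \<beta> x = 0"
    and "{a'..b'} \<times> {c'..d'} \<subseteq> S"
  shows "(\<lambda>x::real\<times>real. \<alpha> (fst x) * \<beta> (snd x)) \<in> test_functions S"
proof -
  have "smooth (\<lambda>x::real\<times>real. \<alpha> (fst x) * \<beta> (snd x))"
    by (intro smooth_mult smooth_fst smooth_snd assms)
  moreover have "compact ({a'..b'} \<times> {c'..d'})" by (intro compact_Times) auto
  moreover have "\<forall>x. x \<notin> {a'..b'} \<times> {c'..d'} \<longrightarrow> \<alpha> (fst x) * \<beta> (snd x) = 0"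
    using assms(3,4) by (auto simp: mem_Times_iff)
  ultimately have "(\<forall>k. C_k k (\<lambda>x::real\<times>real. \<alpha> (fst x) * \<beta> (snd x))) \<and>
      (\<exists>K. compact K \<and> K \<subseteq> S \<and> (\<forall>x. x \<notin> K \<longrightarrow> \<alpha> (fst x) * \<beta> (snd x) = 0))"
    using assms(5) unfolding smooth_def by (intro conjI exI[of _ "{a'..b'} \<times> {c'..d'}"]) simp_all
  then show ?thesis unfolding test_functions_def by simp
qed

lemma grad_tensor:
  assumes "(\<alpha> has_real_derivative \<alpha>') (at (fst x))" "(\<beta> has_real_derivative \<beta>') (at (snd x))"
  shows "((\<lambda>x::real\<times>real. \<alpha> (fst x) * \<beta> (snd x)) has_derivative
      (\<lambda>h. (\<alpha>' * \<beta> (snd x), \<alpha> (fst x) * \<beta>') \<bullet> h)) (at x)"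
proof -
  have "((\<lambda>x. \<alpha> (fst x)) has_derivative (\<lambda>h. \<alpha>' * fst h)) (at x)"
    "((\<lambda>x. \<beta> (snd x)) has_derivative (\<lambda>h. \<beta>' * snd h)) (at x)"
    using has_derivative_compose[of fst fst x UNIV \<alpha> "\<lambda>h. \<alpha>' * h"]
      has_derivative_compose[of snd snd x UNIV \<beta> "\<lambda>h. \<beta>' * h"] assms
    by (auto simp: has_field_derivative_def bounded_linear_imp_has_derivative bounded_linear_fst bounded_linear_snd)
  from has_derivative_mult[OF this] show ?thesis
    by (rule has_derivative_eq_rhs) (auto simp: inner_prod_def fun_eq_iff algebra_simps)
qed

lemma integral_rect_eq:
  fixes f :: "real \<times> real \<Rightarrow> real"
  assumes "continuous_on (cbox (a, 0) (b, 1)) f"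
  shows "integrable (lebesgue_on (rect a b)) f"
    and "(LINT x|lebesgue_on (rect a b). f x) = integral (cbox (a, 0) (b, 1)) f"
proof -
  have "f absolutely_integrable_on cbox (a, 0) (b, 1)"
    by (rule absolutely_integrable_continuous[OF assms])
  then have "f absolutely_integrable_on rect a b"
    by (simp add: rect_eq_box absolutely_integrable_on_open_interval)
  then show i: "integrable (lebesgue_on (rect a b)) f"
    by (simp add: absolutely_integrable_imp_integrable)
  show "(LINT x|lebesgue_on (rect a b). f x) = integral (cbox (a, 0) (b, 1)) f"
    using lebesgue_integral_eq_integral[OF i] by (simp add: rect_eq_box integral_open_interval)
qed

text \<open>Fubini reduces both identities to the fundamental theorem of calculus on horizontal and
  on vertical lines. The integrations by parts below are instances in which F is a product with a
  test function.\<close>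

lemma Green_rect:
  fixes F :: "real \<times> real \<Rightarrow> real"
  assumes F: "\<And>x. (F has_derivative (\<lambda>h. G x \<bullet> h)) (at x)" and G: "continuous_on UNIV G"
    and ab: "a \<le> b"
  shows "(LINT x|lebesgue_on (rect a b). fst (G x)) = integral {0..1} (\<lambda>t. F (b, t) - F (a, t))"
    and "(LINT x|lebesgue_on (rect a b). snd (G x)) = integral {a..b} (\<lambda>s. F (s, 1) - F (s, 0))"
proof -
  have c: "continuous_on S (\<lambda>x. fst (G x))" "continuous_on S (\<lambda>x. snd (G x))" for S
    using G by (auto intro!: continuous_intros intro: continuous_on_subset)
  have d1: "((\<lambda>s. F (s, t)) has_vector_derivative fst (G (s, t))) (at s within A)" for s t A
  proof -
    have "((\<lambda>s. (s, t)) has_derivative (\<lambda>h. (h, 0))) (at s within A)" by (auto intro!: derivative_eq_intros)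
    from has_derivative_compose[OF this F] show ?thesis
      by (simp add: has_vector_derivative_def inner_prod_def mult.commute)
  qed
  have d2: "((\<lambda>t. F (s, t)) has_vector_derivative snd (G (s, t))) (at t within A)" for s t A
  proof -
    have "((\<lambda>t. (s, t)) has_derivative (\<lambda>h. (0, h))) (at t within A)" by (auto intro!: derivative_eq_intros)
    from has_derivative_compose[OF this F] show ?thesis
      by (simp add: has_vector_derivative_def inner_prod_def mult.commute)
  qed
  have e1: "integral (cbox a b) (\<lambda>s. fst (G (s, t))) = F (b, t) - F (a, t)" for t
    using fundamental_theorem_of_calculus[OF ab, of "\<lambda>s. F (s, t)"] d1 by (simp add: integral_unique)
  have e2: "integral (cbox 0 1) (\<lambda>t. snd (G (s, t))) = F (s, 1) - F (s, 0)" for s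
    using fundamental_theorem_of_calculus[of 0 1 "\<lambda>t. F (s, t)"] d2 by (simp add: integral_unique)
  have "integral (cbox (a, 0) (b, 1)) (\<lambda>x. fst (G x))
      = integral (cbox a b) (\<lambda>s. integral (cbox 0 1) (\<lambda>t. fst (G (s, t))))"
    by (rule integral_prod_continuous[OF c(1)])
  also have "\<dots> = integral (cbox 0 1) (\<lambda>t. integral (cbox a b) (\<lambda>s. fst (G (s, t))))"
    using c(1) by (intro integral_swap_continuous) (simp add: case_prod_unfold)
  also have "\<dots> = integral (cbox 0 1) (\<lambda>t. F (b, t) - F (a, t))" by (simp only: e1)
  finally show "(LINT x|lebesgue_on (rect a b). fst (G x)) = integral {0..1} (\<lambda>t. F (b, t) - F (a, t))"
    using integral_rect_eq(2)[OF c(1), of a b] by simp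
  have "integral (cbox (a, 0) (b, 1)) (\<lambda>x. snd (G x))
      = integral (cbox a b) (\<lambda>s. integral (cbox 0 1) (\<lambda>t. snd (G (s, t))))"
    by (rule integral_prod_continuous[OF c(2)])
  also have "\<dots> = integral (cbox a b) (\<lambda>s. F (s, 1) - F (s, 0))" by (simp only: e2)
  finally show "(LINT x|lebesgue_on (rect a b). snd (G x)) = integral {a..b} (\<lambda>s. F (s, 1) - F (s, 0))"
    using integral_rect_eq(2)[OF c(2), of a b] by simp
qed

section \<open>Uniqueness of weak gradients up to null sets\<close>

lemma Int_stable_boxes: "Int_stable (range (\<lambda>(a, b). box a b :: 'a::euclidean_space set))"
  by (auto simp: Int_stable_def box_Int_box)

text \<open>Fundamental lemma of the calculus of variations. Products of cutoffs converge boundedly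
  to indicators of boxes, so g integrates to zero over every box; boxes are stable under
  intersection and generate the Borel sets, which carries this to Borel sets and, up to null sets,
  to all Lebesgue sets.\<close>

lemma AE_zero_if_orthogonal_to_test_functions:
  fixes g :: "real \<times> real \<Rightarrow> real"
  assumes g: "g \<in> L2_space (rect a b)"
    and orth: "\<And>\<phi>. \<phi> \<in> test_functions (rect a b) \<Longrightarrow> L2_inner (rect a b) g \<phi> = 0"
  shows "AE x in lebesgue_on (rect a b). g x = 0"
proof -
  let ?R = "rect a b"
  have one: "(\<lambda>x. 1 :: real) \<in> L2_space ?R"
    by (rule L2_space_bounded[where B = 1]) auto
  have gint: "integrable (lebesgue_on ?R) g"
    using L2_integrable_inner[OF g one] by simp
  define h where "h x = indicator ?R x *\<^sub>R g x" for x
  have h: "integrable lebesgue h"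
    using gint by (simp add: integrable_restrict_space h_def[abs_def])
  have box0: "(LINT x:box p q|lebesgue. h x) = 0" for p q
  proof -
    obtain p1 p2 q1 q2 where pq: "p = (p1, p2)" "q = (q1, q2)" by (cases p, cases q)
    \<comment> \<open>The box is clipped to the rectangle. The index \<open>Suc k\<close> used below
      keeps a positive margin, so that each product of cutoffs has compact support inside the open
      rectangle.\<close>
    define l1 r1 l2 r2 where lr: "l1 = max a p1" "r1 = min b q1" "l2 = max 0 p2" "r2 = min 1 q2"
    define \<phi> where "\<phi> k x = plateau l1 r1 (Suc k) (fst x) * plateau l2 r2 (Suc k) (snd x)" for k and x :: "real \<times> real"
    have "\<phi> k \<in> test_functions ?R" for k
    proof -
      have "{l1 + e..r1 - e} \<times> {l2 + e..r2 - e} \<subseteq> ?R" if "0 < e" for e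
        using that by (auto simp: rect_def lr max_def min_def split: if_splits)
      from this[of "inverse (real (Suc k))"] show ?thesis unfolding \<phi>_def
        by (intro test_tensor[OF smooth_plateau smooth_plateau plateau_support plateau_support]) auto
    qed
    then have "(LINT x|lebesgue_on ?R. g x * \<phi> k x) = 0" for k
      using orth[of "\<phi> k"] by (simp add: L2_inner_def)
    moreover have "(\<lambda>k. LINT x|lebesgue_on ?R. g x * \<phi> k x) \<longlonglongrightarrow>
        (LINT x|lebesgue_on ?R. g x * indicator (box p q) x)"
    proof (rule integral_dominated_convergence)
      show "integrable (lebesgue_on ?R) (\<lambda>x. norm (g x))" using gint by simp
      show "(\<lambda>x. g x * indicator (box p q) x) \<in> borel_measurable (lebesgue_on ?R)"
        by (intro borel_measurable_times L2_measurable[OF g])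
          (rule borel_measurable_lebesgue_on, rule borel_measurable_indicator, simp)
      fix k
      have "continuous_on UNIV (\<phi> k)" unfolding \<phi>_def
        by (intro smooth_continuous smooth_mult smooth_fst smooth_snd smooth_plateau)
      then show "(\<lambda>x. g x * \<phi> k x) \<in> borel_measurable (lebesgue_on ?R)"
        by (intro borel_measurable_times L2_measurable[OF g] continuous_measurable_lebesgue_on)
      have "\<bar>\<phi> k x\<bar> \<le> 1" for x
        unfolding \<phi>_def abs_mult by (intro mult_le_one) (simp_all add: plateau_bounds abs_of_nonneg)
      then have "norm (g x * \<phi> k x) \<le> norm (g x)" for x
        using mult_left_mono[of "\<bar>\<phi> k x\<bar>" 1 "\<bar>g x\<bar>"] by (simp add: abs_mult)
      then show "AE x in lebesgue_on ?R. norm (g x * \<phi> k x) \<le> norm (g x)" by simp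
    next
      have "(\<lambda>k. \<phi> k x) \<longlonglongrightarrow> indicator (box p q) x" if "x \<in> ?R" for x
      proof (cases "x \<in> box p q")
        case True
        then have "fst x \<in> {l1<..<r1}" "snd x \<in> {l2<..<r2}"
          using that by (auto simp: lr pq rect_def box_real_pair)
        from tendsto_mult[OF plateau_tendsto[OF this(1), THEN LIMSEQ_Suc] plateau_tendsto[OF this(2), THEN LIMSEQ_Suc]] True
        show ?thesis by (simp add: \<phi>_def)
      next
        case False
        then have "fst x \<notin> {l1<..<r1} \<or> snd x \<notin> {l2<..<r2}"
          by (auto simp: lr pq rect_def box_real_pair mem_Times_iff)
        then have "\<phi> k x = 0" for k by (auto simp: \<phi>_def plateau_support_outside simp del: of_nat_Suc)
        then show ?thesis using False by simp
      qed
      then show "AE x in lebesgue_on ?R. (\<lambda>k. g x * \<phi> k x) \<longlonglongrightarrow> g x * indicator (box p q) x"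
        by (intro AE_I2 tendsto_mult tendsto_const) auto
    qed
    ultimately have "(LINT x|lebesgue_on ?R. g x * indicator (box p q) x) = 0"
      by (simp add: LIMSEQ_const_iff)
    then show ?thesis
      by (simp add: integral_restrict_space set_lebesgue_integral_def h_def mult.commute mult.left_commute)
  qed
  have hA: "set_integrable lebesgue A h" if "A \<in> sets lebesgue" for A
    using integrable_mult_indicator[OF that h] by (simp add: set_integrable_def)
  have UN: "(LINT x:UNIV|lebesgue. h x) = 0"
  proof -
    have "(LINT x:UNIV|lebesgue. h x) = (LINT x:box (a, 0) (b, 1)|lebesgue. h x)"
      unfolding set_lebesgue_integral_def
      by (rule Bochner_Integration.integral_cong) (auto simp: h_def rect_eq_box indicator_def)
    then show ?thesis using box0 by simp
  qed
  let ?B = "range (\<lambda>(p, q). box p q) :: (real \<times> real) set set"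
  have sets: "A \<in> sets lebesgue" if "A \<in> sigma_sets UNIV ?B" for A
    using that sets_completionI_sets[of A lborel] unfolding sets_lborel borel_eq_box
    by (simp add: sets_measure_of)
  have int: "Int_stable ?B" by (rule Int_stable_boxes)
  have pow: "?B \<subseteq> Pow UNIV" by simp
  have gen: "A \<in> sigma_sets UNIV ?B" if "A \<in> sets borel" for A :: "(real \<times> real) set"
    using that unfolding borel_eq_box by (simp add: sets_measure_of)
  have borel0: "(LINT x:A|lebesgue. h x) = 0" if "A \<in> sets borel" for A
    using int pow gen[OF that]
  proof (induction A rule: sigma_sets_induct_disjoint)
    case (basic A)
    then show ?case using box0 by auto
  next
      case (compl A)
      have "(LINT x:UNIV|lebesgue. h x) = (LINT x:(UNIV - A) \<union> A|lebesgue. h x)" by simp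
      also have "\<dots> = (LINT x:UNIV - A|lebesgue. h x) + (LINT x:A|lebesgue. h x)"
        using sets[OF compl(1)] by (intro set_integral_Un hA) auto
      finally show ?case using compl UN by simp
    next
      case (union A)
      have A: "A i \<in> sets lebesgue" for i using sets union(2) by (meson range_subsetD)
      have "(LINT x:(\<Union>i. A i)|lebesgue. h x) = (\<Sum>i. LINT x:A i|lebesgue. h x)"
        using union(1) A by (intro lebesgue_integral_countable_add hA) (auto simp: disjoint_family_on_def)
      then show ?case using union by simp
  qed (auto simp: set_lebesgue_integral_def)
  have "AE x in lebesgue. h x = 0"
  proof (rule density_unique_real[OF h])
    fix A :: "(real \<times> real) set" assume A: "A \<in> sets lebesgue"
    obtain B N where BN: "B \<in> sets borel" "negligible N" "B \<union> N = A"
      using sets_lebesgue_almost_borel[OF A] .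
    have B: "B \<in> sets lebesgue" using BN(1) by (simp add: sets_completionI_sets)
    have N: "AE x in lebesgue. x \<notin> N"
      using BN(2) by (simp add: negligible_iff_null_sets AE_not_in)
    have "(LINT x:A|lebesgue. h x) = (LINT x:B|lebesgue. h x)"
      unfolding set_lebesgue_integral_def
    proof (rule integral_cong_AE)
      show "AE x in lebesgue. indicator A x *\<^sub>R h x = indicator B x *\<^sub>R h x"
        using N by eventually_elim (use BN in \<open>auto simp: indicator_def\<close>)
      show "(\<lambda>x. indicator A x *\<^sub>R h x) \<in> borel_measurable lebesgue"
        "(\<lambda>x. indicator B x *\<^sub>R h x) \<in> borel_measurable lebesgue"
        using hA[OF A] hA[OF B] unfolding set_integrable_def by blast+
    qed
    then show "(LINT x:A|lebesgue. h x) = (LINT x:A|lebesgue. 0)" using borel0[OF BN(1)]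
      by (simp add: set_lebesgue_integral_def)
  qed simp
  then have "AE x in lebesgue. x \<in> ?R \<longrightarrow> g x = 0"
    by eventually_elim (auto simp: h_def)
  then show ?thesis by (simp add: AE_restrict_space_iff)
qed

lemma weak_gradient_unique:
  assumes "has_weak_gradient (rect a b) u g" "has_weak_gradient (rect a b) u g'"
  shows "AE x in lebesgue_on (rect a b). g x = g' x"
proof -
  let ?R = "rect a b"
  have L: "g \<in> L2_space ?R" "g' \<in> L2_space ?R" using assms by (auto simp: has_weak_gradient_def)
  have "AE x in lebesgue_on ?R. g x \<bullet> i - g' x \<bullet> i = 0" if "i \<in> Basis" for i
  proof (rule AE_zero_if_orthogonal_to_test_functions)
    show "(\<lambda>x. g x \<bullet> i - g' x \<bullet> i) \<in> L2_space ?R" by (intro L2_diff L2_component L)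
    fix \<phi> assume \<phi>: "\<phi> \<in> test_functions ?R"
    have "L2_inner ?R (\<lambda>x. g x \<bullet> i) \<phi> = L2_inner ?R (\<lambda>x. g' x \<bullet> i) \<phi>"
      using assms \<phi> that unfolding has_weak_gradient_def by (metis neg_equal_iff_equal)
    then show "L2_inner ?R (\<lambda>x. g x \<bullet> i - g' x \<bullet> i) \<phi> = 0"
      using \<phi> by (subst L2_inner_diff_left) (auto intro!: L2_component L test_L2)
  qed
  then have "AE x in lebesgue_on ?R. \<forall>i\<in>Basis. g x \<bullet> i - g' x \<bullet> i = 0"
    by (simp add: AE_ball_countable countable_finite)
  then show ?thesis by eventually_elim (auto intro: euclidean_eqI)
qed

text \<open>\<open>weak_gradient\<close> is an arbitrary choice; these facts exchange it for any
  explicit gradient at hand.\<close>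

lemma weak_gradient_AE_eq:
  assumes "has_weak_gradient (rect a b) u g"
  shows "AE x in lebesgue_on (rect a b). weak_gradient (rect a b) u x = g x"
    and "weak_gradient (rect a b) u \<in> L2_space (rect a b)"
    and "has_weak_gradient (rect a b) u (weak_gradient (rect a b) u)"
proof -
  show *: "has_weak_gradient (rect a b) u (weak_gradient (rect a b) u)"
    unfolding weak_gradient_def by (rule someI[of "has_weak_gradient (rect a b) u" g, OF assms])
  show "AE x in lebesgue_on (rect a b). weak_gradient (rect a b) u x = g x"
    by (rule weak_gradient_unique[OF * assms])
  show "weak_gradient (rect a b) u \<in> L2_space (rect a b)" using * by (simp add: has_weak_gradient_def)
qed

lemma has_weak_gradient_test:
  assumes u: "u \<in> test_functions (rect a b)" and "a \<le> b"
  shows "has_weak_gradient (rect a b) u (grad u)"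
  unfolding has_weak_gradient_def
proof (intro conjI ballI)
  let ?R = "rect a b"
  show "grad u \<in> L2_space ?R" using u by (simp add: test_L2)
  fix \<phi> i assume \<phi>: "\<phi> \<in> test_functions ?R" and i: "i \<in> (Basis :: (real \<times> real) set)"
  let ?G = "\<lambda>x. u x *\<^sub>R grad \<phi> x + \<phi> x *\<^sub>R grad u x"
  have d: "((\<lambda>x. u x * \<phi> x) has_derivative (\<lambda>h. ?G x \<bullet> h)) (at x)" for x
    using has_derivative_mult[OF smooth_grad(1)[OF test_smooth[OF u]] smooth_grad(1)[OF test_smooth[OF \<phi>]]]
    by (rule has_derivative_eq_rhs) (auto simp: inner_add_left)
  have c: "continuous_on UNIV ?G"
    by (intro continuous_intros smooth_continuous smooth_grad test_smooth[OF u] test_smooth[OF \<phi>])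
  have z: "u (s, t) = 0" if "s \<le> a \<or> b \<le> s \<or> t \<le> 0 \<or> 1 \<le> t" for s t
    using that by (intro test_zero_outside[OF u]) (auto simp: rect_def)
  \<comment> \<open>Green's formula for the product of u and \<phi>: the boundary terms vanish
    together with u.\<close>
  have "(LINT x|lebesgue_on ?R. ?G x \<bullet> i) = 0"
    using Green_rect[OF d c \<open>a \<le> b\<close>] i by (auto simp: Basis_real_pair inner_prod_def z)
  also have "(\<lambda>x. ?G x \<bullet> i) = (\<lambda>x. u x * (grad \<phi> x \<bullet> i) + (grad u x \<bullet> i) * \<phi> x)"
    by (auto simp: inner_add_left)
  finally have "(LINT x|lebesgue_on ?R. u x * (grad \<phi> x \<bullet> i) + (grad u x \<bullet> i) * \<phi> x) = 0" .
  moreover have "integrable (lebesgue_on ?R) (\<lambda>x. u x * (grad \<phi> x \<bullet> i))"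
    "integrable (lebesgue_on ?R) (\<lambda>x. (grad u x \<bullet> i) * \<phi> x)"
    using L2_integrable_inner[OF test_L2(1)[OF u] L2_component[OF test_L2(2)[OF \<phi>]], of ?R i]
      L2_integrable_inner[OF L2_component[OF test_L2(2)[OF u]] test_L2(1)[OF \<phi>], of ?R i] by auto
  ultimately show "L2_inner ?R u (\<lambda>x. frechet_derivative \<phi> (at x) i) = - L2_inner ?R (\<lambda>x. grad u x \<bullet> i) \<phi>"
    by (simp add: L2_inner_def inner_grad[OF i])
qed

section \<open>Approximation by smooth functions with compact support\<close>

text \<open>The integral starts to the left of the support of q, so it is zero there; to the right
  of the support it equals the total integral, which is zero as well. Mean zero is thus what lets
  compact support survive integration.\<close>

lemma compactly_supported_antiderivative:
  fixes q :: "real \<Rightarrow> real"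
  assumes q: "continuous_on UNIV q" and supp: "\<And>x. x \<notin> {a'..b'} \<Longrightarrow> q x = 0"
    and ab: "a < a'" "b' < b" "a < b" and total: "integral {a..b} q = 0"
    and bound: "\<And>x. \<bar>q x\<bar> \<le> C"
  shows "((\<lambda>x. integral {a..x} q) has_real_derivative q x) (at x)"
    and "x \<notin> {a'..b'} \<Longrightarrow> integral {a..x} q = 0"
    and "\<bar>integral {a..x} q\<bar> \<le> C * (b - a)"
proof -
  have c: "continuous_on A q" for A using q continuous_on_subset by blast
  then have i: "q integrable_on {s..t}" for s t by (rule integrable_continuous_real)
  have z: "integral {s..t} q = 0" if "t < a' \<or> b' < s" for s t
  proof -
    have "integral {s..t} q = integral {s..t} (\<lambda>_. 0)"
      using that by (intro integral_cong supp) auto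
    then show ?thesis by simp
  qed
  show supp': "integral {a..x} q = 0" if "x \<notin> {a'..b'}" for x
  proof (cases "x < a'")
    case False
    show ?thesis
    proof (cases "b' < a")
      case True
      then show ?thesis by (intro z) simp
    next
      case a: False
      then have x: "b' < x" "a \<le> x" using that False ab by auto
      show ?thesis
      proof (cases "x \<le> b")
        case True
        have "integral {a..x} q + integral {x..b} q = integral {a..b} q"
          using x True by (intro Henstock_Kurzweil_Integration.integral_combine i)
        then show ?thesis using z[of b x] x total by simp
      next
        case False
        have "integral {a..b} q + integral {b..x} q = integral {a..x} q"
          using ab False by (intro Henstock_Kurzweil_Integration.integral_combine i) auto
        then show ?thesis using z[of x b] ab total by simp
      qed
    qed
  qed (simp add: z)
  show "((\<lambda>x. integral {a..x} q) has_real_derivative q x) (at x)"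
  proof (cases "a < x")
    case True
    then have "x \<in> interior {a..x+1}"  by (simp add: interior_atLeastAtMost_real)
    have "((\<lambda>x. integral {a..x} q) has_real_derivative q x) (at x within {a..x+1})"
      using True by (intro integral_has_real_derivative[OF c]) simp
    then show ?thesis unfolding at_within_interior[OF \<open>x \<in> interior {a..x+1}\<close>] .
  next
    case False
    have "((\<lambda>x. 0) has_real_derivative 0) (at x)" by simp
    then have "((\<lambda>x. integral {a..x} q) has_real_derivative 0) (at x)"
      by (rule has_field_derivative_transform_within_open[of _ _ _ "{..<a'}"])
        (use False ab in \<open>auto simp: z\<close>)
    then show ?thesis using False ab supp[of x] by simp
  qed
  have C: "0 \<le> C" using bound[of 0] by simp
  show "\<bar>integral {a..x} q\<bar> \<le> C * (b - a)"
  proof (cases "x \<in> {a'..b'}")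
    case True
    have "norm (integral {a..x} q) \<le> C * (x - a)"
      using True ab bound by (intro integral_bound c) auto
    also have "\<dots> \<le> C * (b - a)" using True ab C by (intro mult_left_mono) auto
    finally show ?thesis by simp
  qed (use C ab in \<open>simp add: supp'\<close>)
qed

text \<open>\<open>adm a b f p\<close>: the function \<open>f\<close> with derivative \<open>p\<close> is a boundedly pointwise limit in \<open>C\<^sup>1\<close> of
  smooth functions with compact support in \<open>(a,b)\<close>.\<close>

definition adm :: "real \<Rightarrow> real \<Rightarrow> (real \<Rightarrow> real) \<Rightarrow> (real \<Rightarrow> real) \<Rightarrow> bool"
  where "adm a b f p \<longleftrightarrow> (\<exists>\<alpha> B. \<forall>k. smooth (\<alpha> k) \<and>
    (\<exists>a' b'. a < a' \<and> b' < b \<and> (\<forall>x. x \<notin> {a'..b'} \<longrightarrow> \<alpha> k x = 0)) \<and>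
    (\<forall>x. \<bar>\<alpha> k x\<bar> \<le> B \<and> \<bar>deriv (\<alpha> k) x\<bar> \<le> B \<and>
      (\<lambda>k. \<alpha> k x) \<longlonglongrightarrow> f x \<and> (\<lambda>k. deriv (\<alpha> k) x) \<longlonglongrightarrow> p x))"

text \<open>Supplies a smooth compactly supported function that can be normalised to integral 1;
  subtracting multiples of it restores mean zero in the next construction.\<close>

lemma plateau_integral_nonzero:
  assumes "a < b"
  shows "\<exists>k. integral {a..b} (plateau a b (Suc k)) \<noteq> 0"
proof -
  have "(\<lambda>k. integral {a<..<b} (plateau a b (Suc k))) \<longlonglongrightarrow> integral {a<..<b} (\<lambda>x. 1)"
  proof (rule dominated_convergence(2)[where h = "\<lambda>x. 1"])
    show "plateau a b (Suc k) integrable_on {a<..<b}" for k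
      unfolding integrable_on_Icc_iff_Ioo[symmetric]
      by (intro integrable_continuous_real smooth_continuous smooth_plateau)
    show "(\<lambda>x::real. 1::real) integrable_on {a<..<b}"
      unfolding integrable_on_Icc_iff_Ioo[symmetric] by (intro integrable_continuous_real continuous_intros)
  qed (use plateau_bounds plateau_tendsto[THEN LIMSEQ_Suc] in auto)
  then have "(\<lambda>k. integral {a..b} (plateau a b (Suc k))) \<longlonglongrightarrow> b - a"
    using assms unfolding integral_open_interval_real[symmetric] by simp
  then have "eventually (\<lambda>k. integral {a..b} (plateau a b (Suc k)) \<noteq> 0) sequentially"
    using assms by (intro tendsto_imp_eventually_ne) auto
  then show ?thesis by (auto simp: eventually_sequentially)
qed

text \<open>The approximation is built on the derivative: it is cut off on each smooth piece,
  corrected to mean zero by a multiple of a fixed bump, and integrated. The corrections tend to zero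
  because the limit p integrates to f b - f a = 0. The cutoffs vanish at l, c and r, hence the value
  0 of p there.\<close>

lemma adm_kink:
  assumes ab: "a < b" and ord: "a \<le> l" "l \<le> c" "c \<le> r" "r \<le> b"
    and F: "smooth F1" "smooth F2" and val: "F1 l = 0" "F1 c = F2 c" "F2 r = 0"
  shows "adm a b (\<lambda>x. if x \<in> {l..c} then F1 x else if x \<in> {c..r} then F2 x else 0)
    (\<lambda>x. if x \<in> {l<..<c} then deriv F1 x else if x \<in> {c<..<r} then deriv F2 x else 0)"
proof -
  define f where "f x = (if x \<in> {l..c} then F1 x else if x \<in> {c..r} then F2 x else 0)" for x
  define p where "p x = (if x \<in> {l<..<c} then deriv F1 x else if x \<in> {c<..<r} then deriv F2 x else 0)" for x
  have "r = c" if "r \<le> c" using that ord by simp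
  then have "f l = 0" "f r = 0" using ord val by (auto simp: f_def)
  moreover have "f x = 0" if "x < l \<or> r < x" for x using that ord by (auto simp: f_def)
  ultimately have f0: "f x = 0" if "x \<le> a \<or> b \<le> x" for x
    using that ord by (cases "x < l \<or> r < x") (auto dest: order_antisym)
  \<comment> \<open>Clamping the argument replaces the case distinction by one formula in continuous
    functions; \<open>F1 c = F2 c\<close> makes the surplus term cancel.\<close>
  have "f = (\<lambda>x. F1 (max l (min c x)) + F2 (max c (min r x)) - F1 c)"
    using ord val by (auto simp: f_def fun_eq_iff max_def min_def)
  moreover have "continuous_on UNIV (\<lambda>x. F1 (max l (min c x)) + F2 (max c (min r x)) - F1 c)"
    by (intro continuous_intros continuous_on_compose2[OF smooth_continuous[OF F(1)]]
        continuous_on_compose2[OF smooth_continuous[OF F(2)]]) auto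
  ultimately have contf: "continuous_on A f" for A using continuous_on_subset by fastforce
  have derf: "(f has_real_derivative p x) (at x)" if x: "x \<notin> {l, c, r}" for x
  proof -
    consider "x < l \<or> r < x" | "x \<in> {l<..<c}" | "x \<in> {c<..<r}" using x ord by force
    then show ?thesis
    proof cases
      case 1
      have "((\<lambda>x. 0) has_real_derivative 0) (at x)" by simp
      then have "(f has_real_derivative 0) (at x)"
        by (rule has_field_derivative_transform_within_open[of _ _ _ "{..<l} \<union> {r<..}"])
          (use 1 ord in \<open>auto simp: f_def\<close>)
      then show ?thesis using 1 ord by (auto simp: p_def)
    next
      case 2
      have "(f has_real_derivative deriv F1 x) (at x)"
        using smooth_deriv(1)[OF F(1)] by (rule has_field_derivative_transform_within_open[of _ _ _ "{l<..<c}"])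
          (use 2 ord in \<open>auto simp: f_def\<close>)
      then show ?thesis using 2 by (auto simp: p_def)
    next
      case 3
      have "(f has_real_derivative deriv F2 x) (at x)"
        using smooth_deriv(1)[OF F(2)] by (rule has_field_derivative_transform_within_open[of _ _ _ "{c<..<r}"])
          (use 3 ord in \<open>auto simp: f_def\<close>)
      then show ?thesis using 3 by (auto simp: p_def)
    qed
  qed
  have intp: "(p has_integral f x) {a..x}" if "a \<le> x" for x
    using fundamental_theorem_of_calculus_interior_strong[of "{l, c, r}" a x f p] that contf f0[of a] derf
    by (auto simp: has_real_derivative_iff_has_vector_derivative)

  define P where "P k x = plateau l c (Suc k) x * deriv F1 x + plateau c r (Suc k) x * deriv F2 x" for k x
  obtain k0 where k0: "integral {a..b} (plateau a b (Suc k0)) \<noteq> 0" using plateau_integral_nonzero[OF ab] by blast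
  \<comment> \<open>Normalised to integral 1, so that subtracting \<open>I k * \<rho> x\<close>
    removes exactly the mean of \<open>P k\<close>.\<close>
  define \<rho> where "\<rho> x = plateau a b (Suc k0) x / integral {a..b} (plateau a b (Suc k0))" for x
  define I where "I k = integral {a..b} (P k)" for k
  define q where "q k x = P k x - I k * \<rho> x" for k x
  have smP: "smooth (P k)" for k unfolding P_def
    by (intro smooth_add smooth_mult smooth_plateau smooth_deriv F)
  have sm\<rho>: "smooth \<rho>"
    using smooth_mult[OF smooth_const smooth_plateau, of "inverse (integral {a..b} (plateau a b (Suc k0)))" a b "Suc k0"]
    by (simp add: \<rho>_def[abs_def] divide_inverse mult.commute)
  have smq: "smooth (q k)" for k unfolding q_def
    by (intro smooth_diff smooth_mult smP sm\<rho> smooth_const)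
  have int\<rho>: "integral {a..b} \<rho> = 1" using k0 by (simp add: \<rho>_def[abs_def])
  have igr: "g integrable_on {s..t}" if "smooth g" for g :: "real \<Rightarrow> real" and s t
    by (intro integrable_continuous_real smooth_continuous that)
  have intq: "integral {a..b} (q k) = 0" for k
    unfolding q_def by (subst integral_diff) (auto intro!: igr smP sm\<rho> smooth_mult simp: int\<rho> I_def)
  have P0: "P k x = 0" if "x \<notin> {a + inverse (real (Suc k))..b - inverse (real (Suc k))}" for k x
  proof -
    have *: "x \<notin> {l + inverse (real (Suc k))..c - inverse (real (Suc k))}"
      "x \<notin> {c + inverse (real (Suc k))..r - inverse (real (Suc k))}"
      using that ord by auto
    show ?thesis by (simp add: P_def plateau_support[OF *(1)] plateau_support[OF *(2)] del: of_nat_Suc)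
  qed
  \<comment> \<open>A margin at both ends of the interval on which \<open>P k\<close> and \<rho>
    vanish simultaneously.\<close>
  define \<delta> where "\<delta> k = min (inverse (real (Suc k))) (inverse (real (Suc k0)))" for k
  have \<delta>: "0 < \<delta> k" for k unfolding \<delta>_def by simp
  have \<delta>le: "\<delta> k \<le> inverse (real (Suc k))" "\<delta> k \<le> inverse (real (Suc k0))" for k
    unfolding \<delta>_def by (rule min.cobounded1, rule min.cobounded2)
  have q0: "q k x = 0" if "x \<notin> {a + \<delta> k..b - \<delta> k}" for k x
  proof -
    have *: "x \<notin> {a + inverse (real (Suc k))..b - inverse (real (Suc k))}"
      "x \<notin> {a + inverse (real (Suc k0))..b - inverse (real (Suc k0))}"
      using that \<delta>le[of k] by (auto simp del: of_nat_Suc)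
    show ?thesis by (simp add: q_def P0[OF *(1)] \<rho>_def plateau_support[OF *(2)])
  qed
  have "\<exists>B. \<forall>x\<in>{a..b}. \<bar>g x\<bar> \<le> B" if "smooth g" for g :: "real \<Rightarrow> real"
    using compact_imp_bounded[OF compact_continuous_image[OF smooth_continuous[OF that], of "{a..b}"]]
    by (auto simp: bounded_iff)
  from this[of "deriv F1"] this[of "deriv F2"] this[of \<rho>] obtain B1 B2 B3 where
    B: "\<And>x. x \<in> {a..b} \<Longrightarrow> \<bar>deriv F1 x\<bar> \<le> B1" "\<And>x. x \<in> {a..b} \<Longrightarrow> \<bar>deriv F2 x\<bar> \<le> B2"
      "\<And>x. x \<in> {a..b} \<Longrightarrow> \<bar>\<rho> x\<bar> \<le> B3"
    using smooth_deriv F sm\<rho> by metis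
  have B0: "0 \<le> B1" "0 \<le> B2" "0 \<le> B3" using B[of a] ab by auto
  have pl: "\<bar>plateau s t k x * y\<bar> \<le> z" if "\<bar>y\<bar> \<le> z" for s t k x y z
    using mult_mono[OF plateau_bounds(2)[of s t k x] that] plateau_bounds[of s t k x] that
    by (simp add: abs_mult)
  have PB: "\<bar>P k x\<bar> \<le> B1 + B2" for k x
  proof (cases "x \<in> {a..b}")
    case True
    show ?thesis unfolding P_def
      using pl[OF B(1)[OF True], of l c "Suc k" x] pl[OF B(2)[OF True], of c r "Suc k" x] by linarith
  next
    case False
    have "0 < inverse (real (Suc k))" by simp
    moreover have "x \<notin> {a + e..b - e}" if "0 < e" for e using False that by auto
    ultimately have "P k x = 0" by (intro P0) blast
    then show ?thesis using B0 by simp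
  qed
  have IB: "\<bar>I k\<bar> \<le> (B1 + B2) * (b - a)" for k
    using integral_bound[of a b "P k" "B1 + B2"] ab PB smooth_continuous[OF smP] by (simp add: I_def)
  define B' where "B' = (B1 + B2) + (B1 + B2) * (b - a) * B3"
  have B'0: "0 \<le> B'" using B0 ab by (auto simp: B'_def)
  have qB: "\<bar>q k x\<bar> \<le> B'" for k x
  proof (cases "x \<in> {a..b}")
    case True
    have "\<bar>I k * \<rho> x\<bar> \<le> (B1 + B2) * (b - a) * B3"
      unfolding abs_mult using IB B(3)[OF True] B0 ab by (intro mult_mono) auto
    then show ?thesis unfolding q_def B'_def using PB[of k x] by linarith
  next
    case False
    then have "q k x = 0" using q0[of x k] \<delta>[of k] by auto
    then show ?thesis using B'0 by simp
  qed
  have Plim: "(\<lambda>k. P k x) \<longlonglongrightarrow> p x" for x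
  proof -
    have pl: "(\<lambda>k. plateau s t (Suc k) x) \<longlonglongrightarrow> (if x \<in> {s<..<t} then 1 else 0)" for s t
    proof (cases "x \<in> {s<..<t}")
      case True
      then show ?thesis using plateau_tendsto[OF True, THEN LIMSEQ_Suc] by simp
    next
      case False
      have "(\<lambda>k. plateau s t (Suc k) x) = (\<lambda>k. 0)" by (simp add: plateau_support_outside[OF False])
      then show ?thesis unfolding if_not_P[OF False] by simp
    qed
    have "(\<lambda>k. P k x) \<longlonglongrightarrow> (if x \<in> {l<..<c} then 1 else 0) * deriv F1 x + (if x \<in> {c<..<r} then 1 else 0) * deriv F2 x"
      unfolding P_def by (intro tendsto_intros pl)
    then show ?thesis by (auto simp: p_def split: if_splits)
  qed
  have "I \<longlonglongrightarrow> integral {a..b} p"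
    unfolding I_def
    by (rule dominated_convergence(2)[where h = "\<lambda>x. B1 + B2"]) (use Plim PB igr[OF smP] in auto)
  then have Ilim: "I \<longlonglongrightarrow> 0" using intp[of b] ab f0[of b] by (simp add: integral_unique)
  have qlim: "(\<lambda>k. q k x) \<longlonglongrightarrow> p x" for x
    using tendsto_diff[OF Plim[of x] tendsto_mult[OF Ilim tendsto_const[of "\<rho> x"]]] by (simp add: q_def)

  define \<alpha> where "\<alpha> k x = integral {a..x} (q k)" for k x
  note anti = compactly_supported_antiderivative[OF smooth_continuous[OF smq], of "a + \<delta> k" "b - \<delta> k" k a b B' for k,
      OF q0 _ _ ab intq qB, simplified \<delta>, folded \<alpha>_def]
  have der: "(\<alpha> k has_real_derivative q k x) (at x)" for k x
    using anti(1)[of k x] \<delta>[of k] by (simp add: \<alpha>_def[abs_def])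
  have "smooth (\<alpha> k)" for k by (rule smooth_if_smooth_deriv[OF der smq])
  moreover have "\<exists>a' b'. a < a' \<and> b' < b \<and> (\<forall>x. x \<notin> {a'..b'} \<longrightarrow> \<alpha> k x = 0)" for k
    using anti(2)[of k] \<delta>[of k] by (intro exI[of _ "a + \<delta> k"] exI[of _ "b - \<delta> k"]) auto
  moreover have "\<bar>\<alpha> k x\<bar> \<le> B' * (b - a) + B'" "\<bar>deriv (\<alpha> k) x\<bar> \<le> B' * (b - a) + B'" for k x
    using anti(3)[of k x] \<delta>[of k] qB[of k x] B'0 ab mult_nonneg_nonneg[of B' "b - a"]
    by (auto simp: DERIV_imp_deriv[OF der])
  moreover have "(\<lambda>k. \<alpha> k x) \<longlonglongrightarrow> f x" for x
  proof (cases "a \<le> x")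
    case True
    have "(\<lambda>k. \<alpha> k x) \<longlonglongrightarrow> integral {a..x} p"
      unfolding \<alpha>_def
      by (rule dominated_convergence(2)[where h = "\<lambda>x. B'"]) (use qlim qB igr[OF smq] in auto)
    then show ?thesis using intp[OF True] by (simp add: integral_unique)
  qed (use f0 in \<open>simp add: \<alpha>_def\<close>)
  moreover have "(\<lambda>k. deriv (\<alpha> k) x) \<longlonglongrightarrow> p x" for x
    using qlim by (simp add: DERIV_imp_deriv[OF der])
  ultimately have "adm a b f p" unfolding adm_def by blast
  then show ?thesis by (simp add: f_def[abs_def] p_def[abs_def])
qed

text \<open>The kink construction with l = c = a, where the first piece shrinks to a point.\<close>

lemma adm_smooth:
  assumes "a < b" "smooth F" "F a = 0" "F b = 0"
  shows "adm a b (\<lambda>x. if x \<in> {a..b} then F x else 0) (\<lambda>x. if x \<in> {a<..<b} then deriv F x else 0)"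
proof -
  have "(\<lambda>x. if x \<in> {a..a} then 0 else if x \<in> {a..b} then F x else 0) = (\<lambda>x. if x \<in> {a..b} then F x else 0)"
    using assms by (auto simp: fun_eq_iff)
  then show ?thesis using adm_kink[of a b a a b "\<lambda>x. 0" F] assms by simp
qed

section \<open>The space \<open>H\<^sup>1\<^sub>0\<close> of a rectangle\<close>

definition test_limit ::
    "(real \<times> real) set \<Rightarrow> (nat \<Rightarrow> real \<times> real \<Rightarrow> real) \<Rightarrow> (real \<times> real \<Rightarrow> real) \<Rightarrow>
      (real \<times> real \<Rightarrow> real \<times> real) \<Rightarrow> bool"
  where "test_limit S \<phi> u g \<longleftrightarrow> (\<forall>k. \<phi> k \<in> test_functions S) \<and>
    (\<lambda>k. L2_norm S (\<lambda>x. \<phi> k x - u x)) \<longlonglongrightarrow> 0 \<and>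
    (\<lambda>k. L2_norm S (\<lambda>x. grad (\<phi> k) x - g x)) \<longlonglongrightarrow> 0"

definition has_H10_grad :: "real \<Rightarrow> real \<Rightarrow> (real \<times> real \<Rightarrow> real) \<Rightarrow> (real \<times> real \<Rightarrow> real \<times> real) \<Rightarrow> bool"
  where "has_H10_grad a b u g \<longleftrightarrow> u \<in> L2_space (rect a b) \<and> g \<in> L2_space (rect a b) \<and>
    (\<exists>\<phi>. test_limit (rect a b) \<phi> u g)"

lemma has_H10_gradD:
  assumes "has_H10_grad a b u g"
  shows "u \<in> L2_space (rect a b)" "g \<in> L2_space (rect a b)"
  using assms by (auto simp: has_H10_grad_def)

lemma test_functionsI:
  assumes "smooth \<phi>" "compact K" "K \<subseteq> S" "\<And>x. x \<notin> K \<Longrightarrow> \<phi> x = 0"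
  shows "\<phi> \<in> test_functions S"
proof -
  have "\<exists>K. compact K \<and> K \<subseteq> S \<and> (\<forall>x. x \<notin> K \<longrightarrow> \<phi> x = 0)"
    using assms by (intro exI[of _ K]) simp
  then show ?thesis using assms(1) by (simp add: test_functions_def smooth_def)
qed

lemma test_support:
  assumes "\<phi> \<in> test_functions S"
  shows "\<exists>K. compact K \<and> K \<subseteq> S \<and> (\<forall>x. x \<notin> K \<longrightarrow> \<phi> x = 0)"
  using assms by (simp add: test_functions_def)

lemma has_weak_gradientD:
  assumes "has_weak_gradient S u g" "\<psi> \<in> test_functions S" "i \<in> Basis"
  shows "L2_inner S u (\<lambda>x. frechet_derivative \<psi> (at x) i) = - L2_inner S (\<lambda>x. g x \<bullet> i) \<psi>"
  using assms unfolding has_weak_gradient_def by blast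

lemma test_limit_inner:
  assumes "test_limit (rect a b) \<phi> u g" "g \<in> L2_space (rect a b)" "h \<in> L2_space (rect a b)"
  shows "(\<lambda>k. L2_inner (rect a b) (grad (\<phi> k)) h) \<longlonglongrightarrow> L2_inner (rect a b) g h"
  using assms unfolding test_limit_def
  by (intro L2_tendsto_inner) (auto intro: test_L2(2))

text \<open>Both sides of the integration by parts identity are L2-continuous in the pair, so the
  identity passes from test functions to the limit.\<close>

lemma test_limit_weak_gradient:
  assumes lim: "test_limit (rect a b) \<phi> u g" and "a \<le> b"
    and u: "u \<in> L2_space (rect a b)" and g: "g \<in> L2_space (rect a b)"
  shows "has_weak_gradient (rect a b) u g"
  unfolding has_weak_gradient_def
proof (intro conjI ballI)
  let ?R = "rect a b"
  have \<phi>: "\<phi> k \<in> test_functions ?R" for k using lim by (simp add: test_limit_def)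
  show "g \<in> L2_space ?R" by (rule g)
  fix \<psi> i assume \<psi>: "\<psi> \<in> test_functions ?R" and i: "i \<in> (Basis :: (real \<times> real) set)"
  have flip: "L2_inner ?R (\<lambda>x. h x \<bullet> i) \<psi> = L2_inner ?R h (\<lambda>x. \<psi> x *\<^sub>R i)" for h :: "real \<times> real \<Rightarrow> real \<times> real"
    by (simp add: L2_inner_def mult.commute)
  have "norm i = 1" using i by (rule norm_Basis)
  then have \<psi>i: "(\<lambda>x. \<psi> x *\<^sub>R i) \<in> L2_space ?R"
    using test_L2(1)[OF \<psi> rect_measurable(2)[of a b]]
    by (simp add: L2_space_def borel_measurable_scaleR)
  have "(\<lambda>k. L2_inner ?R (\<phi> k) (\<lambda>x. frechet_derivative \<psi> (at x) i)) \<longlonglongrightarrow>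
      L2_inner ?R u (\<lambda>x. frechet_derivative \<psi> (at x) i)"
    using lim unfolding test_limit_def inner_grad[OF i]
    by (intro L2_tendsto_inner u L2_component test_L2[OF \<phi>] test_L2[OF \<psi>]) auto
  moreover have "L2_inner ?R (\<phi> k) (\<lambda>x. frechet_derivative \<psi> (at x) i)
      = - L2_inner ?R (grad (\<phi> k)) (\<lambda>x. \<psi> x *\<^sub>R i)" for k
    unfolding has_weak_gradientD[OF has_weak_gradient_test[OF \<phi> \<open>a \<le> b\<close>] \<psi> i] flip ..
  moreover have "(\<lambda>k. - L2_inner ?R (grad (\<phi> k)) (\<lambda>x. \<psi> x *\<^sub>R i)) \<longlonglongrightarrow> - L2_inner ?R g (\<lambda>x. \<psi> x *\<^sub>R i)"
    by (intro tendsto_minus test_limit_inner[OF lim g \<psi>i])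
  ultimately show "L2_inner ?R u (\<lambda>x. frechet_derivative \<psi> (at x) i) = - L2_inner ?R (\<lambda>x. g x \<bullet> i) \<psi>"
    unfolding flip by (auto intro: LIMSEQ_unique)
qed

lemma has_weak_gradient_diff:
  assumes "has_weak_gradient (rect a b) u g" "has_weak_gradient (rect a b) v h"
    and uv: "u \<in> L2_space (rect a b)" "v \<in> L2_space (rect a b)"
  shows "has_weak_gradient (rect a b) (\<lambda>x. u x - v x) (\<lambda>x. g x - h x)"
  unfolding has_weak_gradient_def
proof (intro conjI ballI)
  let ?R = "rect a b"
  have gh: "g \<in> L2_space ?R" "h \<in> L2_space ?R" using assms by (auto simp: has_weak_gradient_def)
  then show "(\<lambda>x. g x - h x) \<in> L2_space ?R" by (rule L2_diff)
  fix \<psi> i assume \<psi>: "\<psi> \<in> test_functions ?R" and i: "i \<in> (Basis :: (real \<times> real) set)"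
  have "(\<lambda>x. frechet_derivative \<psi> (at x) i) \<in> L2_space ?R"
    unfolding inner_grad[OF i] by (intro L2_component test_L2[OF \<psi>]) auto
  then have "L2_inner ?R (\<lambda>x. u x - v x) (\<lambda>x. frechet_derivative \<psi> (at x) i)
      = L2_inner ?R u (\<lambda>x. frechet_derivative \<psi> (at x) i) - L2_inner ?R v (\<lambda>x. frechet_derivative \<psi> (at x) i)"
    by (intro L2_inner_diff_left uv)
  also have "\<dots> = - L2_inner ?R (\<lambda>x. g x \<bullet> i) \<psi> - - L2_inner ?R (\<lambda>x. h x \<bullet> i) \<psi>"
    unfolding has_weak_gradientD[OF assms(1) \<psi> i] has_weak_gradientD[OF assms(2) \<psi> i] ..
  also have "\<dots> = - L2_inner ?R (\<lambda>x. g x \<bullet> i - h x \<bullet> i) \<psi>"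
    by (subst L2_inner_diff_left) (auto intro!: L2_component gh test_L2[OF \<psi>])
  finally show "L2_inner ?R (\<lambda>x. u x - v x) (\<lambda>x. frechet_derivative \<psi> (at x) i)
      = - L2_inner ?R (\<lambda>x. (g x - h x) \<bullet> i) \<psi>" by (simp add: inner_diff_left)
qed

lemma H1_norm_test_diff:
  assumes \<phi>: "\<phi> \<in> test_functions (rect a b)" and "a \<le> b"
    and u: "u \<in> L2_space (rect a b)" "has_weak_gradient (rect a b) u g"
  shows "H1_norm (rect a b) (\<lambda>x. \<phi> x - u x) =
    sqrt ((L2_norm (rect a b) (\<lambda>x. \<phi> x - u x))\<^sup>2 + (L2_norm (rect a b) (\<lambda>x. grad \<phi> x - g x))\<^sup>2)"
proof -
  have w: "has_weak_gradient (rect a b) (\<lambda>x. \<phi> x - u x) (\<lambda>x. grad \<phi> x - g x)"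
    by (intro has_weak_gradient_diff has_weak_gradient_test test_L2(1)[OF \<phi>] \<phi> u \<open>a \<le> b\<close>) simp
  have "L2_norm (rect a b) (weak_gradient (rect a b) (\<lambda>x. \<phi> x - u x)) = L2_norm (rect a b) (\<lambda>x. grad \<phi> x - g x)"
    using weak_gradient_AE_eq[OF w] w unfolding has_weak_gradient_def
    by (intro L2_norm_cong_AE) (blast intro: L2_measurable)+
  then show ?thesis by (simp add: H1_norm_def)
qed

text \<open>\<open>H1_norm\<close> is computed from a chosen weak gradient of the difference, which
  agrees almost everywhere with the difference of the gradients; a sum of two squares tends to zero
  exactly when both parts do.\<close>

lemma H1_norm_tendsto_iff:
  assumes \<phi>: "\<And>k. \<phi> k \<in> test_functions (rect a b)" and "a \<le> b"
    and u: "u \<in> L2_space (rect a b)" "has_weak_gradient (rect a b) u g"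
  shows "(\<lambda>k. H1_norm (rect a b) (\<lambda>x. \<phi> k x - u x)) \<longlonglongrightarrow> 0 \<longleftrightarrow> test_limit (rect a b) \<phi> u g"
proof -
  let ?p = "\<lambda>k. L2_norm (rect a b) (\<lambda>x. \<phi> k x - u x)" and ?q = "\<lambda>k. L2_norm (rect a b) (\<lambda>x. grad (\<phi> k) x - g x)"
  have eq: "(\<lambda>k. H1_norm (rect a b) (\<lambda>x. \<phi> k x - u x)) = (\<lambda>k. sqrt ((?p k)\<^sup>2 + (?q k)\<^sup>2))"
    using H1_norm_test_diff[OF \<phi> \<open>a \<le> b\<close> u] by simp
  have "?p \<longlonglongrightarrow> 0 \<and> ?q \<longlonglongrightarrow> 0" if lim: "(\<lambda>k. sqrt ((?p k)\<^sup>2 + (?q k)\<^sup>2)) \<longlonglongrightarrow> 0"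
  proof
    show "?p \<longlonglongrightarrow> 0" by (rule Lim_null_comparison[OF always_eventually lim]) (simp add: L2_norm_nonneg)
    show "?q \<longlonglongrightarrow> 0" by (rule Lim_null_comparison[OF always_eventually lim]) (simp add: L2_norm_nonneg)
  qed
  moreover have "(\<lambda>k. sqrt ((?p k)\<^sup>2 + (?q k)\<^sup>2)) \<longlonglongrightarrow> 0" if "?p \<longlonglongrightarrow> 0" "?q \<longlonglongrightarrow> 0"
  proof -
    have "(\<lambda>k. sqrt ((?p k)\<^sup>2 + (?q k)\<^sup>2)) \<longlonglongrightarrow> sqrt (0\<^sup>2 + 0\<^sup>2)" by (intro tendsto_intros that)
    then show ?thesis by simp
  qed
  ultimately show ?thesis unfolding eq test_limit_def using \<phi> by blast
qed

lemma H10_spaceI: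
  assumes "has_H10_grad a b u g" "a \<le> b"
  shows "u \<in> H10_space (rect a b)" and "has_weak_gradient (rect a b) u g"
proof -
  obtain \<phi> where \<phi>: "test_limit (rect a b) \<phi> u g" using assms by (auto simp: has_H10_grad_def)
  note L2 = has_H10_gradD[OF assms(1)]
  show w: "has_weak_gradient (rect a b) u g" by (rule test_limit_weak_gradient[OF \<phi> assms(2) L2])
  have t: "\<And>k. \<phi> k \<in> test_functions (rect a b)" using \<phi> by (simp add: test_limit_def)
  have "(\<lambda>k. H1_norm (rect a b) (\<lambda>x. \<phi> k x - u x)) \<longlonglongrightarrow> 0"
    using H1_norm_tendsto_iff[OF t assms(2) L2(1) w] \<phi> by simp
  then show "u \<in> H10_space (rect a b)"
    unfolding H10_space_def H1_space_def using w t L2(1) by blast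
qed

lemma H10_spaceD:
  assumes "u \<in> H10_space (rect a b)" "a \<le> b"
  shows "has_H10_grad a b u (weak_gradient (rect a b) u)"
proof -
  obtain g \<phi> where *: "u \<in> L2_space (rect a b)" "has_weak_gradient (rect a b) u g"
    "\<And>k. \<phi> k \<in> test_functions (rect a b)" "(\<lambda>k. H1_norm (rect a b) (\<lambda>x. \<phi> k x - u x)) \<longlonglongrightarrow> 0"
    using assms(1) unfolding H10_space_def H1_space_def by blast
  note w = weak_gradient_AE_eq[OF *(2)]
  have "test_limit (rect a b) \<phi> u (weak_gradient (rect a b) u)"
    using H1_norm_tendsto_iff[OF *(3) assms(2) *(1) w(3)] *(4) by (rule iffD1)
  then show ?thesis unfolding has_H10_grad_def using *(1) w(2) by blast
qed

lemma has_H10_grad_add: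
  assumes "has_H10_grad a b u g" "has_H10_grad a b v h"
  shows "has_H10_grad a b (\<lambda>x. u x + v x) (\<lambda>x. g x + h x)"
proof -
  let ?R = "rect a b"
  obtain \<phi> \<psi> where \<phi>: "test_limit ?R \<phi> u g" and \<psi>: "test_limit ?R \<psi> v h"
    using assms by (auto simp: has_H10_grad_def)
  note L2 = has_H10_gradD[OF assms(1)] has_H10_gradD[OF assms(2)]
  have t: "\<phi> k \<in> test_functions ?R" "\<psi> k \<in> test_functions ?R" for k
    using \<phi> \<psi> by (auto simp: test_limit_def)
  have gr: "grad (\<lambda>x. \<phi> k x + \<psi> k x) = (\<lambda>x. grad (\<phi> k) x + grad (\<psi> k) x)" for k
  proof
    fix x
    show "grad (\<lambda>x. \<phi> k x + \<psi> k x) x = grad (\<phi> k) x + grad (\<psi> k) x"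
      using has_derivative_add[OF smooth_grad(1)[OF test_smooth[OF t(1)]] smooth_grad(1)[OF test_smooth[OF t(2)]]]
      by (intro grad_eqI) (simp add: inner_add_left)
  qed
  have "(\<lambda>x. \<phi> k x + \<psi> k x) \<in> test_functions ?R" for k
  proof -
    obtain K1 where K1: "compact K1" "K1 \<subseteq> ?R" "\<And>x. x \<notin> K1 \<Longrightarrow> \<phi> k x = 0"
      using test_support[OF t(1)[of k]] by metis
    obtain K2 where K2: "compact K2" "K2 \<subseteq> ?R" "\<And>x. x \<notin> K2 \<Longrightarrow> \<psi> k x = 0"
      using test_support[OF t(2)[of k]] by metis
    have "smooth (\<lambda>x. \<phi> k x + \<psi> k x)" by (intro smooth_add test_smooth[OF t(1)] test_smooth[OF t(2)])
    moreover have "compact (K1 \<union> K2)" "K1 \<union> K2 \<subseteq> ?R" "\<And>x. x \<notin> K1 \<union> K2 \<Longrightarrow> \<phi> k x + \<psi> k x = 0"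
      using K1 K2 by auto
    ultimately show ?thesis by (rule test_functionsI)
  qed
  then have "test_limit ?R (\<lambda>k x. \<phi> k x + \<psi> k x) (\<lambda>x. u x + v x) (\<lambda>x. g x + h x)"
    using \<phi> \<psi> unfolding test_limit_def gr
    by (intro conjI allI L2_tendsto_add L2 test_L2[OF t(1)] test_L2[OF t(2)]) simp_all
  moreover have "(\<lambda>x. u x + v x) \<in> L2_space ?R" "(\<lambda>x. g x + h x) \<in> L2_space ?R"
    by (intro L2_add L2)+
  ultimately show ?thesis unfolding has_H10_grad_def by blast
qed

lemma has_H10_grad_scaleR:
  assumes "has_H10_grad a b u g"
  shows "has_H10_grad a b (\<lambda>x. c * u x) (\<lambda>x. c *\<^sub>R g x)"
proof -
  let ?R = "rect a b"
  obtain \<phi> where \<phi>: "test_limit ?R \<phi> u g" using assms by (auto simp: has_H10_grad_def)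
  note L2 = has_H10_gradD[OF assms]
  have t: "\<phi> k \<in> test_functions ?R" for k using \<phi> by (auto simp: test_limit_def)
  have gr: "grad (\<lambda>x. c * \<phi> k x) = (\<lambda>x. c *\<^sub>R grad (\<phi> k) x)" for k
  proof
    fix x
    show "grad (\<lambda>x. c * \<phi> k x) x = c *\<^sub>R grad (\<phi> k) x"
      using has_derivative_mult_right[OF smooth_grad(1)[OF test_smooth[OF t]], of c]
      by (intro grad_eqI) simp
  qed
  have "(\<lambda>x. c * \<phi> k x) \<in> test_functions ?R" for k
  proof -
    obtain K where K: "compact K" "K \<subseteq> ?R" "\<And>x. x \<notin> K \<Longrightarrow> \<phi> k x = 0"
      using test_support[OF t[of k]] by metis
    have "smooth (\<lambda>x. c * \<phi> k x)" by (intro smooth_mult smooth_const test_smooth[OF t])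
    then show ?thesis by (rule test_functionsI[OF _ K(1,2)]) (simp add: K(3))
  qed
  then have "test_limit ?R (\<lambda>k x. c * \<phi> k x) (\<lambda>x. c * u x) (\<lambda>x. c *\<^sub>R g x)"
    using \<phi> L2_tendsto_scaleR[of ?R \<phi> u c] unfolding test_limit_def gr by (simp add: L2_tendsto_scaleR)
  moreover have "(\<lambda>x. c * u x) \<in> L2_space ?R" "(\<lambda>x. c *\<^sub>R g x) \<in> L2_space ?R"
    using L2_scaleR[OF L2(1), of c] L2_scaleR[OF L2(2), of c] by simp_all
  ultimately show ?thesis unfolding has_H10_grad_def by blast
qed

lemma has_H10_grad_zero: "has_H10_grad a b (\<lambda>x. 0) (\<lambda>x. 0)"
proof -
  have "grad (\<lambda>x. 0) = (\<lambda>x. 0)" by (rule ext, rule grad_eqI) simp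
  moreover have "(\<lambda>x. 0) \<in> test_functions (rect a b)"
    by (auto simp: test_functions_def C_k_const intro!: exI[of _ "{}"])
  ultimately have "test_limit (rect a b) (\<lambda>k x. 0) (\<lambda>x. 0) (\<lambda>x. 0)"
    by (simp add: test_limit_def L2_norm_def L2_inner_def)
  then show ?thesis unfolding has_H10_grad_def by (intro conjI L2_zero exI)
qed

lemma L2_inner_cong_on:
  "(\<And>x. x \<in> S \<Longrightarrow> f x = f' x) \<Longrightarrow> (\<And>x. x \<in> S \<Longrightarrow> g x = g' x) \<Longrightarrow> L2_inner S f g = L2_inner S f' g'"
  unfolding L2_inner_def by (intro Bochner_Integration.integral_cong) auto

lemma L2_space_cong_on: "(\<And>x. x \<in> S \<Longrightarrow> f x = f' x) \<Longrightarrow> f \<in> L2_space S \<longleftrightarrow> f' \<in> L2_space S"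
  unfolding L2_space_def mem_Collect_eq
  by (intro conj_cong measurable_cong Bochner_Integration.integrable_cong) auto

lemma has_H10_grad_cong:
  assumes "has_H10_grad a b u g" and uv: "\<And>x. x \<in> rect a b \<Longrightarrow> u x = v x" and gh: "\<And>x. x \<in> rect a b \<Longrightarrow> g x = h x"
  shows "has_H10_grad a b v h"
proof -
  have "L2_norm (rect a b) (\<lambda>x. \<phi> x - u x) = L2_norm (rect a b) (\<lambda>x. \<phi> x - v x)"
    "L2_norm (rect a b) (\<lambda>x. \<psi> x - g x) = L2_norm (rect a b) (\<lambda>x. \<psi> x - h x)" for \<phi> \<psi>
    unfolding L2_norm_def by (auto intro!: arg_cong[where f = sqrt] L2_inner_cong_on simp: uv gh)
  then show ?thesis
    using assms(1) L2_space_cong_on[of "rect a b" u v] L2_space_cong_on[of "rect a b" g h] uv gh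
    unfolding has_H10_grad_def test_limit_def by simp
qed

text \<open>The same approximating sequence serves the larger rectangle, because test functions and
  their gradients vanish outside the smaller one.\<close>

lemma has_H10_grad_extend:
  assumes "has_H10_grad a b w g" "a' \<le> a" "b \<le> b'"
  shows "has_H10_grad a' b' (\<lambda>x. if x \<in> rect a b then w x else 0) (\<lambda>x. if x \<in> rect a b then g x else 0)"
proof -
  let ?R = "rect a b" and ?S = "rect a' b'"
  obtain \<phi> where \<phi>: "test_limit ?R \<phi> w g" using assms by (auto simp: has_H10_grad_def)
  note L2 = has_H10_gradD[OF assms(1)]
  have t: "\<phi> k \<in> test_functions ?R" for k using \<phi> by (auto simp: test_limit_def)
  have sub: "?R \<subseteq> ?S" using assms by (intro rect_mono)
  have "L2_norm ?S (\<lambda>x. \<phi> k x - (if x \<in> ?R then w x else 0)) = L2_norm ?R (\<lambda>x. \<phi> k x - w x)" for k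
    using L2_norm_superset[OF sub, of "\<lambda>x. \<phi> k x - (if x \<in> ?R then w x else 0)"] test_zero_outside(1)[OF t]
      L2_inner_cong_on[of ?R "\<lambda>x. \<phi> k x - (if x \<in> ?R then w x else 0)" "\<lambda>x. \<phi> k x - w x"]
    by (simp add: L2_norm_def)
  moreover have "L2_norm ?S (\<lambda>x. grad (\<phi> k) x - (if x \<in> ?R then g x else 0)) = L2_norm ?R (\<lambda>x. grad (\<phi> k) x - g x)" for k
    using L2_norm_superset[OF sub, of "\<lambda>x. grad (\<phi> k) x - (if x \<in> ?R then g x else 0)"] test_zero_outside(2)[OF t]
      L2_inner_cong_on[of ?R "\<lambda>x. grad (\<phi> k) x - (if x \<in> ?R then g x else 0)" "\<lambda>x. grad (\<phi> k) x - g x"]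
    by (simp add: L2_norm_def)
  ultimately have "test_limit ?S \<phi> (\<lambda>x. if x \<in> ?R then w x else 0) (\<lambda>x. if x \<in> ?R then g x else 0)"
    using \<phi> test_mono[OF sub] unfolding test_limit_def by simp
  then show ?thesis
    using L2_zero_extension[OF sub _ _ L2(1)] L2_zero_extension[OF sub _ _ L2(2)]
    unfolding has_H10_grad_def by auto
qed

text \<open>The passage from test functions to H10 used throughout: an identity that is linear and
  L2-continuous in the gradient is phrased as orthogonality to a single field h.\<close>

lemma H10_orthogonal_if_test_orthogonal:
  assumes "has_H10_grad a b u g" "h \<in> L2_space (rect a b)"
    and "\<And>\<phi>. \<phi> \<in> test_functions (rect a b) \<Longrightarrow> L2_inner (rect a b) (grad \<phi>) h = 0"
  shows "L2_inner (rect a b) g h = 0"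
proof -
  obtain \<phi> where \<phi>: "test_limit (rect a b) \<phi> u g" using assms(1) by (auto simp: has_H10_grad_def)
  have "(\<lambda>k. L2_inner (rect a b) (grad (\<phi> k)) h) = (\<lambda>k. 0)"
    using assms(3) \<phi> by (simp add: test_limit_def)
  then show ?thesis
    using test_limit_inner[OF \<phi> has_H10_gradD(2)[OF assms(1)] assms(2)] by (simp add: LIMSEQ_const_iff)
qed

text \<open>Products of the two approximating sequences are bounded and converge everywhere together
  with their gradients, so bounded convergence applies on the rectangle and on every vertical line.
  One sequence therefore witnesses both membership in H10 and the traces.\<close>

lemma adm_tensor:
  assumes f: "adm a b f p" and s: "adm 0 1 s q"
  shows "\<exists>\<phi>. test_limit (rect a b) \<phi> (\<lambda>x. f (fst x) * s (snd x)) (\<lambda>x. (p (fst x) * s (snd x), f (fst x) * q (snd x))) \<and>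
      (\<forall>x. (\<lambda>k. L2_norm {0<..<1} (\<lambda>t. \<phi> k (x, t) - f x * s t)) \<longlonglongrightarrow> 0)"
    and "has_H10_grad a b (\<lambda>x. f (fst x) * s (snd x)) (\<lambda>x. (p (fst x) * s (snd x), f (fst x) * q (snd x)))"
    and "(\<lambda>t. c * s t) \<in> L2_space {0<..<1}"
proof -
  let ?R = "rect a b"
  let ?u = "\<lambda>x::real\<times>real. f (fst x) * s (snd x)" and ?g = "\<lambda>x::real\<times>real. (p (fst x) * s (snd x), f (fst x) * q (snd x))"
  obtain \<alpha> A where \<alpha>: "\<And>k. smooth (\<alpha> k)"
    "\<And>k. \<exists>a' b'. a < a' \<and> b' < b \<and> (\<forall>x. x \<notin> {a'..b'} \<longrightarrow> \<alpha> k x = 0)"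
    "\<And>k x. \<bar>\<alpha> k x\<bar> \<le> A" "\<And>k x. \<bar>deriv (\<alpha> k) x\<bar> \<le> A"
    "\<And>x. (\<lambda>k. \<alpha> k x) \<longlonglongrightarrow> f x" "\<And>x. (\<lambda>k. deriv (\<alpha> k) x) \<longlonglongrightarrow> p x"
    using f unfolding adm_def by blast
  obtain \<beta> B where \<beta>: "\<And>k. smooth (\<beta> k)"
    "\<And>k. \<exists>a' b'. 0 < a' \<and> b' < 1 \<and> (\<forall>x. x \<notin> {a'..b'} \<longrightarrow> \<beta> k x = 0)"
    "\<And>k x. \<bar>\<beta> k x\<bar> \<le> B" "\<And>k x. \<bar>deriv (\<beta> k) x\<bar> \<le> B"
    "\<And>x. (\<lambda>k. \<beta> k x) \<longlonglongrightarrow> s x" "\<And>x. (\<lambda>k. deriv (\<beta> k) x) \<longlonglongrightarrow> q x"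
    using s unfolding adm_def by blast
  define \<phi> where "\<phi> k x = \<alpha> k (fst x) * \<beta> k (snd x)" for k and x :: "real \<times> real"
  have A0: "0 \<le> A" "0 \<le> B" using \<alpha>(3)[of 0 0] \<beta>(3)[of 0 0] by linarith+
  have t: "\<phi> k \<in> test_functions ?R" for k
  proof -
    obtain a' b' where 1: "a < a'" "b' < b" "\<And>x. x \<notin> {a'..b'} \<Longrightarrow> \<alpha> k x = 0" using \<alpha>(2) by blast
    obtain c' d' where 2: "0 < c'" "d' < 1" "\<And>x. x \<notin> {c'..d'} \<Longrightarrow> \<beta> k x = 0" using \<beta>(2) by blast
    have sub: "{a'..b'} \<times> {c'..d'} \<subseteq> ?R" using 1(1,2) 2(1,2) by (auto simp: rect_def)
    show ?thesis unfolding \<phi>_def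
      by (rule test_tensor[OF \<alpha>(1) \<beta>(1) _ _ sub]) (erule 1(3), erule 2(3))
  qed
  have gr: "grad (\<phi> k) x = (deriv (\<alpha> k) (fst x) * \<beta> k (snd x), \<alpha> k (fst x) * deriv (\<beta> k) (snd x))" for k x
    unfolding \<phi>_def by (rule grad_eqI, rule grad_tensor) (rule smooth_deriv[OF \<alpha>(1)], rule smooth_deriv[OF \<beta>(1)])
  have meas: "\<phi> k \<in> borel_measurable (lebesgue_on ?R)" "grad (\<phi> k) \<in> borel_measurable (lebesgue_on ?R)" for k
    by (intro continuous_measurable_lebesgue_on smooth_continuous smooth_grad test_smooth[OF t])+
  have bor: "f \<in> borel_measurable borel" "p \<in> borel_measurable borel" "s \<in> borel_measurable borel" "q \<in> borel_measurable borel"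
    by (rule borel_measurable_LIMSEQ_real[OF \<alpha>(5)], intro borel_measurable_continuous_onI smooth_continuous \<alpha>(1),
      rule borel_measurable_LIMSEQ_real[OF \<alpha>(6)], intro borel_measurable_continuous_onI smooth_continuous smooth_deriv \<alpha>(1),
      rule borel_measurable_LIMSEQ_real[OF \<beta>(5)], intro borel_measurable_continuous_onI smooth_continuous \<beta>(1),
      rule borel_measurable_LIMSEQ_real[OF \<beta>(6)], intro borel_measurable_continuous_onI smooth_continuous smooth_deriv \<beta>(1))
  have bfst: "(\<lambda>x::real\<times>real. h (fst x)) \<in> borel_measurable borel"
    and bsnd: "(\<lambda>x::real\<times>real. h (snd x)) \<in> borel_measurable borel"
    if "h \<in> borel_measurable borel" for h :: "real \<Rightarrow> real"
    by (rule measurable_compose[OF _ that], intro borel_measurable_continuous_onI continuous_on_fst continuous_on_id,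
      rule measurable_compose[OF _ that], intro borel_measurable_continuous_onI continuous_on_snd continuous_on_id)
  have mu: "?u \<in> borel_measurable (lebesgue_on ?R)"
    by (intro borel_measurable_lebesgue_on borel_measurable_times bfst bsnd bor)
  have mg: "?g \<in> borel_measurable (lebesgue_on ?R)"
    by (intro borel_measurable_lebesgue_on borel_measurable_Pair borel_measurable_times bfst bsnd bor)
  have b: "\<bar>\<phi> k x\<bar> \<le> A * B" for k x
    unfolding \<phi>_def abs_mult by (intro mult_mono \<alpha> \<beta> A0) auto
  have bg: "norm (grad (\<phi> k) x) \<le> A * B + A * B" for k x
    unfolding gr
    by (rule order_trans[OF norm_Pair_le], unfold real_norm_def abs_mult)
      (intro add_mono mult_mono \<alpha> \<beta> A0 abs_ge_zero)
  have lim: "(\<lambda>k. \<phi> k x) \<longlonglongrightarrow> ?u x" "(\<lambda>k. grad (\<phi> k) x) \<longlonglongrightarrow> ?g x" for x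
    unfolding gr unfolding \<phi>_def by (intro tendsto_intros \<alpha> \<beta>)+
  have b': "norm (\<phi> k x) \<le> A * B" for k x using b by simp
  note u = L2_dominated_convergence[OF rect_measurable(2) meas(1) mu b' AE_I2[OF lim(1)]]
  note cg = L2_dominated_convergence[OF rect_measurable(2) meas(2) mg bg AE_I2[OF lim(2)]]

  have tl: "test_limit ?R \<phi> ?u ?g" unfolding test_limit_def using t u(2) cg(2) by blast
  then show "has_H10_grad a b ?u ?g" unfolding has_H10_grad_def using u(1) cg(1) by blast
  have line: "(\<lambda>t. f x * s t) \<in> L2_space {0<..<1} \<and> (\<lambda>k. L2_norm {0<..<1} (\<lambda>t. \<phi> k (x, t) - f x * s t)) \<longlonglongrightarrow> 0" for x
  proof -
    have "(\<lambda>t. \<phi> k (x, t)) \<in> borel_measurable (lebesgue_on {0<..<1})" for k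
      unfolding \<phi>_def using \<beta>(1)[of k]
      by (intro continuous_measurable_lebesgue_on) (auto intro!: continuous_intros smooth_continuous)
    moreover have "(\<lambda>t. f x * s t) \<in> borel_measurable (lebesgue_on {0<..<1})"
      by (intro borel_measurable_lebesgue_on borel_measurable_times bor(3)) simp
    moreover have "{0<..<1::real} \<in> lmeasurable" by simp
    moreover have "(\<lambda>k. \<phi> k (x, t)) \<longlonglongrightarrow> f x * s t" for t using lim(1)[of "(x, t)"] by simp
    then have "AE t in lebesgue_on {0<..<1}. (\<lambda>k. \<phi> k (x, t)) \<longlonglongrightarrow> f x * s t" by (rule AE_I2)
    ultimately show ?thesis
      using L2_dominated_convergence[of "{0<..<1::real}" "\<lambda>k t. \<phi> k (x, t)" "\<lambda>t. f x * s t", OF _ _ _ b'] by blast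
  qed
  show "\<exists>\<phi>. test_limit ?R \<phi> ?u ?g \<and> (\<forall>x. (\<lambda>k. L2_norm {0<..<1} (\<lambda>t. \<phi> k (x, t) - f x * s t)) \<longlonglongrightarrow> 0)"
    using tl line by blast
  show "(\<lambda>t. c * s t) \<in> L2_space {0<..<1}"
  proof (rule L2_space_bounded)
    show "AE t in lebesgue_on {0<..<1}. norm (c * s t) \<le> \<bar>c\<bar> * B"
    proof (rule AE_I2)
      fix t
      have "\<bar>s t\<bar> \<le> B" by (rule Lim_bounded[OF tendsto_rabs[OF \<beta>(5)], of 0]) (simp add: \<beta>(3))
      then show "norm (c * s t) \<le> \<bar>c\<bar> * B" by (simp add: abs_mult mult_left_mono)
    qed
  qed (auto intro!: borel_measurable_lebesgue_on borel_measurable_times bor(3))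
qed

section \<open>Traces expressed through approximating pairs\<close>

lemma has_traceI:
  assumes \<phi>: "test_limit (rect 0 N) \<phi> u g" and L2: "u \<in> L2_space (rect 0 N)" "g \<in> L2_space (rect 0 N)"
    and h: "h \<in> L2_space {0<..<1}" "(\<lambda>k. L2_norm {0<..<1} (\<lambda>t. \<phi> k (real i, t) - h t)) \<longlonglongrightarrow> 0"
  shows "has_trace N i u h"
proof -
  have O: "Omega N = rect 0 N" by (simp add: Omega_eq rect_def)
  have t: "\<And>k. \<phi> k \<in> test_functions (rect 0 N)" using \<phi> by (simp add: test_limit_def)
  have H: "has_H10_grad 0 N u g" unfolding has_H10_grad_def using L2 \<phi> by blast
  note w = H10_spaceI[OF H of_nat_0_le_iff]
  have "(\<lambda>k. H1_norm (rect 0 N) (\<lambda>x. \<phi> k x - u x)) \<longlonglongrightarrow> 0"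
    using H1_norm_tendsto_iff[OF t of_nat_0_le_iff L2(1) w(2)] \<phi> by simp
  then show ?thesis unfolding has_trace_def O using w(1) h t by blast
qed

lemma has_traceD:
  assumes "has_trace N i u h"
  shows "h \<in> L2_space {0<..<1}" "u \<in> H10_space (rect 0 N)"
    and "\<exists>\<phi>. test_limit (rect 0 N) \<phi> u (weak_gradient (rect 0 N) u) \<and>
        (\<lambda>k. L2_norm {0<..<1} (\<lambda>t. \<phi> k (real i, t) - h t)) \<longlonglongrightarrow> 0"
proof -
  have O: "Omega N = rect 0 N" by (simp add: Omega_eq rect_def)
  show h: "h \<in> L2_space {0<..<1}" "u \<in> H10_space (rect 0 N)"
    using assms unfolding has_trace_def O by blast+
  obtain \<phi> where \<phi>: "\<And>k. \<phi> k \<in> test_functions (rect 0 N)" "(\<lambda>k. H1_norm (rect 0 N) (\<lambda>x. \<phi> k x - u x)) \<longlonglongrightarrow> 0"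
    "(\<lambda>k. L2_norm {0<..<1} (\<lambda>t. \<phi> k (real i, t) - h t)) \<longlonglongrightarrow> 0"
    using assms unfolding has_trace_def O by blast
  have H: "has_H10_grad 0 N u (weak_gradient (rect 0 N) u)" by (rule H10_spaceD[OF h(2) of_nat_0_le_iff])
  have "test_limit (rect 0 N) \<phi> u (weak_gradient (rect 0 N) u)"
    using H1_norm_tendsto_iff[OF \<phi>(1) of_nat_0_le_iff has_H10_gradD(1)[OF H] H10_spaceI(2)[OF H of_nat_0_le_iff]] \<phi>(2)
    by simp
  then show "\<exists>\<phi>. test_limit (rect 0 N) \<phi> u (weak_gradient (rect 0 N) u) \<and>
        (\<lambda>k. L2_norm {0<..<1} (\<lambda>t. \<phi> k (real i, t) - h t)) \<longlonglongrightarrow> 0" using \<phi>(3) by blast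
qed

section \<open>Sine coefficients of traces\<close>

lemma L2_continuous:
  fixes h :: "real \<times> real \<Rightarrow> 'b::euclidean_space"
  assumes "continuous_on UNIV h"
  shows "h \<in> L2_space (rect a b)"
proof -
  have "compact (h ` cbox (a, 0) (b, 1))"
    using assms by (intro compact_continuous_image continuous_on_subset[OF assms]) auto
  then have "bounded (h ` cbox (a, 0) (b, 1))" by (rule compact_imp_bounded)
  then obtain B where "\<forall>y\<in>h ` cbox (a, 0) (b, 1). norm y \<le> B" unfolding bounded_iff by (elim exE)
  then have B: "norm (h x) \<le> B" if "x \<in> cbox (a, 0) (b, 1)" for x using that by (simp del: cbox_Pair_iff)
  have "AE x in lebesgue_on (rect a b). norm (h x) \<le> B"
  proof (rule AE_I2)
    fix x assume "x \<in> space (lebesgue_on (rect a b))"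
    then have "x \<in> cbox (a, 0) (b, 1)" using box_subset_cbox[of "(a, 0)" "(b, 1)"] by (auto simp: rect_eq_box)
    then show "norm (h x) \<le> B" by (rule B)
  qed
  then show ?thesis by (rule L2_space_bounded[OF rect_measurable(2) continuous_measurable_lebesgue_on[OF assms]])
qed

definition cut :: "nat \<Rightarrow> nat \<Rightarrow> real \<times> real \<Rightarrow> real \<times> real"
  where "cut n j x = (if x \<in> rect 0 j then (sin (pi * real n * snd x), 0) else 0)"

lemma cut_L2: "cut n j \<in> L2_space (rect 0 N)" if "j \<le> N" for N :: nat
proof -
  have "(\<lambda>x::real\<times>real. (sin (pi * real n * snd x), 0 :: real)) \<in> L2_space (rect 0 j)"
    by (intro L2_continuous continuous_intros)
  then show ?thesis using that unfolding cut_def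
    by (intro L2_zero_extension rect_mono) auto
qed

text \<open>Twice the \<open>n\<close>-th sine moment of the trace on \<open>\<Gamma>\<^sub>j\<close>, written as an integral over the part of the
  domain to the left of \<open>\<Gamma>\<^sub>j\<close>, where it only depends on the gradient.\<close>

definition coef :: "nat \<Rightarrow> nat \<Rightarrow> nat \<Rightarrow> (real \<times> real \<Rightarrow> real \<times> real) \<Rightarrow> real"
  where "coef N n j g = 2 * L2_inner (rect 0 N) g (cut n j)"

definition moment :: "(real \<times> real \<Rightarrow> real) \<Rightarrow> nat \<Rightarrow> real \<Rightarrow> real"
  where "moment \<phi> n s = integral {0..1} (\<lambda>t. \<phi> (s, t) * sin (pi * real n * t))"

lemma sin_cos_derivs:
  "((\<lambda>t. sin (pi * real n * t)) has_real_derivative pi * real n * cos (pi * real n * t)) (at t)"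
  "((\<lambda>t. cos (pi * real n * t)) has_real_derivative - (pi * real n * sin (pi * real n * t))) (at t)"
  by (auto intro!: derivative_eq_intros)

lemma smooth_sin: "smooth (\<lambda>t. sin (pi * real n * t))"
  using smooth_affine[OF smooth_sin_cos(1), of "pi * real n" 0] by simp

text \<open>The fundamental theorem in the first variable: \<phi> vanishes on the left edge, so
  integrating its first partial derivative times the sine over the part left of x1 = j leaves only
  the values on that line.\<close>

lemma test_moment:
  fixes N :: nat
  assumes \<phi>: "\<phi> \<in> test_functions (rect 0 N)" and j: "j \<le> N"
  shows "L2_inner (rect 0 N) (grad \<phi>) (cut n j) = moment \<phi> n j"
proof -
  let ?s = "\<lambda>x::real\<times>real. 1 * sin (pi * real n * snd x)"
  let ?gs = "\<lambda>x::real\<times>real. (0 * sin (pi * real n * snd x), 1 * (pi * real n * cos (pi * real n * snd x)))"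
  let ?G = "\<lambda>x. \<phi> x *\<^sub>R ?gs x + ?s x *\<^sub>R grad \<phi> x"
  have ds: "(?s has_derivative (\<lambda>h. ?gs x \<bullet> h)) (at x)" for x
    by (rule grad_tensor[of "\<lambda>_. 1" 0]) (auto intro: sin_cos_derivs)
  have d: "((\<lambda>x. \<phi> x * ?s x) has_derivative (\<lambda>h. ?G x \<bullet> h)) (at x)" for x
    using has_derivative_mult[OF smooth_grad(1)[OF test_smooth[OF \<phi>]] ds]
    by (rule has_derivative_eq_rhs) (auto simp: inner_add_left)
  have c: "continuous_on UNIV ?G"
    by (intro continuous_intros smooth_continuous smooth_grad test_smooth[OF \<phi>])
  have "L2_inner (rect 0 N) (grad \<phi>) (cut n j) = L2_inner (rect 0 j) (grad \<phi>) (cut n j)"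
    using j by (intro L2_inner_superset rect_mono) (auto simp: cut_def)
  also have "\<dots> = (LINT x|lebesgue_on (rect 0 j). fst (?G x))"
    unfolding L2_inner_def by (rule Bochner_Integration.integral_cong) (auto simp: cut_def inner_prod_def)
  also have "\<dots> = integral {0..1} (\<lambda>t. \<phi> (real j, t) * ?s (real j, t) - \<phi> (0, t) * ?s (0 :: real, t))"
    by (rule Green_rect(1)[OF d c]) simp
  also have "\<dots> = moment \<phi> n j"
    using test_zero_outside(1)[OF \<phi>, of "(0, _)"] by (simp add: moment_def rect_def)
  finally show ?thesis .
qed

lemma moment_eq_L2_inner:
  assumes "continuous_on UNIV \<phi>"
  shows "moment \<phi> n s = L2_inner {0<..<1} (\<lambda>t. \<phi> (s, t)) (\<lambda>t. sin (pi * real n * t))"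
    and "(\<lambda>t. \<phi> (s, t)) \<in> L2_space {0<..<1}"
proof -
  have c: "continuous_on {0..1} (\<lambda>t. \<phi> (s, t))"
    by (rule continuous_on_compose2[OF assms]) (auto intro!: continuous_intros)

  have int: "integrable (lebesgue_on {0<..<1}) f" "(LINT t|lebesgue_on {0<..<1}. f t) = integral {0..1} f"
    if "continuous_on {0..1} f" for f :: "real \<Rightarrow> real"
  proof -
    have "f absolutely_integrable_on {0..1}" by (rule absolutely_integrable_continuous_real[OF that])
    then have "f absolutely_integrable_on {0<..<1}"
      using absolutely_integrable_on_open_interval[where f = f and a = 0 and b = 1] by simp
    then show i: "integrable (lebesgue_on {0<..<1}) f" by (simp add: absolutely_integrable_imp_integrable)
    show "(LINT t|lebesgue_on {0<..<1}. f t) = integral {0..1} f"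
      using lebesgue_integral_eq_integral[OF i] by (simp add: integral_open_interval_real)
  qed
  show "moment \<phi> n s = L2_inner {0<..<1} (\<lambda>t. \<phi> (s, t)) (\<lambda>t. sin (pi * real n * t))"
    using int(2)[of "\<lambda>t. \<phi> (s, t) * sin (pi * real n * t)"] c
    by (simp add: moment_def L2_inner_def continuous_intros)
  have "(\<lambda>t. \<phi> (s, t)) \<in> borel_measurable (lebesgue_on {0<..<1})"
    using int(1)[OF c] by simp
  moreover have "integrable (lebesgue_on {0<..<1}) (\<lambda>t. (norm (\<phi> (s, t)))\<^sup>2)"
    by (intro int(1) continuous_intros c)
  ultimately show "(\<lambda>t. \<phi> (s, t)) \<in> L2_space {0<..<1}" by (simp add: L2_space_def)
qed

lemma sin_L2: "(\<lambda>t. sin (pi * real n * t)) \<in> L2_space {0<..<1}"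
proof -
  have "continuous_on UNIV (\<lambda>x::real\<times>real. sin (pi * real n * snd x))" by (intro continuous_intros)
  from moment_eq_L2_inner(2)[OF this] show ?thesis by simp
qed

text \<open>The moments of the approximating test functions have two limits: convergence of the
  gradients gives the pairing with \<open>cut n j\<close>, convergence of the restrictions gives the
  moment of h.\<close>

lemma coef_eq_trace_moment:
  assumes "has_trace N j u h" "j \<le> N"
  shows "coef N n j (weak_gradient (rect 0 N) u) = 2 * L2_inner {0<..<1} h (\<lambda>t. sin (pi * real n * t))"
proof -
  note tr = has_traceD[OF assms(1)]
  obtain \<phi> where \<phi>: "test_limit (rect 0 N) \<phi> u (weak_gradient (rect 0 N) u)"
    "(\<lambda>k. L2_norm {0<..<1} (\<lambda>t. \<phi> k (real j, t) - h t)) \<longlonglongrightarrow> 0" using tr(3) by blast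
  have t: "\<phi> k \<in> test_functions (rect 0 N)" for k using \<phi>(1) by (simp add: test_limit_def)
  note m = moment_eq_L2_inner[OF smooth_continuous[OF test_smooth[OF t]]]
  have g: "weak_gradient (rect 0 N) u \<in> L2_space (rect 0 N)"
    by (rule has_H10_gradD(2)[OF H10_spaceD[OF tr(2) of_nat_0_le_iff]])
  have "(\<lambda>k. moment (\<phi> k) n j) \<longlonglongrightarrow> L2_inner (rect 0 N) (weak_gradient (rect 0 N) u) (cut n j)"
    using test_limit_inner[OF \<phi>(1) g cut_L2[OF assms(2)]] by (simp add: test_moment[OF t assms(2)])
  moreover have "(\<lambda>k. moment (\<phi> k) n j) \<longlonglongrightarrow> L2_inner {0<..<1} h (\<lambda>t. sin (pi * real n * t))"
    unfolding m(1) by (intro L2_tendsto_inner m(2) tr(1) sin_L2 \<phi>(2))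
  ultimately show ?thesis unfolding coef_def by (metis LIMSEQ_unique)
qed

text \<open>The differential equation makes s(x1) sin (\<pi> n x2) harmonic, and the second argument
  of the pairing is its gradient. Green's formula leaves the normal derivative on the vertical
  edges; the horizontal edges drop out because \<phi> vanishes there.\<close>

lemma test_separated_solution:
  assumes \<phi>: "\<phi> \<in> test_functions S" and ab: "a \<le> b"
    and s: "\<And>x. (s has_real_derivative s1 x) (at x)" "\<And>x. (s1 has_real_derivative (pi * real n)\<^sup>2 * s x) (at x)"
    and z: "\<And>x. \<phi> (x, 0) = 0" "\<And>x. \<phi> (x, 1) = 0"
  shows "L2_inner (rect a b) (grad \<phi>)
      (\<lambda>x. (s1 (fst x) * sin (pi * real n * snd x), s (fst x) * (pi * real n * cos (pi * real n * snd x))))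
    = s1 b * moment \<phi> n b - s1 a * moment \<phi> n a"
proof -
  let ?w = "pi * real n"
  let ?F1 = "\<lambda>x. s1 (fst x) * sin (?w * snd x)" and ?F2 = "\<lambda>x. s (fst x) * (?w * cos (?w * snd x))"
  let ?g1 = "\<lambda>x. (?w\<^sup>2 * s (fst x) * sin (?w * snd x), s1 (fst x) * (?w * cos (?w * snd x)))"
  let ?g2 = "\<lambda>x. (s1 (fst x) * (?w * cos (?w * snd x)), s (fst x) * (?w * (- (?w * sin (?w * snd x)))))"
  let ?G1 = "\<lambda>x. \<phi> x *\<^sub>R ?g1 x + ?F1 x *\<^sub>R grad \<phi> x" and ?G2 = "\<lambda>x. \<phi> x *\<^sub>R ?g2 x + ?F2 x *\<^sub>R grad \<phi> x"
  have contR: "continuous_on UNIV s" "continuous_on UNIV s1"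
    using s by (auto intro!: continuous_at_imp_continuous_on DERIV_isCont)
  have "continuous_on UNIV (\<lambda>x::real\<times>real. s (fst x))" "continuous_on UNIV (\<lambda>x::real\<times>real. s1 (fst x))"
    by (rule continuous_on_compose2[OF contR(1)], auto intro!: continuous_intros,
        rule continuous_on_compose2[OF contR(2)], auto intro!: continuous_intros)
  note cont = this smooth_continuous[OF test_smooth[OF \<phi>]] smooth_grad(4)[OF test_smooth[OF \<phi>]]
  have d1: "((\<lambda>x. \<phi> x * ?F1 x) has_derivative (\<lambda>h. ?G1 x \<bullet> h)) (at x)" for x
    by (rule has_derivative_eq_rhs[OF has_derivative_mult[OF smooth_grad(1)[OF test_smooth[OF \<phi>]]
        grad_tensor[OF s(2) sin_cos_derivs(1)]]])
      (rule ext, simp only: inner_add_left inner_scaleR_left mult.commute)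
  have d2: "((\<lambda>x. \<phi> x * ?F2 x) has_derivative (\<lambda>h. ?G2 x \<bullet> h)) (at x)" for x
    by (rule has_derivative_eq_rhs[OF has_derivative_mult[OF smooth_grad(1)[OF test_smooth[OF \<phi>]]
        grad_tensor[OF s(1) DERIV_cmult[OF sin_cos_derivs(2)]]]])
      (rule ext, simp only: inner_add_left inner_scaleR_left mult.commute)
  have c: "continuous_on UNIV ?G1" "continuous_on UNIV ?G2"
    by (intro continuous_intros cont)+
  have i: "integrable (lebesgue_on (rect a b)) (\<lambda>x. fst (?G1 x))" "integrable (lebesgue_on (rect a b)) (\<lambda>x. snd (?G2 x))"
    by (intro integral_rect_eq(1) continuous_on_subset[OF continuous_on_fst[OF c(1)]] subset_UNIV,
        intro integral_rect_eq(1) continuous_on_subset[OF continuous_on_snd[OF c(2)]] subset_UNIV)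
  have mi: "(\<lambda>t. \<phi> (x, t) * sin (?w * t)) integrable_on {0..1}" for x
    by (intro integrable_continuous_real continuous_intros continuous_on_compose2[OF cont(3)]) auto
  have "L2_inner (rect a b) (grad \<phi>) (\<lambda>x. (?F1 x, ?F2 x)) = (LINT x|lebesgue_on (rect a b). fst (?G1 x) + snd (?G2 x))"
    unfolding L2_inner_def
    by (rule Bochner_Integration.integral_cong) (auto simp: inner_prod_def power2_eq_square algebra_simps)
  also have "\<dots> = (LINT x|lebesgue_on (rect a b). fst (?G1 x)) + (LINT x|lebesgue_on (rect a b). snd (?G2 x))"
    by (rule Bochner_Integration.integral_add[OF i])
  also have "(LINT x|lebesgue_on (rect a b). snd (?G2 x)) = 0"
    using Green_rect(2)[OF d2 c(2) ab] by (simp add: z)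
  also have "(LINT x|lebesgue_on (rect a b). fst (?G1 x)) =
      integral {0..1} (\<lambda>t. s1 b * (\<phi> (b, t) * sin (?w * t)) - s1 a * (\<phi> (a, t) * sin (?w * t)))"
    using Green_rect(1)[OF d1 c(1) ab] by (simp add: mult.assoc mult.left_commute)
  also have "\<dots> = s1 b * moment \<phi> n b - s1 a * moment \<phi> n a"
    unfolding moment_def using mi by (subst integral_diff) (auto intro: integrable_on_mult_right)
  finally show ?thesis by simp
qed

text \<open>The lines x1 = 0 and x1 = N lie on the boundary, where test functions vanish. These
  zeros close the tridiagonal systems at both ends.\<close>

lemma coef_boundary:
  assumes "has_H10_grad 0 N u g"
  shows "coef N n 0 g = 0" "coef N n N g = 0"
proof -
  have "L2_inner (rect 0 N) (grad \<phi>) (cut n j) = 0" if "\<phi> \<in> test_functions (rect 0 N)" "j = 0 \<or> j = N" for \<phi> j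
  proof -
    have "\<phi> (real j, t) = 0" for t using that by (intro test_zero_outside(1)[OF that(1)]) (auto simp: rect_def)
    then show ?thesis using test_moment[OF that(1), of j n] that(2) by (auto simp: moment_def)
  qed
  then show "coef N n 0 g = 0" "coef N n N g = 0"
    unfolding coef_def using H10_orthogonal_if_test_orthogonal[OF assms cut_L2, of 0 n]
      H10_orthogonal_if_test_orthogonal[OF assms cut_L2, of N n] by simp_all
qed

lemma inner_separated_solution:
  assumes u: "has_H10_grad 0 N u g" and j: "1 \<le> j" "j \<le> N"
    and s: "\<And>x. (s has_real_derivative s1 x) (at x)" "\<And>x. (s1 has_real_derivative (pi * real n)\<^sup>2 * s x) (at x)"
  shows "L2_inner (rect (real j - 1) j) g
      (\<lambda>x. (s1 (fst x) * sin (pi * real n * snd x), s (fst x) * (pi * real n * cos (pi * real n * snd x))))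
    = (s1 j * coef N n j g - s1 (real j - 1) * coef N n (j - 1) g) / 2"
proof -
  let ?R = "rect 0 N" and ?S = "rect (real j - 1) j"
  let ?h = "\<lambda>x. (s1 (fst x) * sin (pi * real n * snd x), s (fst x) * (pi * real n * cos (pi * real n * snd x)))"
  let ?e = "\<lambda>x. if x \<in> ?S then ?h x else 0"
  have j': "j - 1 \<le> N" "real (j - 1) = real j - 1" using j by (auto simp: of_nat_diff)
  have contR: "continuous_on UNIV s" "continuous_on UNIV s1"
    using s by (auto intro!: continuous_at_imp_continuous_on DERIV_isCont)
  have "continuous_on UNIV (\<lambda>x::real\<times>real. s (fst x))" "continuous_on UNIV (\<lambda>x::real\<times>real. s1 (fst x))"
    by (rule continuous_on_compose2[OF contR(1)], auto intro!: continuous_intros,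
        rule continuous_on_compose2[OF contR(2)], auto intro!: continuous_intros)
  then have hS: "?h \<in> L2_space ?S" by (intro L2_continuous continuous_intros)
  have sub: "?S \<subseteq> ?R" using j by (intro rect_mono) auto
  have e: "?e \<in> L2_space ?R" by (rule L2_zero_extension[OF sub _ _ hS]) auto
  have inner_e: "L2_inner ?R g' ?e = L2_inner ?S g' ?h" for g'
    using L2_inner_superset[OF sub, of g' ?e] L2_inner_cong_on[of ?S g' g' ?e ?h] by simp
  note cL = cut_L2[OF j(2), of n] cut_L2[OF j'(1), of n]
  \<comment> \<open>The claimed identity, multiplied out, says that g is orthogonal to this one
    field, so density of test functions applies.\<close>
  let ?k = "\<lambda>x. ?e x - (s1 j *\<^sub>R cut n j x - s1 (real j - 1) *\<^sub>R cut n (j - 1) x)"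
  have k: "?k \<in> L2_space ?R" by (intro L2_diff L2_scaleR e cL)
  have inner_k: "L2_inner ?R g' ?k = L2_inner ?S g' ?h - (s1 j * L2_inner ?R g' (cut n j) - s1 (real j - 1) * L2_inner ?R g' (cut n (j - 1)))"
    if g': "g' \<in> L2_space ?R" for g'
  proof -
    have "L2_inner ?R ?k g' = L2_inner ?R ?e g' - (s1 j * L2_inner ?R (cut n j) g' - s1 (real j - 1) * L2_inner ?R (cut n (j - 1)) g')"
      by (subst L2_inner_diff_left[OF e _ g'], intro L2_diff L2_scaleR cL, subst L2_inner_diff_left[OF _ _ g'])
        (intro L2_scaleR cL | simp add: L2_inner_scaleR_left)+
    then show ?thesis using inner_e[of g'] by (simp add: L2_inner_commute[of ?R g'])
  qed
  have "L2_inner ?R g ?k = 0"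
  proof (rule H10_orthogonal_if_test_orthogonal[OF u k])
    fix \<phi> assume \<phi>: "\<phi> \<in> test_functions ?R"
    have z: "\<phi> (x, 0) = 0" "\<phi> (x, 1) = 0" for x by (rule test_zero_outside(1)[OF \<phi>]; simp add: rect_def)+
    have "L2_inner ?S (grad \<phi>) ?h = s1 j * moment \<phi> n j - s1 (real j - 1) * moment \<phi> n (real j - 1)"
      by (rule test_separated_solution[OF \<phi> _ s z]) simp
    then show "L2_inner ?R (grad \<phi>) ?k = 0"
      unfolding inner_k[OF test_L2(2)[OF \<phi> rect_measurable(2)]] test_moment[OF \<phi> j(2)] test_moment[OF \<phi> j'(1)] j'(2)
      by simp
  qed
  then show ?thesis unfolding inner_k[OF has_H10_gradD(2)[OF u]] coef_def by simp
qed

lemma sin_sin_moment: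
  assumes "1 \<le> n" "1 \<le> m"
  shows "L2_inner {0<..<1} (\<lambda>t. sin (pi * real n * t)) (\<lambda>t. sin (pi * real m * t)) = (if n = m then 1/2 else 0)"
proof -
  let ?f = "\<lambda>t. sin (pi * real n * t) * sin (pi * real m * t)"
  have "L2_inner {0<..<1} (\<lambda>t. sin (pi * real n * t)) (\<lambda>t. sin (pi * real m * t)) = integral {0..1} ?f"
  proof -
    have "continuous_on UNIV (\<lambda>x::real\<times>real. sin (pi * real n * snd x))" by (intro continuous_intros)
    from moment_eq_L2_inner(1)[OF this, of m] show ?thesis by (simp add: moment_def)
  qed
  also have "\<dots> = (if n = m then 1/2 else 0)"
  proof (rule integral_unique, cases "n = m")
    case True
    define w where "w = pi * real n"
    have w: "w \<noteq> 0" "sin (2 * w) = 0" using assms sin_npi2[of "2 * n"] by (simp_all add: w_def mult_ac)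
    let ?F = "\<lambda>t. t / 2 - sin (2 * w * t) / (4 * w)"
    have f: "?f t = 1/2 - cos (2 * w * t) / 2" for t
      using cos_double_sin[of "w * t"] True by (simp add: w_def power2_eq_square mult.assoc diff_divide_distrib)
    have "(?F has_vector_derivative 1/2 - cos (2 * w * t) / 2) (at t within {0..1})" for t
      unfolding has_real_derivative_iff_has_vector_derivative[symmetric]
      using w by (auto intro!: derivative_eq_intros simp: field_simps)
    then have "((\<lambda>t. 1/2 - cos (2 * w * t) / 2) has_integral (?F 1 - ?F 0)) {0..1}"
      by (intro fundamental_theorem_of_calculus) auto
    then show "(?f has_integral (if n = m then 1/2 else 0)) {0..1}" using True w unfolding f by simp
  next
    case False
    define a b where "a = pi * (real n - real m)" and "b = pi * (real n + real m)"
    have ab: "a \<noteq> 0" "b \<noteq> 0" using False assms by (auto simp: a_def b_def)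
    let ?F = "\<lambda>t. sin (a * t) / (2 * a) - sin (b * t) / (2 * b)"
    have f: "?f t = cos (a * t) / 2 - cos (b * t) / 2" for t
    proof -
      have "a * t = pi * real n * t - pi * real m * t" "b * t = pi * real n * t + pi * real m * t"
        by (simp_all add: a_def b_def algebra_simps)
      then show ?thesis by (simp only: sin_times_sin diff_divide_distrib)
    qed
    have "(?F has_vector_derivative cos (a * t) / 2 - cos (b * t) / 2) (at t within {0..1})" for t
      unfolding has_real_derivative_iff_has_vector_derivative[symmetric]
      using ab by (auto intro!: derivative_eq_intros)
    then have "(?f has_integral (?F 1 - ?F 0)) {0..1}" unfolding f
      by (intro fundamental_theorem_of_calculus) auto
    moreover have "sin a = 0" "sin b = 0"
      using sin_npi2[of n] sin_npi2[of m] unfolding a_def b_def distrib_left right_diff_distrib sin_diff sin_add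
      by simp_all
    ultimately show "(?f has_integral (if n = m then 1/2 else 0)) {0..1}" using False by simp
  qed
  finally show ?thesis .
qed

section \<open>Discrete harmonic functions and the sine modes\<close>

text \<open>For n \<ge> 1 this is the solution of s'' = (\<pi> n)^2 s with value 0 at c and 1 at c +
  1, hence -1 at c - 1; \<open>hc\<close> is its derivative. Harmonic extensions on cells of width 1
  are combined from it.\<close>

definition hs :: "nat \<Rightarrow> real \<Rightarrow> real \<Rightarrow> real"
  where "hs n c x = sinh (pi * real n * (x - c)) / sinh (pi * real n)"

definition hc :: "nat \<Rightarrow> real \<Rightarrow> real \<Rightarrow> real"
  where "hc n c x = pi * real n * cosh (pi * real n * (x - c)) / sinh (pi * real n)"

lemma hs_derivs:
  "(hs n c has_real_derivative hc n c x) (at x)"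
  "(hc n c has_real_derivative (pi * real n)\<^sup>2 * hs n c x) (at x)"
  unfolding hs_def[abs_def] hc_def[abs_def]
  by (cases "n = 0"; auto intro!: derivative_eq_intros simp: power2_eq_square)+

lemma smooth_hs: "smooth (hs n c)"
proof -
  have "smooth (\<lambda>x. sinh (pi * real n * x + - (pi * real n * c)) * inverse (sinh (pi * real n)))"
    by (rule smooth_mult[OF smooth_affine[OF smooth_sinh_cosh(1)] smooth_const])
  then show ?thesis by (simp add: hs_def[abs_def] divide_inverse right_diff_distrib)
qed

lemma hs_values:
  assumes "1 \<le> n"
  shows "hs n c c = 0" "hs n c (c + 1) = 1" "hs n c (c - 1) = -1"
  using assms by (simp_all add: hs_def)

text \<open>Harmonic counterpart of the hat function, with nodal value 1 at i and 0 at both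
  neighbours. The minus sign on the right piece compensates the value -1 of \<open>hs\<close> one
  unit to the left of its zero.\<close>

definition tent :: "nat \<Rightarrow> nat \<Rightarrow> real \<Rightarrow> real"
  where "tent n i x = (if x \<in> {real i - 1..real i} then hs n (real i - 1) x
    else if x \<in> {real i..real i + 1} then - hs n (real i + 1) x else 0)"

text \<open>The value 0 at the kinks is the one delivered by the limit in
  \<open>adm_kink\<close>.\<close>

definition tent' :: "nat \<Rightarrow> nat \<Rightarrow> real \<Rightarrow> real"
  where "tent' n i x = (if x \<in> {real i - 1<..<real i} then hc n (real i - 1) x
    else if x \<in> {real i<..<real i + 1} then - hc n (real i + 1) x else 0)"

definition sine :: "nat \<Rightarrow> real \<Rightarrow> real"
  where "sine n t = (if t \<in> {0..1} then sin (pi * real n * t) else 0)"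

definition sine' :: "nat \<Rightarrow> real \<Rightarrow> real"
  where "sine' n t = (if t \<in> {0<..<1} then pi * real n * cos (pi * real n * t) else 0)"

lemma adm_sine: "adm 0 1 (sine n) (sine' n)"
proof -
  have d: "deriv (\<lambda>t. sin (pi * real n * t)) t = pi * real n * cos (pi * real n * t)" for t
    by (rule DERIV_imp_deriv[OF sin_cos_derivs(1)])
  have "adm 0 1 (\<lambda>t. if t \<in> {0..1} then sin (pi * real n * t) else 0)
      (\<lambda>t. if t \<in> {0<..<1} then deriv (\<lambda>t. sin (pi * real n * t)) t else 0)"
    by (rule adm_smooth[OF _ smooth_sin]) simp_all
  then show ?thesis unfolding d sine_def[abs_def] sine'_def[abs_def] .
qed

lemma adm_tent:
  assumes "1 \<le> n" "1 \<le> i" "i + 1 \<le> N"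
  shows "adm 0 (real N) (tent n i) (tent' n i)"
proof -
  have d: "deriv (hs n (real i - 1)) x = hc n (real i - 1) x" "deriv (\<lambda>x. - hs n (real i + 1) x) x = - hc n (real i + 1) x" for x
    by (rule DERIV_imp_deriv[OF hs_derivs(1)], rule DERIV_imp_deriv[OF DERIV_minus[OF hs_derivs(1)]])
  have sm: "smooth (\<lambda>x. - hs n (real i + 1) x)"
    using smooth_mult[OF smooth_const[of "-1"] smooth_hs[of n "real i + 1"]] by simp
  have v: "hs n (real i - 1) (real i) = 1" "hs n (real i + 1) (real i) = - 1"
    using hs_values(2)[OF assms(1), of "real i - 1"] hs_values(3)[OF assms(1), of "real i + 1"] by simp_all
  have "adm 0 (real N) (\<lambda>x. if x \<in> {real i - 1..real i} then hs n (real i - 1) x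
      else if x \<in> {real i..real i + 1} then - hs n (real i + 1) x else 0)
    (\<lambda>x. if x \<in> {real i - 1<..<real i} then deriv (hs n (real i - 1)) x
      else if x \<in> {real i<..<real i + 1} then deriv (\<lambda>x. - hs n (real i + 1) x) x else 0)"
    by (rule adm_kink) (use assms in \<open>simp_all add: sm smooth_hs v hs_values\<close>)
  then show ?thesis unfolding d by (simp add: tent_def[abs_def] tent'_def[abs_def])
qed

text \<open>The discrete harmonic extension of sin (\<pi> n x2) from the interface i, nonzero only
  on the closure of the two adjacent subdomains; \<open>gmode\<close> is its gradient.\<close>

definition mode :: "nat \<Rightarrow> nat \<Rightarrow> real \<times> real \<Rightarrow> real"
  where "mode n i x = tent n i (fst x) * sine n (snd x)"

definition gmode :: "nat \<Rightarrow> nat \<Rightarrow> real \<times> real \<Rightarrow> real \<times> real"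
  where "gmode n i x = (tent' n i (fst x) * sine n (snd x), tent n i (fst x) * sine' n (snd x))"

lemma mode_H10:
  fixes N :: nat
  assumes "1 \<le> n" "1 \<le> i" "i + 1 \<le> N"
  shows "has_H10_grad 0 N (mode n i) (gmode n i)"
  using adm_tensor(2)[OF adm_tent[OF assms] adm_sine[of n]] by (simp add: mode_def[abs_def] gmode_def[abs_def])

lemma tent_at: "1 \<le> n \<Longrightarrow> tent n i (real j) = (if j = i then 1 else 0)"
proof -
  assume n: "1 \<le> n"
  consider "j = i" | "j + 1 = i" | "j = i + 1" | "j + 1 < i \<or> i + 1 < j" by linarith
  then show ?thesis
  proof cases
    case 1 then show ?thesis using hs_values(2)[OF n, of "real i - 1"] by (simp add: tent_def)
  next
    case 2
    then have "real j = real i - 1" by linarith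
    then show ?thesis using 2 hs_values(1)[OF n] by (auto simp: tent_def)
  next
    case 3
    then show ?thesis using hs_values(1)[OF n] by (auto simp: tent_def add.commute)
  next
    case 4
    then have "real j < real i - 1 \<or> real i + 1 < real j" by linarith
    then show ?thesis using 4 by (auto simp: tent_def)
  qed
qed

lemma has_trace_cong:
  assumes "has_trace N j u h" "\<And>t. t \<in> {0<..<1} \<Longrightarrow> h t = h' t"
  shows "has_trace N j u h'"
proof -
  have "L2_norm {0<..<1} (\<lambda>t. \<phi> t - h t) = L2_norm {0<..<1} (\<lambda>t. \<phi> t - h' t)" for \<phi>
    unfolding L2_norm_def by (rule arg_cong[where f = sqrt], rule L2_inner_cong_on) (simp_all add: assms(2))
  then show ?thesis
    using assms(1) L2_space_cong_on[of "{0<..<1}" h h'] assms(2) unfolding has_trace_def by simp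
qed

lemma mode_trace:
  assumes "1 \<le> n" "1 \<le> i" "i + 1 \<le> N"
  shows "has_trace N j (mode n i) (\<lambda>t. if j = i then sin (pi * real n * t) else 0)"
proof -
  note ad = adm_tensor[OF adm_tent[OF assms] adm_sine[of n]]
  obtain \<phi> where \<phi>: "test_limit (rect 0 N) \<phi> (mode n i) (gmode n i)"
    "\<And>x. (\<lambda>k. L2_norm {0<..<1} (\<lambda>t. \<phi> k (x, t) - tent n i x * sine n t)) \<longlonglongrightarrow> 0"
    using ad(1) unfolding mode_def gmode_def by blast
  have "has_trace N j (mode n i) (\<lambda>t. tent n i j * sine n t)"
    by (rule has_traceI[OF \<phi>(1) has_H10_gradD[OF mode_H10[OF assms]] ad(3) \<phi>(2)])
  then show ?thesis
    by (rule has_trace_cong) (use assms in \<open>auto simp: tent_at sine_def\<close>)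
qed

text \<open>The factor 2 in \<open>coef\<close> offsets the integral 1/2 of the squared sine, so
  modes and coefficients are biorthogonal.\<close>

lemma coef_gmode:
  assumes n: "1 \<le> n" "1 \<le> i" "i + 1 \<le> N" and m: "1 \<le> m" "j \<le> N"
  shows "coef N m j (gmode n i) = (if m = n \<and> j = i then 1 else 0)"
proof -
  note w = weak_gradient_AE_eq[OF H10_spaceI(2)[OF mode_H10[OF n] of_nat_0_le_iff]]
  have "coef N m j (gmode n i) = coef N m j (weak_gradient (rect 0 N) (mode n i))"
    unfolding coef_def using w(1)
    by (intro arg_cong[where f = "(*) 2"] L2_inner_cong_AE L2_measurable w(2) cut_L2 m(2) has_H10_gradD(2)[OF mode_H10[OF n]]) auto
  also have "\<dots> = 2 * L2_inner {0<..<1} (\<lambda>t. if j = i then sin (pi * real n * t) else 0) (\<lambda>t. sin (pi * real m * t))"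
    by (rule coef_eq_trace_moment[OF mode_trace[OF n] m(2)])
  also have "\<dots> = (if m = n \<and> j = i then 1 else 0)"
  proof (cases "j = i")
    case True
    then show ?thesis using sin_sin_moment[OF n(1) m(1)] by simp
  qed (simp add: L2_inner_def)
  finally show ?thesis .
qed

lemma tent_left: "x \<in> {real i - 1<..<real i} \<Longrightarrow> tent n i x = hs n (real i - 1) x \<and> tent' n i x = hc n (real i - 1) x"
  and tent_right: "x \<in> {real i<..<real i + 1} \<Longrightarrow> tent n i x = - hs n (real i + 1) x \<and> tent' n i x = - hc n (real i + 1) x"
  and tent_outside: "x < real i - 1 \<or> real i + 1 < x \<Longrightarrow> tent n i x = 0 \<and> tent' n i x = 0"
  by (auto simp: tent_def tent'_def)

lemma sine_inside: "t \<in> {0<..<1} \<Longrightarrow> sine n t = sin (pi * real n * t) \<and> sine' n t = pi * real n * cos (pi * real n * t)"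
  by (simp add: sine_def sine'_def)

lemma rectD: "x \<in> rect a b \<Longrightarrow> fst x \<in> {a<..<b}" "x \<in> rect a b \<Longrightarrow> snd x \<in> {0<..<1}"
  by (auto simp: rect_def)

text \<open>On the two subdomains next to interface i the mode is a separated harmonic function, so
  the pairing reduces to end values of \<open>hc\<close>: up to a common factor, cosh at the
  interface itself and 1 at the neighbour. These become the block entries. The formula covers every
  H10 function, which is what allows zero extensions from a subdomain below.\<close>

lemma inner_gmode:
  assumes u: "has_H10_grad 0 N u g" and j: "1 \<le> j" "j \<le> N" and n: "1 \<le> n" "1 \<le> i" "i + 1 \<le> N"
  shows "L2_inner (rect (real j - 1) j) g (gmode n i) = pi * real n / (2 * sinh (pi * real n)) *
    (if j = i then cosh (pi * real n) * coef N n i g - coef N n (i - 1) g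
     else if j = i + 1 then cosh (pi * real n) * coef N n i g - coef N n (i + 1) g else 0)"
proof -
  let ?S = "rect (real j - 1) j"
  have hcv: "hc n c c = pi * real n / sinh (pi * real n)"
    "hc n c (c + 1) = pi * real n * cosh (pi * real n) / sinh (pi * real n)"
    "hc n c (c - 1) = pi * real n * cosh (pi * real n) / sinh (pi * real n)" for c
    by (simp_all add: hc_def)
  have j1: "hc n (real j - 1) (real j) = pi * real n * cosh (pi * real n) / sinh (pi * real n)"
    using hcv(2)[of "real j - 1"] by simp
  have alg1: "(w * C / S * x - w / S * y) / 2 = w / (2 * S) * (C * x - y)"
    and alg2: "(- (w / S) * y - - (w * C / S) * x) / 2 = w / (2 * S) * (C * x - y)" for w C S x y :: real
    by (cases "S = 0"; simp add: field_simps)+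
  consider "j = i" | "j = i + 1" | "j < i \<or> i + 1 < j" by linarith
  then show ?thesis
  proof cases
    case 1
    have "L2_inner ?S g (gmode n i) = L2_inner ?S g (\<lambda>x. (hc n (real j - 1) (fst x) * sin (pi * real n * snd x),
        hs n (real j - 1) (fst x) * (pi * real n * cos (pi * real n * snd x))))"
    proof (rule L2_inner_cong_on[OF refl])
      fix x assume x: "x \<in> ?S"
      then have "fst x \<in> {real i - 1<..<real i}" using rectD(1)[OF x] 1 by simp
      from tent_left[OF this, of n] sine_inside[OF rectD(2)[OF x], of n]
      show "gmode n i x = (hc n (real j - 1) (fst x) * sin (pi * real n * snd x),
        hs n (real j - 1) (fst x) * (pi * real n * cos (pi * real n * snd x)))"
        using 1 by (simp add: gmode_def)
    qed
    also have "\<dots> = (hc n (real j - 1) j * coef N n j g - hc n (real j - 1) (real j - 1) * coef N n (j - 1) g) / 2"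
      by (rule inner_separated_solution[OF u j hs_derivs])
    finally show ?thesis unfolding hcv(1) j1 alg1 using 1 by simp
  next
    case 2
    have ij: "real i = real j - 1" "j - 1 = i" using 2 by simp_all
    have "L2_inner ?S g (gmode n i) = L2_inner ?S g (\<lambda>x. (- hc n (real j) (fst x) * sin (pi * real n * snd x),
        - hs n (real j) (fst x) * (pi * real n * cos (pi * real n * snd x))))"
    proof (rule L2_inner_cong_on[OF refl])
      fix x assume x: "x \<in> ?S"
      have j: "real j = real i + 1" using 2 by simp
      then have "fst x \<in> {real i<..<real i + 1}" using rectD(1)[OF x] by simp
      from tent_right[OF this, of n] sine_inside[OF rectD(2)[OF x], of n]
      show "gmode n i x = (- hc n (real j) (fst x) * sin (pi * real n * snd x),
        - hs n (real j) (fst x) * (pi * real n * cos (pi * real n * snd x)))"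
        unfolding j by (simp add: gmode_def)
    qed
    also have "\<dots> = (- hc n (real j) j * coef N n j g - - hc n (real j) (real j - 1) * coef N n (j - 1) g) / 2"
      using inner_separated_solution[OF u j, of "\<lambda>x. - hs n (real j) x" "\<lambda>x. - hc n (real j) x" n]
        DERIV_minus[OF hs_derivs(1)] DERIV_minus[OF hs_derivs(2)] by simp
    finally show ?thesis unfolding hcv(1) hcv(3)[of "real j"] alg2 ij(2) using 2 by simp
  next
    case 3
    then have "real j \<le> real i - 1 \<or> real i + 1 \<le> real j - 1" by linarith
    then have "L2_inner ?S g (gmode n i) = L2_inner ?S g (\<lambda>x. 0)"
    proof (intro L2_inner_cong_on[OF refl])
      fix x assume x: "x \<in> ?S"
      have "fst x < real i - 1 \<or> real i + 1 < fst x"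
        using rectD(1)[OF x] \<open>real j \<le> real i - 1 \<or> real i + 1 \<le> real j - 1\<close> by auto
      from tent_outside[OF this, of n] show "gmode n i x = 0" by (simp add: gmode_def zero_prod_def)
    qed
    then show ?thesis using 3 by (auto simp: L2_inner_def)
  qed
qed

text \<open>Extended by zero, w has vanishing sine coefficients on all interfaces, and
  \<open>inner_gmode\<close> depends on nothing else.\<close>

lemma gmode_orthogonal_subdomain:
  fixes N :: nat
  assumes w: "has_H10_grad (real j - 1) j w gw" and j: "1 \<le> j" "j \<le> N" and n: "1 \<le> n" "1 \<le> i" "i + 1 \<le> N"
  shows "L2_inner (rect (real j - 1) j) (gmode n i) gw = 0"
proof -
  let ?S = "rect (real j - 1) j"
  let ?g = "\<lambda>x. if x \<in> ?S then gw x else 0"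
  have sub: "?S \<subseteq> rect 0 N" using j by (intro rect_mono) auto
  have ext: "has_H10_grad 0 N (\<lambda>x. if x \<in> ?S then w x else 0) ?g"
    by (rule has_H10_grad_extend[OF w]) (use j in auto)
  have c0: "coef N n k ?g = 0" if k: "k \<le> N" for k
  proof -
    have S: "L2_inner (rect 0 N) h (cut n k) = L2_inner ?S h (cut n k)" if "\<And>x. x \<notin> ?S \<Longrightarrow> h x = 0" for h
      using that by (intro L2_inner_superset sub) auto
    have "L2_inner ?S gw (cut n k) = 0"
    proof (rule H10_orthogonal_if_test_orthogonal[OF w L2_subset[OF sub _ _ cut_L2[OF k]]])
      fix \<phi> assume \<phi>: "\<phi> \<in> test_functions ?S"
      \<comment> \<open>No line x1 = k meets the open subdomain, so its test functions vanish on all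
        these lines.\<close>
      have "real k \<le> real j - 1 \<or> real j \<le> real k"
        using j(1) by (cases "k < j") (auto simp: of_nat_diff[symmetric] simp del: of_nat_diff)
      then have "\<phi> (real k, t) = 0" for t by (intro test_zero_outside(1)[OF \<phi>]) (auto simp: rect_def)
      then show "L2_inner ?S (grad \<phi>) (cut n k) = 0"
        using S[OF test_zero_outside(2)[OF \<phi>]] test_moment[OF test_mono[OF sub \<phi>], of k n] k
        by (simp add: moment_def)
    qed auto
    moreover have "L2_inner ?S ?g (cut n k) = L2_inner ?S gw (cut n k)" by (rule L2_inner_cong_on) auto
    ultimately show ?thesis unfolding coef_def using S[of ?g] by simp
  qed
  have "L2_inner ?S ?g (gmode n i) = 0"
  proof -
    have "i \<le> N" "i - 1 \<le> N" using n by auto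
    note c = c0[OF this(1)] c0[OF this(2)] c0[OF n(3)]
    show ?thesis unfolding inner_gmode[OF ext j n] c by (simp only: mult_zero_right diff_self if_cancel)
  qed
  moreover have "L2_inner ?S ?g (gmode n i) = L2_inner ?S gw (gmode n i)" by (rule L2_inner_cong_on) auto
  ultimately show ?thesis by (simp add: L2_inner_commute)
qed

text \<open>\<open>V_Gamma\<close> for a function paired with an explicit gradient, the
  orthogonality being tested inside each subdomain; \<open>V_GammaD\<close> and
  \<open>V_GammaI\<close> translate.\<close>

definition harm :: "nat \<Rightarrow> (real \<times> real \<Rightarrow> real) \<Rightarrow> (real \<times> real \<Rightarrow> real \<times> real) \<Rightarrow> bool"
  where "harm N u g \<longleftrightarrow> has_H10_grad 0 N u g \<and>
    (\<forall>j\<in>{1..N}. \<forall>w gw. has_H10_grad (real j - 1) j w gw \<longrightarrow> L2_inner (rect (real j - 1) j) g gw = 0)"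

lemma Omega_rect: "Omega N = rect 0 N" "Omega_sub j = rect (real j - 1) j"
  by (simp_all add: Omega_eq rect_def Omega_sub_def)

lemma subdomain_subset: "1 \<le> j \<Longrightarrow> j \<le> N \<Longrightarrow> rect (real j - 1) (real j) \<subseteq> rect 0 (real N)"
  by (intro rect_mono) auto

text \<open>The weak gradient of the zero extension is almost everywhere the zero extension of the
  gradient, which localises the pairing to the subdomain.\<close>

lemma inner_extension:
  assumes w: "has_H10_grad (real j - 1) j w gw" and j: "1 \<le> j" "j \<le> N" and g: "g \<in> L2_space (rect 0 N)"
  shows "L2_inner (rect 0 N) g (weak_gradient (rect 0 N) (\<lambda>x. if x \<in> rect (real j - 1) j then w x else 0))
    = L2_inner (rect (real j - 1) j) g gw"
proof -
  let ?S = "rect (real j - 1) j"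
  let ?w = "\<lambda>x. if x \<in> ?S then w x else 0" and ?g = "\<lambda>x. if x \<in> ?S then gw x else 0"
  note sub = subdomain_subset[OF j]
  have ext: "has_H10_grad 0 N ?w ?g"
    by (rule has_H10_grad_extend[OF w]) (use j in auto)
  note wg = weak_gradient_AE_eq[OF H10_spaceI(2)[OF ext of_nat_0_le_iff]]
  have "L2_inner (rect 0 N) g (weak_gradient (rect 0 N) ?w) = L2_inner (rect 0 N) g ?g"
    using wg(1) by (intro L2_inner_cong_AE L2_measurable g wg(2) has_H10_gradD(2)[OF ext]) auto
  also have "\<dots> = L2_inner ?S g ?g" using sub by (intro L2_inner_superset) auto
  also have "\<dots> = L2_inner ?S g gw" by (rule L2_inner_cong_on) auto
  finally show ?thesis .
qed

lemma V_GammaD: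
  assumes "v \<in> V_Gamma N"
  shows "harm N v (weak_gradient (rect 0 N) v)"
proof -
  have v: "has_H10_grad 0 N v (weak_gradient (rect 0 N) v)"
    using assms unfolding V_Gamma_def Omega_rect by (intro H10_spaceD) auto
  have "L2_inner (rect (real j - 1) j) (weak_gradient (rect 0 N) v) gw = 0"
    if j: "j \<in> {1..N}" and w: "has_H10_grad (real j - 1) j w gw" for j w gw
  proof -
    have "w \<in> H10_space (rect (real j - 1) j)" by (rule H10_spaceI(1)[OF w]) simp
    then have "(\<lambda>x. if x \<in> rect (real j - 1) j then w x else 0) \<in> V_sub j"
      unfolding V_sub_def Omega_rect by blast
    then have "L2_inner (rect 0 N) (weak_gradient (rect 0 N) v)
        (weak_gradient (rect 0 N) (\<lambda>x. if x \<in> rect (real j - 1) j then w x else 0)) = 0"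
      using assms j unfolding V_Gamma_def Omega_rect by blast
    then show ?thesis using inner_extension[OF w _ _ has_H10_gradD(2)[OF v]] j by simp
  qed
  then show ?thesis unfolding harm_def using v by blast
qed

lemma V_GammaI:
  assumes "harm N v g"
  shows "v \<in> V_Gamma N"
proof -
  have v: "has_H10_grad 0 N v g" using assms by (simp add: harm_def)
  note wg = H10_spaceI[OF v of_nat_0_le_iff]
  note ae = weak_gradient_AE_eq[OF wg(2)]
  have "L2_inner (rect 0 N) (weak_gradient (rect 0 N) v) (weak_gradient (rect 0 N) z) = 0"
    if j: "j \<in> {1..N}" and z: "z \<in> V_sub j" for j z
  proof -
    let ?S = "rect (real j - 1) j"
    obtain w where w: "w \<in> H10_space ?S" "z = (\<lambda>x. if x \<in> ?S then w x else 0)"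
      using z unfolding V_sub_def Omega_rect by blast
    have w': "has_H10_grad (real j - 1) j w (weak_gradient ?S w)" by (rule H10_spaceD[OF w(1)]) simp
    have sub: "?S \<subseteq> rect 0 N" using j by (intro subdomain_subset) auto
    have "L2_inner (rect 0 N) (weak_gradient (rect 0 N) v) (weak_gradient (rect 0 N) z)
        = L2_inner ?S (weak_gradient (rect 0 N) v) (weak_gradient ?S w)"
      unfolding w(2) using j by (intro inner_extension[OF w' _ _ ae(2)]) auto
    also have "\<dots> = L2_inner ?S g (weak_gradient ?S w)"
      using AE_lebesgue_on_subset[OF sub _ _ ae(1)] has_H10_gradD(2)[OF w']
        L2_subset[OF sub _ _ ae(2)] L2_subset[OF sub _ _ has_H10_gradD(2)[OF v]]
      by (intro L2_inner_cong_AE L2_measurable) auto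
    also have "\<dots> = 0" using assms j w' unfolding harm_def by blast
    finally show ?thesis .
  qed
  then show ?thesis unfolding V_Gamma_def Omega_rect using wg(1) by blast
qed

lemma harm_L2:
  assumes "harm N u g"
  shows "g \<in> L2_space (rect 0 N)" "1 \<le> j \<Longrightarrow> j \<le> N \<Longrightarrow> g \<in> L2_space (rect (real j - 1) j)"
  using has_H10_gradD(2)[of 0 N u g] assms L2_subset[OF subdomain_subset _ _ has_H10_gradD(2)[of 0 N u g]]
  by (auto simp: harm_def)

lemma harm_add:
  assumes "harm N u g" "harm N v h"
  shows "harm N (\<lambda>x. u x + v x) (\<lambda>x. g x + h x)"
  using assms harm_L2(2)[OF assms(1)] harm_L2(2)[OF assms(2)]
  unfolding harm_def by (auto simp: has_H10_grad_add L2_inner_add_left has_H10_gradD(2))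

lemma harm_scaleR:
  assumes "harm N u g"
  shows "harm N (\<lambda>x. c * u x) (\<lambda>x. c *\<^sub>R g x)"
  using assms unfolding harm_def by (simp add: has_H10_grad_scaleR L2_inner_scaleR_left)

lemma harm_zero: "harm N (\<lambda>x. 0) (\<lambda>x. 0)"
  unfolding harm_def by (simp add: has_H10_grad_zero L2_inner_def)

lemma harm_sum: "(\<And>i. i \<in> I \<Longrightarrow> harm N (u i) (g i)) \<Longrightarrow> harm N (\<lambda>x. \<Sum>i\<in>I. u i x) (\<lambda>x. \<Sum>i\<in>I. g i x)"
  by (induction I rule: infinite_finite_induct) (simp_all add: harm_zero harm_add)

lemma harm_diff: "harm N u g \<Longrightarrow> harm N v h \<Longrightarrow> harm N (\<lambda>x. u x - v x) (\<lambda>x. g x - h x)"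
  using harm_add[OF _ harm_scaleR[of N v h "-1"], of u g] by simp

lemma harm_mode: "1 \<le> n \<Longrightarrow> 1 \<le> i \<Longrightarrow> i + 1 \<le> N \<Longrightarrow> harm N (mode n i) (gmode n i)"
  unfolding harm_def using mode_H10 gmode_orthogonal_subdomain by auto

text \<open>On each subdomain \<open>\<psi>(x\<^sub>1) sin(\<pi> n x\<^sub>2)\<close> splits into the discrete harmonic extension of its
  traces and an element of \<open>H\<^sup>1\<^sub>0\<close> of the subdomain.\<close>

lemma harm_orthogonal_separated:
  assumes v: "harm N v g" and j: "1 \<le> j" "j \<le> N" and n: "1 \<le> n"
    and c: "coef N n (j - 1) g = 0" "coef N n j g = 0" and \<psi>: "smooth \<psi>"
  shows "L2_inner (rect (real j - 1) j) g (\<lambda>x. (deriv \<psi> (fst x) * sin (pi * real n * snd x),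
      \<psi> (fst x) * (pi * real n * cos (pi * real n * snd x)))) = 0"
proof -
  let ?S = "rect (real j - 1) j"
  let ?G = "\<lambda>f f' x. (f' (fst x) * sin (pi * real n * snd x), f (fst x) * (pi * real n * cos (pi * real n * snd x)))"
  \<comment> \<open>s solves the differential equation with the end values of \<psi>; the second
    term is subtracted because \<open>hs n j\<close> is -1 at j - 1. Then \<psi> - s vanishes at
    both ends.\<close>
  define s where "s x = \<psi> j * hs n (real j - 1) x - \<psi> (real j - 1) * hs n j x" for x
  define s1 where "s1 x = \<psi> j * hc n (real j - 1) x - \<psi> (real j - 1) * hc n j x" for x
  have ds: "(s has_real_derivative s1 x) (at x)" "(s1 has_real_derivative (pi * real n)\<^sup>2 * s x) (at x)" for x
    unfolding s_def s1_def
    by (rule DERIV_diff DERIV_cmult hs_derivs)+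
      (rule DERIV_cong[OF DERIV_diff[OF DERIV_cmult[OF hs_derivs(2)] DERIV_cmult[OF hs_derivs(2)]]], simp add: algebra_simps)
  have sms: "smooth s" unfolding s_def by (intro smooth_diff smooth_mult smooth_const smooth_hs)
  have vals: "s (real j - 1) = \<psi> (real j - 1)" "s j = \<psi> j"
    using hs_values[OF n, of "real j - 1"] hs_values[OF n, of "real j"] by (simp_all add: s_def)
  define F where "F x = \<psi> x - s x" for x
  have smF: "smooth F" unfolding F_def by (intro smooth_diff \<psi> sms)
  have dF: "deriv F x = deriv \<psi> x - s1 x" for x
    unfolding F_def by (rule DERIV_imp_deriv[OF DERIV_diff[OF smooth_deriv(1)[OF \<psi>] ds(1)]])
  have "adm (real j - 1) j (\<lambda>x. if x \<in> {real j - 1..j} then F x else 0) (\<lambda>x. if x \<in> {real j - 1<..<j} then deriv F x else 0)"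
    by (rule adm_smooth[OF _ smF]) (simp_all add: F_def vals)
  from has_H10_grad_cong[OF adm_tensor(2)[OF this adm_sine[of n]], of "\<lambda>x. F (fst x) * sin (pi * real n * snd x)" "?G F (deriv F)"]
  have "has_H10_grad (real j - 1) j (\<lambda>x. F (fst x) * sin (pi * real n * snd x)) (?G F (deriv F))"
    by (auto simp: rect_def sine_def sine'_def)
  then have F0: "L2_inner ?S g (?G F (deriv F)) = 0" using v j unfolding harm_def by auto
  have s0: "L2_inner ?S g (?G s s1) = 0"
    using inner_separated_solution[OF _ j ds, of v g] v c by (simp add: harm_def)
  have cont: "continuous_on UNIV (\<lambda>x::real\<times>real. f (fst x))" if "continuous_on UNIV f" for f :: "real \<Rightarrow> real"
    by (rule continuous_on_compose2[OF that]) (auto intro!: continuous_intros)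
  have "continuous_on UNIV s1" using ds(2) by (auto intro!: continuous_at_imp_continuous_on DERIV_isCont)
  note cs = cont[OF this] cont[OF smooth_continuous[OF sms]] cont[OF smooth_continuous[OF smF]]
    cont[OF smooth_continuous[OF smooth_deriv(2)[OF smF]]]
  have L: "?G F (deriv F) \<in> L2_space ?S" "?G s s1 \<in> L2_space ?S"
    by (intro L2_continuous continuous_intros cs)+
  have "L2_inner ?S (\<lambda>x. ?G F (deriv F) x + ?G s s1 x) g = 0"
    using F0 s0 by (simp only: L2_inner_add_left[OF L harm_L2(2)[OF v j]] L2_inner_commute[of ?S _ g] add_0)
  also have "(\<lambda>x. ?G F (deriv F) x + ?G s s1 x) = ?G \<psi> (deriv \<psi>)"
    unfolding dF by (auto simp: fun_eq_iff F_def algebra_simps)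
  finally show ?thesis by (simp add: L2_inner_commute)
qed

section \<open>Density of separated functions\<close>

text \<open>Cosines rather than sines: they include the constants, their products are again sums of
  cosines, and cos (\<pi> t) separates the points of [0,1]. This gives the algebra that
  Stone-Weierstrass asks for; sines appear only after integration.\<close>

inductive_set cos_polys :: "(real \<times> real \<Rightarrow> real) set" where
  basic: "(\<lambda>x. poly p (fst x) * cos (pi * real n * snd x)) \<in> cos_polys"
| add: "f \<in> cos_polys \<Longrightarrow> g \<in> cos_polys \<Longrightarrow> (\<lambda>x. f x + g x) \<in> cos_polys"

lemma cos_polys_mult:
  assumes "f \<in> cos_polys" "g \<in> cos_polys"
  shows "(\<lambda>x. f x * g x) \<in> cos_polys"
  using assms(1)
proof induction
  case (basic p n)
  show ?case using assms(2)
  proof induction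
    case (basic q m)
    \<comment> \<open>The distance of n and m as a natural number, since the difference frequency in
      the product-to-sum formula has to be an index again; cosine ignores its sign.\<close>
    define d where "d = (if m \<le> n then n - m else m - n)"
    have d: "cos (pi * real d * t) = cos (pi * real n * t - pi * real m * t)" for t
    proof (cases "m \<le> n")
      case True
      then show ?thesis by (simp add: d_def of_nat_diff algebra_simps)
    next
      case False
      then have "pi * real d * t = - (pi * real n * t - pi * real m * t)"
        by (simp add: d_def of_nat_diff algebra_simps)
      then show ?thesis by (simp only: cos_minus)
    qed
    have s: "cos (pi * real (n + m) * t) = cos (pi * real n * t + pi * real m * t)" for t
      by (simp add: algebra_simps)
    have "(\<lambda>x::real\<times>real. poly (smult (1/2) (p * q)) (fst x) * cos (pi * real d * snd x) +
        poly (smult (1/2) (p * q)) (fst x) * cos (pi * real (n + m) * snd x)) \<in> cos_polys"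
      by (intro cos_polys.intros)
    also have "(\<lambda>x::real\<times>real. poly (smult (1/2) (p * q)) (fst x) * cos (pi * real d * snd x) +
        poly (smult (1/2) (p * q)) (fst x) * cos (pi * real (n + m) * snd x)) =
        (\<lambda>x. poly p (fst x) * cos (pi * real n * snd x) * (poly q (fst x) * cos (pi * real m * snd x)))"
      unfolding d s cos_add cos_diff by (auto simp: fun_eq_iff algebra_simps)
    finally show ?case .
  next
    case (add f g)
    then show ?case using cos_polys.add[OF add.IH] by (simp add: algebra_simps)
  qed
next
  case (add f1 f2)
  then show ?case using cos_polys.add[OF add.IH] by (simp add: algebra_simps)
qed

lemma cos_polys_sum:
  assumes "f \<in> cos_polys"
  shows "\<exists>K p. f = (\<lambda>x. \<Sum>n\<le>K. poly (p n) (fst x) * cos (pi * real n * snd x))"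
proof -
  \<comment> \<open>The vanishing of \<open>p n\<close> beyond K is carried along so that sums of
    different length can be padded to a common one.\<close>
  have "\<exists>K p. (\<forall>n>K. p n = 0) \<and> f = (\<lambda>x. \<Sum>n\<le>K. poly (p n) (fst x) * cos (pi * real n * snd x))"
    using assms
  proof induction
    case (basic q m)
    have "(\<Sum>n\<le>m. poly (if n = m then q else 0) s * cos (pi * real n * t)) = poly q s * cos (pi * real m * t)" for s t
    proof -
      have "(\<Sum>n\<le>m. poly (if n = m then q else 0) s * cos (pi * real n * t))
          = (\<Sum>n\<le>m. if n = m then poly q s * cos (pi * real m * t) else 0)"
        by (rule sum.cong) auto
      then show ?thesis by simp
    qed
    then show ?case by (intro exI[of _ m] exI[of _ "\<lambda>n. if n = m then q else 0"]) auto
  next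
    case (add f g)
    then obtain K p L q where
      p: "\<forall>n>K. p n = 0" "f = (\<lambda>x. \<Sum>n\<le>K. poly (p n) (fst x) * cos (pi * real n * snd x))" and
      q: "\<forall>n>L. q n = 0" "g = (\<lambda>x. \<Sum>n\<le>L. poly (q n) (fst x) * cos (pi * real n * snd x))" by blast
    let ?M = "max K L"
    have ext: "(\<Sum>n\<le>k. poly (r n) s * cos (pi * real n * t)) = (\<Sum>n\<le>?M. poly (r n) s * cos (pi * real n * t))"
      if "\<forall>n>k. r n = 0" "k \<le> ?M" for r :: "nat \<Rightarrow> real poly" and k s t
      using that by (intro sum.mono_neutral_left) (auto simp: not_le)
    have "(\<lambda>x. f x + g x) = (\<lambda>x. \<Sum>n\<le>?M. poly (p n + q n) (fst x) * cos (pi * real n * snd x))"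
      unfolding p(2) q(2) ext[OF p(1) max.cobounded1] ext[OF q(1) max.cobounded2]
      by (simp add: sum.distrib distrib_right)
    then show ?case using p(1) q(1) by (intro exI[of _ ?M] exI[of _ "\<lambda>n. p n + q n"]) auto
  qed
  then show ?thesis by blast
qed

lemma cos_approximation:
  fixes h :: "real \<times> real \<Rightarrow> real"
  assumes h: "continuous_on UNIV h" and e: "0 < e"
  shows "\<exists>K p. \<forall>s\<in>{0..b}. \<forall>t\<in>{0..1}. \<bar>h (s, t) - (\<Sum>n\<le>K. poly (p n) s * cos (pi * real n * t))\<bar> < e"
proof -
  let ?S = "cbox (0, 0) (b, 1) :: (real \<times> real) set"
  have "function_ring_on cos_polys ?S"
  proof
    show "compact ?S" by (rule compact_cbox)
    show "continuous_on ?S f" if "f \<in> cos_polys" for f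
      using that by induction (auto intro!: continuous_intros)
    show "(\<lambda>x. f x + g x) \<in> cos_polys" "(\<lambda>x. f x * g x) \<in> cos_polys" if "f \<in> cos_polys" "g \<in> cos_polys" for f g
      using that by (rule cos_polys.add, rule cos_polys_mult)
    show "(\<lambda>_. c) \<in> cos_polys" for c using cos_polys.basic[of "[:c:]" 0] by simp
    show "\<exists>f\<in>cos_polys. f x \<noteq> f y" if xy: "x \<in> ?S" "y \<in> ?S" "x \<noteq> y" for x y
    proof (cases "fst x = fst y")
      case False
      then show ?thesis using cos_polys.basic[of "[:0, 1:]" 0] by (intro bexI) auto
    next
      case True
      then have "snd x \<noteq> snd y" using xy(3) by (simp add: prod_eq_iff)
      moreover have "0 \<le> snd x" "snd x \<le> 1" "0 \<le> snd y" "snd y \<le> 1"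
        using xy(1,2) by (auto simp: cbox_Pair_eq mem_Times_iff)
      ultimately have "cos (pi * snd x) \<noteq> cos (pi * snd y)"
        using cos_inj_pi[of "pi * snd x" "pi * snd y"] by (auto simp: mult_left_le)
      then show ?thesis using cos_polys.basic[of "[:1:]" 1] by (intro bexI) auto
    qed
  qed
  then obtain f where f: "f \<in> cos_polys" "\<And>x. x \<in> ?S \<Longrightarrow> \<bar>h x - f x\<bar> < e"
    using function_ring_on.Stone_Weierstrass_basic[of cos_polys ?S h e] continuous_on_subset[OF h] e by blast
  obtain K p where "f = (\<lambda>x. \<Sum>n\<le>K. poly (p n) (fst x) * cos (pi * real n * snd x))"
    using cos_polys_sum[OF f(1)] by blast
  then show ?thesis using f(2)[of "(_, _)"] by (intro exI[of _ K] exI[of _ p]) auto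
qed

lemma poly_antiderivative:
  "\<exists>P. \<forall>x::real. (poly P has_real_derivative poly p x) (at x)"
proof (induction p)
  case 0
  show ?case by (intro exI[of _ 0]) auto
next
  case (pCons a p)
  show ?case
  proof -
    define P where "P = (\<Sum>i\<le>degree (pCons a p). monom (coeff (pCons a p) i / real (Suc i)) (Suc i))"
    have "pderiv P = (\<Sum>i\<le>degree (pCons a p). monom (coeff (pCons a p) i) i)"
      unfolding P_def by (simp add: higher_pderiv_sum[of 1, simplified] pderiv_monom del: of_nat_Suc coeff_pCons_Suc degree_pCons_eq_if)
    also have "\<dots> = pCons a p" by (rule poly_as_sum_of_monoms)
    finally show ?thesis using poly_DERIV[of P] by metis
  qed
qed

text \<open>Uniform approximation of \<phi> alone would not control its gradient, so the mixed
  second derivative h is approximated by polynomials times cosines. Integration in x1 turns this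
  into a cosine sum for the second partial derivative, integration in x2 into a sine sum for the
  first, with the same polynomial data. The boundary values of \<phi> make the constant mode small,
  and a linear correction makes the coefficients vanish at N.\<close>

lemma test_approximation:
  assumes \<phi>: "\<phi> \<in> test_functions (rect 0 N)" and N: "0 < N" and e: "0 < e"
  shows "\<exists>K \<psi>. (\<forall>n. smooth (\<psi> n) \<and> \<psi> n 0 = 0 \<and> \<psi> n N = 0) \<and>
    (\<forall>x\<in>rect 0 N.
      \<bar>fst (grad \<phi> x) - (\<Sum>n=1..K. deriv (\<psi> n) (fst x) * sin (pi * real n * snd x))\<bar> \<le> e \<and>
      \<bar>snd (grad \<phi> x) - (\<Sum>n=1..K. \<psi> n (fst x) * (pi * real n * cos (pi * real n * snd x)))\<bar> \<le> e)"
proof -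
  note sm = smooth_grad[OF test_smooth[OF \<phi>]]
  define h where "h x = fst (grad (\<lambda>x. snd (grad \<phi> x)) x)" for x
  have conth: "continuous_on UNIV h"
    unfolding h_def by (intro smooth_continuous smooth_grad(2)[OF sm(3)])
  \<comment> \<open>Dropping the term n = 0 doubles the error to 2d. Integration and the linear
    correction then give 2dN + 2dN for the second component and 2d + 2d for the first, both at most
    e.\<close>
  define d where "d = e / (4 * (N + 1))"
  have d: "0 < d" "4 * N * d \<le> e" "4 * d \<le> e" using N e by (auto simp: d_def field_simps)
  obtain K p where p: "\<And>s t. s \<in> {0..N} \<Longrightarrow> t \<in> {0..1} \<Longrightarrow> \<bar>h (s, t) - (\<Sum>n\<le>K. poly (p n) s * cos (pi * real n * t))\<bar> < d"
    using cos_approximation[OF conth d(1), of N] by blast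
  have "\<forall>n. \<exists>P. (\<forall>x. (poly P has_real_derivative poly (p n) x) (at x)) \<and> poly P 0 = 0"
  proof
    fix n
    obtain P where P: "\<forall>x. (poly P has_real_derivative poly (p n) x) (at x)" using poly_antiderivative by blast
    have "((\<lambda>x. poly P x - poly P 0) has_real_derivative poly (p n) x) (at x)" for x
      using DERIV_diff[OF P[rule_format] DERIV_const] by simp
    then show "\<exists>P. (\<forall>x. (poly P has_real_derivative poly (p n) x) (at x)) \<and> poly P 0 = 0"
      by (intro exI[of _ "P - [:poly P 0:]"]) (simp add: poly_diff[abs_def] fun_diff_def)
  qed
  then obtain P where P: "\<And>n x. (poly (P n) has_real_derivative poly (p n) x) (at x)" "\<And>n. poly (P n) 0 = 0" by metis
  have z: "\<phi> (s, t) = 0" "grad \<phi> (s, t) = 0" if "s \<le> 0 \<or> N \<le> s \<or> t \<le> 0 \<or> 1 \<le> t" for s t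
  proof -
    have "(s, t) \<notin> rect 0 N" using that by (auto simp: rect_def)
    from test_zero_outside[OF \<phi> this] show "\<phi> (s, t) = 0" "grad \<phi> (s, t) = 0" .
  qed
  have line1: "continuous_on A (\<lambda>s. f (s, t))" and line2: "continuous_on B (\<lambda>t. f (s, t))"
    if "continuous_on UNIV f" for f :: "real \<times> real \<Rightarrow> real" and s t A B
    by (rule continuous_on_compose2[OF that], auto intro!: continuous_intros,
        rule continuous_on_compose2[OF that], auto intro!: continuous_intros)
  have dline1: "((\<lambda>s. f (s, t)) has_real_derivative fst (grad f (s, t))) (at s)"
    and dline2: "((\<lambda>t. f (s, t)) has_real_derivative snd (grad f (s, t))) (at t)"
    if "smooth f" for f :: "real \<times> real \<Rightarrow> real" and s t
  proof -
    have 1: "((\<lambda>s. (s, t)) has_derivative (\<lambda>h. (h, 0))) (at s)" and 2: "((\<lambda>t. (s, t)) has_derivative (\<lambda>h. (0, h))) (at t)"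
      by (auto intro!: derivative_eq_intros)
    show "((\<lambda>s. f (s, t)) has_real_derivative fst (grad f (s, t))) (at s)"
      using has_derivative_compose[OF 1 smooth_grad(1)[OF that]] by (simp add: has_field_derivative_def inner_prod_def)
    show "((\<lambda>t. f (s, t)) has_real_derivative snd (grad f (s, t))) (at t)"
      using has_derivative_compose[OF 2 smooth_grad(1)[OF that]] by (simp add: has_field_derivative_def inner_prod_def)
  qed
  have ftc: "(g has_integral G v - G u) {u..v}" if "u \<le> v" "\<And>x. (G has_real_derivative g x) (at x)" for g G :: "real \<Rightarrow> real" and u v
    using that by (intro fundamental_theorem_of_calculus)
      (auto simp: has_real_derivative_iff_has_vector_derivative intro: has_vector_derivative_at_within)
  have bound: "\<bar>integral {u..v} g\<bar> \<le> C * (v - u)" if "u \<le> v" "continuous_on {u..v} g" "\<And>x. x \<in> {u..v} \<Longrightarrow> \<bar>g x\<bar> \<le> C"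
    for g :: "real \<Rightarrow> real" and u v C
    using integral_bound[of u v g C] that by simp
  have igr: "g integrable_on {u..v}" if "continuous_on {u..v} g" for g :: "real \<Rightarrow> real" and u v
    using that by (rule integrable_continuous_real)

  \<comment> \<open>Both partial derivatives of \<open>\<phi>\<close> are recovered from \<open>h = \<partial>\<^sub>1\<partial>\<^sub>2\<phi>\<close>.\<close>
  have i1: "integral {0..s} (\<lambda>s. h (s, t)) = snd (grad \<phi> (s, t))" if "0 \<le> s" for s t
    using integral_unique[OF ftc[OF that dline1[OF sm(3)]]] z(2)[of 0 t] by (simp add: h_def)
  have i2: "integral {0..t} (\<lambda>t. h (s, t)) = fst (grad \<phi> (s, t))" if s: "0 \<le> s" and t: "0 \<le> t" for s t
  proof -
    \<comment> \<open>\<phi> is the double integral of h. Written with the outer integral in s, it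
      can be differentiated in s, and uniqueness of derivatives identifies the inner
      integral.\<close>
    have "\<phi> (s, t) = integral {0..s} (\<lambda>s. integral {0..t} (\<lambda>t. h (s, t)))" if s: "0 \<le> s" for s
    proof -
      have "\<phi> (s, t) = integral {0..t} (\<lambda>t. snd (grad \<phi> (s, t)))"
        using integral_unique[OF ftc[OF t dline2[OF test_smooth[OF \<phi>]]]] z(1)[of s 0] by simp
      also have "\<dots> = integral {0..t} (\<lambda>t. integral {0..s} (\<lambda>s. h (s, t)))" by (simp only: i1[OF s])
      also have "\<dots> = integral {0..s} (\<lambda>s. integral {0..t} (\<lambda>t. h (s, t)))"
        using integral_swap_continuous[of 0 0 t s "\<lambda>t s. h (s, t)"] continuous_on_subset[OF continuous_on_compose2[OF conth, of UNIV "\<lambda>x. (snd x, fst x)"]]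
        by (simp add: case_prod_unfold continuous_intros)
      finally show ?thesis .
    qed
    note int = this
    \<comment> \<open>The interval extends to s + 1 so that s is a limit point of it even for s =
      0.\<close>
    have ch: "continuous_on {0..s+1} (\<lambda>s. integral {0..t} (\<lambda>t. h (s, t)))"
      using integral_continuous_on_param[of "{0..s+1}" 0 t "\<lambda>s t. h (s, t)"] continuous_on_subset[OF conth]
      by (simp add: case_prod_unfold)
    have "((\<lambda>s. integral {0..s} (\<lambda>s. integral {0..t} (\<lambda>t. h (s, t)))) has_real_derivative integral {0..t} (\<lambda>t. h (s, t))) (at s within {0..s+1})"
      by (rule integral_has_real_derivative[OF ch]) (use s in simp)
    then have "((\<lambda>s. \<phi> (s, t)) has_real_derivative integral {0..t} (\<lambda>t. h (s, t))) (at s within {0..s+1})"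
      by (rule has_field_derivative_transform_within[of _ _ _ _ 1]) (use int s in auto)
    moreover have "((\<lambda>s. \<phi> (s, t)) has_real_derivative fst (grad \<phi> (s, t))) (at s within {0..s+1})"
      using dline1[OF test_smooth[OF \<phi>]] by (rule has_field_derivative_at_within)
    moreover have "at s within {0..s+1} \<noteq> bot" using s by (simp add: trivial_limit_within islimpt_Icc)
    ultimately show ?thesis
      unfolding has_real_derivative_iff_has_vector_derivative by (metis vector_derivative_unique_within)
  qed

  let ?Q = "\<lambda>s t. \<Sum>n\<le>K. poly (p n) s * cos (pi * real n * t)" and ?Q1 = "\<lambda>s t. \<Sum>n=1..K. poly (p n) s * cos (pi * real n * t)"
  have split: "(\<Sum>n\<le>K. f n) = f 0 + (\<Sum>n=1..K. f n)" for f :: "nat \<Rightarrow> real"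
    using sum.atLeast_Suc_atMost[of 0 K f] by (simp add: atLeast0AtMost)
  have Qint: "((\<lambda>t. ?Q1 s t) has_integral (\<Sum>n=1..K. poly (p n) s * (sin (pi * real n * t) / (pi * real n)))) {0..t}" if "0 \<le> t" for s t
  proof -
    have "((\<lambda>t. \<Sum>n=1..K. poly (p n) s * (sin (pi * real n * t) / (pi * real n))) has_real_derivative ?Q1 s t) (at t)" for t
      by (auto intro!: derivative_eq_intros sum.cong)
    from ftc[OF that this] show ?thesis by simp
  qed
  have contQ: "continuous_on A (\<lambda>t. ?Q s t)" "continuous_on A (\<lambda>t. ?Q1 s t)" "continuous_on A (\<lambda>s. ?Q1 s t)" for A s t
    by (intro continuous_intros)+
  \<comment> \<open>Over [0,1] the cosines with n \<ge> 1 integrate to zero, and so does h, because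
    the first partial derivative of \<phi> vanishes on the edges t = 0 and t = 1. Only the constant
    term is left.\<close>
  have p0: "\<bar>poly (p 0) s\<bar> \<le> d" if s: "s \<in> {0..N}" for s
  proof -
    have "integral {0..1} (\<lambda>t. h (s, t) - ?Q s t) = integral {0..1} (\<lambda>t. h (s, t)) - integral {0..1} (\<lambda>t. ?Q s t)"
      by (rule integral_diff) (intro igr line2 conth contQ)+
    moreover have "integral {0..1} (\<lambda>t. h (s, t)) = 0" using i2[of s 1] s z(2)[of s 1] by simp
    moreover have "integral {0..1} (\<lambda>t. ?Q s t) = integral {0..1} (\<lambda>t::real. poly (p 0) s) + integral {0..1} (\<lambda>t. ?Q1 s t)"
      unfolding split
      using integral_add[of "\<lambda>t. poly (p 0) s" "{0..1}" "\<lambda>t. ?Q1 s t", OF igr[OF continuous_on_const] igr[OF contQ(2)]]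
      by simp
    moreover have "integral {0..1} (\<lambda>t. ?Q1 s t) = 0" using integral_unique[OF Qint[of 1 s]] by simp
    moreover have "\<bar>integral {0..1} (\<lambda>t. h (s, t) - ?Q s t)\<bar> \<le> d * (1 - 0)"
      using p[OF s] by (intro bound continuous_on_diff line2 conth contQ) (auto intro: less_imp_le)
    ultimately show ?thesis by simp
  qed
  have q: "\<bar>h (s, t) - ?Q1 s t\<bar> \<le> 2 * d" if "s \<in> {0..N}" "t \<in> {0..1}" for s t
    using p[OF that] p0[OF that(1)] unfolding split by simp
  define R where "R s t = (\<Sum>n=1..K. poly (P n) s * cos (pi * real n * t))" for s t
  have Rint: "((\<lambda>s. ?Q1 s t) has_integral R s t) {0..s}" if "0 \<le> s" for s t
  proof -
    have "((\<lambda>s. R s t) has_real_derivative ?Q1 s t) (at s)" for s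
      unfolding R_def by (intro DERIV_sum DERIV_cmult_right P(1))
    from ftc[OF that this] show ?thesis by (simp add: R_def P(2))
  qed
  have r: "\<bar>snd (grad \<phi> (s, t)) - R s t\<bar> \<le> 2 * d * N" if s: "s \<in> {0..N}" and t: "t \<in> {0..1}" for s t
  proof -
    have "snd (grad \<phi> (s, t)) - R s t = integral {0..s} (\<lambda>s. h (s, t) - ?Q1 s t)"
    proof -
      have "integral {0..s} (\<lambda>s. h (s, t) - ?Q1 s t) = integral {0..s} (\<lambda>s. h (s, t)) - integral {0..s} (\<lambda>s. ?Q1 s t)"
        by (rule integral_diff) (intro igr line1 conth contQ)+
      then show ?thesis using i1[of s t] integral_unique[OF Rint[of s t]] s by simp
    qed
    also have "\<bar>\<dots>\<bar> \<le> 2 * d * (s - 0)"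
      using s t q by (intro bound continuous_on_diff line1 conth contQ) auto
    also have "\<dots> \<le> 2 * d * N" using s d by (intro mult_left_mono) auto
    finally show ?thesis .
  qed
  have rN: "\<bar>R N t\<bar> \<le> 2 * d * N" if "t \<in> {0..1}" for t
    using r[of N t] that N z(2)[of N t] by simp
  \<comment> \<open>The factor 1/(\<pi> n) undoes the derivative of the sine. The linear term
    cancels the value at N; what it changes in the sums is controlled by \<open>rN\<close>.\<close>
  define \<psi> where "\<psi> n s = (poly (P n) s - s * (poly (P n) N / N)) * inverse (pi * real n)" for n s
  have d\<psi>: "(\<psi> n has_real_derivative (poly (p n) s - poly (P n) N / N) * inverse (pi * real n)) (at s)" for n s
    unfolding \<psi>_def
    by (rule DERIV_cmult_right, rule DERIV_cong[OF DERIV_diff[OF P(1) DERIV_cmult_right[OF DERIV_ident]]]) simp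
  have s\<psi>: "smooth (\<psi> n)" "\<psi> n 0 = 0" "\<psi> n N = 0" for n
  proof -
    have "smooth (\<lambda>s. (poly (P n) s - s * (poly (P n) N / N)) * inverse (pi * real n))"
      by (intro smooth_mult smooth_diff smooth_poly smooth_const smooth_id)
    then show "smooth (\<psi> n)" by (simp add: \<psi>_def[abs_def])
    show "\<psi> n 0 = 0" "\<psi> n N = 0" using N by (auto simp: \<psi>_def P(2))
  qed
  have "\<bar>fst (grad \<phi> (s, t)) - (\<Sum>n=1..K. deriv (\<psi> n) s * sin (pi * real n * t))\<bar> \<le> e \<and>
      \<bar>snd (grad \<phi> (s, t)) - (\<Sum>n=1..K. \<psi> n s * (pi * real n * cos (pi * real n * t)))\<bar> \<le> e"
    if s: "s \<in> {0..N}" and t: "t \<in> {0..1}" for s t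
  proof
    have "(\<Sum>n=1..K. \<psi> n s * (pi * real n * cos (pi * real n * t))) = R s t - s / N * R N t"
      unfolding R_def sum_distrib_left sum_subtractf[symmetric]
      by (rule sum.cong) (auto simp: \<psi>_def field_simps)
    moreover have "\<bar>s / N * R N t\<bar> \<le> 1 * (2 * d * N)"
      unfolding abs_mult using s N rN[OF t] by (intro mult_mono) auto
    moreover have "2 * d * N + 1 * (2 * d * N) \<le> e" using d(2) by (simp add: mult.commute mult.left_commute)
    ultimately show "\<bar>snd (grad \<phi> (s, t)) - (\<Sum>n=1..K. \<psi> n s * (pi * real n * cos (pi * real n * t)))\<bar> \<le> e"
      using r[OF s t] by linarith
    have RNint: "((\<lambda>t. R N t) has_integral (\<Sum>n=1..K. poly (P n) N * (sin (pi * real n * t) / (pi * real n)))) {0..t}"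
    proof -
      have "((\<lambda>t. \<Sum>n=1..K. poly (P n) N * (sin (pi * real n * t) / (pi * real n))) has_real_derivative R N t) (at t)" for t
        unfolding R_def by (auto intro!: derivative_eq_intros sum.cong)
      from ftc[OF _ this, of 0 t] show ?thesis using t by simp
    qed
    have contR: "continuous_on A (\<lambda>t. R N t)" for A unfolding R_def by (intro continuous_intros)
    have "(\<Sum>n=1..K. deriv (\<psi> n) s * sin (pi * real n * t)) =
        (\<Sum>n=1..K. poly (p n) s * (sin (pi * real n * t) / (pi * real n))) -
        inverse N * (\<Sum>n=1..K. poly (P n) N * (sin (pi * real n * t) / (pi * real n)))"
      unfolding sum_distrib_left sum_subtractf[symmetric]
      by (rule sum.cong) (simp_all add: DERIV_imp_deriv[OF d\<psi>] divide_inverse algebra_simps)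
    then have eq: "(\<Sum>n=1..K. deriv (\<psi> n) s * sin (pi * real n * t)) = integral {0..t} (\<lambda>t. ?Q1 s t) - inverse N * integral {0..t} (\<lambda>t. R N t)"
      using integral_unique[OF Qint[of t s]] integral_unique[OF RNint] t by simp
    have "fst (grad \<phi> (s, t)) - integral {0..t} (\<lambda>t. ?Q1 s t) = integral {0..t} (\<lambda>t. h (s, t) - ?Q1 s t)"
    proof -
      have "integral {0..t} (\<lambda>t. h (s, t) - ?Q1 s t) = integral {0..t} (\<lambda>t. h (s, t)) - integral {0..t} (\<lambda>t. ?Q1 s t)"
        by (rule integral_diff) (intro igr line2 conth contQ)+
      then show ?thesis using i2[of s t] s t by simp
    qed
    then have m1: "\<bar>fst (grad \<phi> (s, t)) - integral {0..t} (\<lambda>t. ?Q1 s t)\<bar> = \<bar>integral {0..t} (\<lambda>t. h (s, t) - ?Q1 s t)\<bar>"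
      by simp
    have m2: "\<bar>integral {0..t} (\<lambda>t. h (s, t) - ?Q1 s t)\<bar> \<le> 2 * d * (t - 0)"
      using s t q by (intro bound continuous_on_diff line2 conth contQ) auto
    have m3: "2 * d * (t - 0) \<le> 2 * d" using t d by (auto intro: mult_left_le)
    have "\<bar>integral {0..t} (\<lambda>t. R N t)\<bar> \<le> 2 * d * N * (t - 0)"
      using t rN by (intro bound contR) auto
    then have "\<bar>inverse N * integral {0..t} (\<lambda>t. R N t)\<bar> \<le> inverse N * (2 * d * N * (t - 0))"
      unfolding abs_mult using N by (intro mult_mono) auto
    moreover have "inverse N * (2 * d * N * (t - 0)) = 2 * d * (t - 0)" using N by (simp add: field_simps)
    ultimately have "\<bar>inverse N * integral {0..t} (\<lambda>t. R N t)\<bar> \<le> 2 * d * (t - 0)" by (simp only:)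
    then show "\<bar>fst (grad \<phi> (s, t)) - (\<Sum>n=1..K. deriv (\<psi> n) s * sin (pi * real n * t))\<bar> \<le> e"
      unfolding eq using d(3) m1 m2 m3 by linarith
  qed
  then show ?thesis
    using s\<psi> by (intro exI[of _ K] exI[of _ \<psi>]) (auto simp: rect_def)
qed

section \<open>The energy form on sine modes\<close>

lemma sum_shift_down:
  fixes a :: "nat \<Rightarrow> real"
  shows "(\<Sum>i=1..M. a (i - 1)) + a M = (\<Sum>i=1..M. a i) + a 0"
  by (induction M) auto

lemma sum_shift_up:
  fixes b :: "nat \<Rightarrow> real"
  shows "(\<Sum>i=1..M. b (i + 1)) + b 1 = (\<Sum>i=1..M. b i) + b (M + 1)"
  by (induction M) auto

definition diag :: "nat \<Rightarrow> (nat \<Rightarrow> real) \<Rightarrow> (nat \<Rightarrow> real) \<Rightarrow> real"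
  where "diag M y c = (\<Sum>i=1..M. (y i + y (i + 1)) * (c i)\<^sup>2)"

text \<open>Shifting the index returns every square to its own node with the weight of one adjacent
  cell; the zeros at both ends ensure that only nonnegative terms are dropped.\<close>

lemma shifted_squares_le:
  assumes y: "\<forall>i\<in>{1..M+1}. 0 < y i" and c: "c 0 = 0" "c (M + 1) = 0"
  shows "(\<Sum>i=1..M. y i * (c (i - 1))\<^sup>2 + y (i + 1) * (c (i + 1))\<^sup>2) \<le> diag M y c"
proof -
  have "(\<Sum>i=1..M. y i * (c (i - 1))\<^sup>2) = (\<Sum>i=1..M. y (i - 1 + 1) * (c (i - 1))\<^sup>2)"
    by (rule sum.cong) auto
  also have "\<dots> \<le> (\<Sum>i=1..M. y (i + 1) * (c i)\<^sup>2)"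
  proof -
    have "0 \<le> y (M + 1) * (c M)\<^sup>2" using y[THEN bspec, of "M + 1"] by simp
    moreover have "y (0 + 1) * (c 0)\<^sup>2 = 0" using c(1) by simp
    ultimately show ?thesis using sum_shift_down[of "\<lambda>k. y (k + 1) * (c k)\<^sup>2" M] by linarith
  qed
  finally have 1: "(\<Sum>i=1..M. y i * (c (i - 1))\<^sup>2) \<le> (\<Sum>i=1..M. y (i + 1) * (c i)\<^sup>2)" .
  have 2: "(\<Sum>i=1..M. y (i + 1) * (c (i + 1))\<^sup>2) \<le> (\<Sum>i=1..M. y i * (c i)\<^sup>2)"
  proof -
    have "0 \<le> y 1 * (c 1)\<^sup>2" using y[THEN bspec, of 1] by simp
    moreover have "y (M + 1) * (c (M + 1))\<^sup>2 = 0" using c(2) by simp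
    ultimately have "(\<Sum>i=1..M. y (i + 1) * (c (i + 1))\<^sup>2) \<le> (\<Sum>i=1..M. y i * (c i)\<^sup>2)"
      using sum_shift_up[of "\<lambda>k. y k * (c k)\<^sup>2" M] by linarith
    then show ?thesis .
  qed
  show ?thesis using 1 2 by (simp add: diag_def sum.distrib distrib_right)
qed

text \<open>Row i of the tridiagonal block of one frequency, stripped of the factor
  \<open>kappa n\<close>; C stands for cosh (\<pi> n).\<close>

definition row :: "(nat \<Rightarrow> real) \<Rightarrow> real \<Rightarrow> (nat \<Rightarrow> real) \<Rightarrow> nat \<Rightarrow> real"
  where "row y C c i = (y i + y (i + 1)) * C * c i - y i * c (i - 1) - y (i + 1) * c (i + 1)"

text \<open>Each off-diagonal product is split by 2ab \<le> a^2 + b^2 while keeping its weight y, so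
  the off-diagonal part is at most \<open>diag\<close>. Comparing with weights instead of constants
  makes the bounds independent of the contrast of y.\<close>

lemma row_form_bounds:
  assumes y: "\<forall>i\<in>{1..M+1}. 0 < y i" and c: "c 0 = 0" "c (M + 1) = 0"
  shows "(C - 1) * diag M y c \<le> (\<Sum>i=1..M. c i * row y C c i)"
    and "(\<Sum>i=1..M. c i * row y C c i) \<le> (C + 1) * diag M y c"
proof -
  let ?r = "\<lambda>i. c i * (y i * c (i - 1) + y (i + 1) * c (i + 1))"
  let ?q = "\<lambda>i. ((y i + y (i + 1)) * (c i)\<^sup>2 + (y i * (c (i - 1))\<^sup>2 + y (i + 1) * (c (i + 1))\<^sup>2)) / 2"
  have r: "\<bar>?r i\<bar> \<le> ?q i" if i: "i \<in> {1..M}" for i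
  proof -
    have *: "\<bar>Y * (a * b)\<bar> \<le> Y * ((a\<^sup>2 + b\<^sup>2) / 2)" if "0 < Y" for Y a b :: real
    proof -
      have "\<bar>a * b\<bar> \<le> (a\<^sup>2 + b\<^sup>2) / 2"
        using sum_squares_bound[of "\<bar>a\<bar>" "\<bar>b\<bar>"] by (simp add: abs_mult)
      from mult_left_mono[OF this, of Y] that show ?thesis by (simp add: abs_mult[of Y])
    qed
    have r_eq: "?r i = y i * (c i * c (i - 1)) + y (i + 1) * (c i * c (i + 1))" by (simp add: algebra_simps)
    have q_eq: "?q i = y i * (((c i)\<^sup>2 + (c (i - 1))\<^sup>2) / 2) + y (i + 1) * (((c i)\<^sup>2 + (c (i + 1))\<^sup>2) / 2)"
      by (simp add: field_simps)
    have yi: "0 < y i" "0 < y (i + 1)" using y[THEN bspec, of i] y[THEN bspec, of "i + 1"] i by auto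
    show ?thesis
      unfolding r_eq q_eq by (rule order_trans[OF abs_triangle_ineq add_mono[OF *[OF yi(1)] *[OF yi(2)]]])
  qed
  have "\<bar>\<Sum>i=1..M. ?r i\<bar> \<le> (\<Sum>i=1..M. ?q i)"
    by (rule order_trans[OF sum_abs sum_mono[OF r]])
  also have "\<dots> = (diag M y c + (\<Sum>i=1..M. y i * (c (i - 1))\<^sup>2 + y (i + 1) * (c (i + 1))\<^sup>2)) / 2"
    unfolding diag_def sum.distrib[symmetric] sum_divide_distrib[symmetric] ..
  also have "\<dots> \<le> diag M y c" using shifted_squares_le[OF y c] by simp
  finally have R: "\<bar>\<Sum>i=1..M. ?r i\<bar> \<le> diag M y c" .
  have "(\<Sum>i=1..M. c i * row y C c i) = (\<Sum>i=1..M. C * ((y i + y (i + 1)) * (c i)\<^sup>2) - ?r i)"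
    by (rule sum.cong) (auto simp: row_def algebra_simps power2_eq_square)
  also have "\<dots> = C * diag M y c - (\<Sum>i=1..M. ?r i)"
    by (simp only: sum_subtractf diag_def sum_distrib_left)
  finally have "(\<Sum>i=1..M. c i * row y C c i) = C * diag M y c - (\<Sum>i=1..M. ?r i)" .
  then show "(C - 1) * diag M y c \<le> (\<Sum>i=1..M. c i * row y C c i)"
    "(\<Sum>i=1..M. c i * row y C c i) \<le> (C + 1) * diag M y c"
    using R by (simp_all add: algebra_simps)
qed

lemma diag_nonneg:
  assumes "\<forall>i\<in>{1..M+1}. 0 < y i"
  shows "0 \<le> diag M y c"
  unfolding diag_def using assms by (intro sum_nonneg mult_nonneg_nonneg add_nonneg_nonneg) (auto intro: less_imp_le)

text \<open>The quadratic form dominates (C - 1) times \<open>diag\<close>, whose weights are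
  positive, so the block is positive definite for C > 1.\<close>

lemma row_kernel:
  assumes y: "\<forall>i\<in>{1..M+1}. 0 < y i" and c: "c 0 = 0" "c (M + 1) = 0" and C: "1 < C"
    and row: "\<And>i. i \<in> {1..M} \<Longrightarrow> row y C c i = 0" and i: "i \<in> {1..M}"
  shows "c i = 0"
proof -
  have "(C - 1) * diag M y c \<le> 0" using row_form_bounds(1)[OF y c, where C = C] row by simp
  then have "diag M y c = 0" using C diag_nonneg[OF y, where c = c] by (simp add: mult_le_0_iff)
  then have "(y i + y (i + 1)) * (c i)\<^sup>2 = 0" unfolding diag_def
  proof (subst (asm) sum_nonneg_eq_0_iff)
    show "0 \<le> (y i + y (i + 1)) * (c i)\<^sup>2" if "i \<in> {1..M}" for i
      using y[THEN bspec, of i] y[THEN bspec, of "i + 1"] that by (intro mult_nonneg_nonneg) auto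
  qed (use i in auto)
  then show ?thesis using y[THEN bspec, of i] y[THEN bspec, of "i + 1"] i by (auto simp: add_eq_0_iff)
qed

text \<open>Replacing the tridiagonal system by its diagonal costs a factor \<open>1 / C\<close>, because the
  off-diagonal part is dominated by the diagonal up to that factor.\<close>

lemma diagonal_error:
  assumes y: "\<forall>i\<in>{1..M+1}. 0 < y i" and c: "c 0 = 0" "c (M + 1) = 0"
    and e: "e 0 = 0" "e (M + 1) = 0" and C: "5/3 \<le> C"
    and eq: "\<And>i. i \<in> {1..M} \<Longrightarrow> (y i + y (i + 1)) * C * e i = y i * c (i - 1) + y (i + 1) * c (i + 1)"
  shows "(\<Sum>i=1..M. e i * row y C e i) \<le> 4 / C\<^sup>2 * (\<Sum>i=1..M. c i * row y C c i)"
proof -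
  have "C\<^sup>2 * diag M y e = (\<Sum>i=1..M. C\<^sup>2 * ((y i + y (i + 1)) * (e i)\<^sup>2))"
    by (simp add: diag_def sum_distrib_left)
  also have "\<dots> \<le> (\<Sum>i=1..M. y i * (c (i - 1))\<^sup>2 + y (i + 1) * (c (i + 1))\<^sup>2)"
  proof (rule sum_mono)
    fix i assume i: "i \<in> {1..M}"
    define p q a b where "p = y i" and "q = y (i + 1)" and "a = c (i - 1)" and "b = c (i + 1)"
    have pq: "0 < p" "0 < q" using y[THEN bspec, of i] y[THEN bspec, of "i + 1"] i by (auto simp: p_def q_def)
    have "(p + q) * (C\<^sup>2 * ((p + q) * (e i)\<^sup>2)) = ((p + q) * C * e i)\<^sup>2" by (simp add: power2_eq_square)
    also have "\<dots> = (p * a + q * b)\<^sup>2" using eq[OF i] by (simp add: p_def q_def a_def b_def)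
    \<comment> \<open>Convexity of the square for the weights p and q.\<close>
    also have "\<dots> \<le> (p + q) * (p * a\<^sup>2 + q * b\<^sup>2)"
    proof -
      have "(p + q) * (p * a\<^sup>2 + q * b\<^sup>2) - (p * a + q * b)\<^sup>2 = p * q * (a - b)\<^sup>2"
        by (simp add: power2_eq_square algebra_simps)
      then show ?thesis using pq by (smt (verit) mult_nonneg_nonneg zero_le_power2)
    qed
    finally have "C\<^sup>2 * ((p + q) * (e i)\<^sup>2) \<le> p * a\<^sup>2 + q * b\<^sup>2" using pq by (simp add: mult_le_cancel_left)
    then show "C\<^sup>2 * ((y i + y (i + 1)) * (e i)\<^sup>2) \<le> y i * (c (i - 1))\<^sup>2 + y (i + 1) * (c (i + 1))\<^sup>2"
      by (simp add: p_def q_def a_def b_def)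
  qed
  also have "\<dots> \<le> diag M y c" by (rule shifted_squares_le[OF y c])
  finally have de: "diag M y e \<le> diag M y c / C\<^sup>2" using C by (simp add: pos_le_divide_eq mult.commute)
  have "(\<Sum>i=1..M. e i * row y C e i) \<le> (C + 1) * diag M y e" by (rule row_form_bounds(2)[OF y e])
  \<comment> \<open>C \<ge> 5/3 is exactly C + 1 \<le> 4 (C - 1); it trades the upper bound of the
    form for the lower one.\<close>
  also have "\<dots> \<le> (4 * (C - 1)) * (diag M y c / C\<^sup>2)"
    using C de diag_nonneg[OF y, where c = e] by (intro mult_mono) auto
  also have "\<dots> = 4 / C\<^sup>2 * ((C - 1) * diag M y c)" by simp
  also have "\<dots> \<le> 4 / C\<^sup>2 * (\<Sum>i=1..M. c i * row y C c i)"
    using C by (intro mult_left_mono row_form_bounds(1)[OF y c]) auto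
  finally show ?thesis .
qed

text \<open>The linear bound exp (\<pi> n) \<ge> 1 + \<pi> n \<ge> 4 already puts cosh above
  2.\<close>

lemma cosh_bounds:
  assumes "1 \<le> n"
  shows "5/3 \<le> cosh (pi * real n)" "exp (pi * real n) / 2 \<le> cosh (pi * real n)"
proof -
  show 1: "exp (pi * real n) / 2 \<le> cosh (pi * real n)" by (simp add: cosh_def)
  have "4 \<le> 1 + pi * real n"
    using pi_gt3 assms mult_mono[of 3 pi 1 "real n"] by simp
  also have "\<dots> \<le> exp (pi * real n)" by (rule exp_ge_add_one_self_aux) simp
  finally show "5/3 \<le> cosh (pi * real n)" using 1 by simp
qed

text \<open>The energy form on vector fields instead of functions: it also accepts square integrable
  fields that need not be gradients of H10 functions, such as the sums of separated terms used for
  density.\<close>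

definition aform :: "nat \<Rightarrow> (nat \<Rightarrow> real) \<Rightarrow> (real \<times> real \<Rightarrow> real \<times> real) \<Rightarrow> (real \<times> real \<Rightarrow> real \<times> real) \<Rightarrow> real"
  where "aform N y g h = (\<Sum>j=1..N. y j * L2_inner (rect (real j - 1) j) g h)"

definition anorm :: "nat \<Rightarrow> (nat \<Rightarrow> real) \<Rightarrow> (real \<times> real \<Rightarrow> real \<times> real) \<Rightarrow> real"
  where "anorm N y g = sqrt (aform N y g g)"

lemma bilinear_form_eq_aform:
  assumes u: "has_H10_grad 0 N u g" and v: "has_H10_grad 0 N v h"
  shows "bilinear_form N y u v = aform N y g h"
proof -
  note wu = weak_gradient_AE_eq[OF H10_spaceI(2)[OF u of_nat_0_le_iff]]
  note wv = weak_gradient_AE_eq[OF H10_spaceI(2)[OF v of_nat_0_le_iff]]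
  have "L2_inner (rect (real j - 1) j) (weak_gradient (rect 0 N) u) (weak_gradient (rect 0 N) v)
      = L2_inner (rect (real j - 1) j) g h" if "j \<in> {1..N}" for j
  proof -
    have sub: "rect (real j - 1) j \<subseteq> rect 0 N" using that by (intro subdomain_subset) auto
    show ?thesis
      using AE_lebesgue_on_subset[OF sub _ _ wu(1)] AE_lebesgue_on_subset[OF sub _ _ wv(1)]
        L2_subset[OF sub _ _ wu(2)] L2_subset[OF sub _ _ wv(2)]
        L2_subset[OF sub _ _ has_H10_gradD(2)[OF u]] L2_subset[OF sub _ _ has_H10_gradD(2)[OF v]]
      by (intro L2_inner_cong_AE L2_measurable) auto
  qed
  then show ?thesis unfolding bilinear_form_def aform_def Omega_rect by simp
qed

lemma L2_subdomain:
  assumes "g \<in> L2_space (rect 0 (real N))" "j \<in> {1..N}"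
  shows "g \<in> L2_space (rect (real j - 1) j)"
  using assms by (intro L2_subset[OF subdomain_subset _ _ assms(1)]) auto

lemma aform_commute: "aform N y g h = aform N y h g"
  unfolding aform_def by (simp add: L2_inner_commute)

lemma aform_add_left:
  assumes "g \<in> L2_space (rect 0 (real N))" "h \<in> L2_space (rect 0 (real N))" "k \<in> L2_space (rect 0 (real N))"
  shows "aform N y (\<lambda>x. g x + h x) k = aform N y g k + aform N y h k"
  unfolding aform_def sum.distrib[symmetric]
proof (intro sum.cong refl)
  fix j assume j: "j \<in> {1..N}"
  note L2_inner_add_left[OF L2_subdomain[OF assms(1) j] L2_subdomain[OF assms(2) j] L2_subdomain[OF assms(3) j]]
  then show "y j * L2_inner (rect (real j - 1) j) (\<lambda>x. g x + h x) k =
      y j * L2_inner (rect (real j - 1) j) g k + y j * L2_inner (rect (real j - 1) j) h k"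
    by (simp only: distrib_left)
qed

lemma aform_scaleR_left: "aform N y (\<lambda>x. c *\<^sub>R g x) k = c * aform N y g k"
  unfolding aform_def L2_inner_scaleR_left sum_distrib_left by (rule sum.cong) auto

lemma aform_diff_left:
  assumes "g \<in> L2_space (rect 0 (real N))" "h \<in> L2_space (rect 0 (real N))" "k \<in> L2_space (rect 0 (real N))"
  shows "aform N y (\<lambda>x. g x - h x) k = aform N y g k - aform N y h k"
  using aform_add_left[OF assms(1) L2_scaleR[OF assms(2)] assms(3), of y "-1"] aform_scaleR_left[of N y "-1" h k]
  by simp

lemma aform_sum_left:
  assumes "\<And>i. i \<in> I \<Longrightarrow> g i \<in> L2_space (rect 0 (real N))" "k \<in> L2_space (rect 0 (real N))"
  shows "aform N y (\<lambda>x. \<Sum>i\<in>I. g i x) k = (\<Sum>i\<in>I. aform N y (g i) k)"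
  using assms(1)
proof (induction I rule: infinite_finite_induct)
  case (insert i I)
  then show ?case using assms(2) by (simp add: aform_add_left L2_sum)
qed (simp_all add: aform_def L2_inner_def)

lemma aform_nonneg:
  assumes "\<forall>j\<in>{1..N}. 0 < y j"
  shows "0 \<le> aform N y g g"
  unfolding aform_def using assms by (intro sum_nonneg mult_nonneg_nonneg L2_inner_nonneg) (auto intro: less_imp_le)

lemma anorm_power2:
  assumes "\<forall>j\<in>{1..N}. 0 < y j"
  shows "(anorm N y g)\<^sup>2 = aform N y g g" "0 \<le> anorm N y g"
  using aform_nonneg[OF assms] by (simp_all add: anorm_def)

lemma aform_Cauchy_Schwarz:
  assumes y: "\<forall>j\<in>{1..N}. 0 < y j" and g: "g \<in> L2_space (rect 0 (real N))" and h: "h \<in> L2_space (rect 0 (real N))"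
  shows "\<bar>aform N y g h\<bar> \<le> anorm N y g * anorm N y h"
  unfolding anorm_def
proof (rule abs_le_sqrt_mult_if_quadratic_nonneg)
  show "0 \<le> aform N y h h" by (rule aform_nonneg[OF y])
  fix t
  let ?k = "\<lambda>x. g x - t *\<^sub>R h x"
  have k: "?k \<in> L2_space (rect 0 N)" by (intro L2_diff L2_scaleR g h)
  have "aform N y ?k ?k = aform N y g ?k - t * aform N y h ?k"
    unfolding aform_diff_left[OF g L2_scaleR[OF h] k] aform_scaleR_left ..
  also have "\<dots> = aform N y g g - 2 * t * aform N y g h + t\<^sup>2 * aform N y h h"
    unfolding aform_commute[of N y g ?k] aform_commute[of N y h ?k]
      aform_diff_left[OF g L2_scaleR[OF h] g] aform_diff_left[OF g L2_scaleR[OF h] h] aform_scaleR_left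
      aform_commute[of N y h g]
    by (simp add: power2_eq_square algebra_simps)
  finally show "0 \<le> aform N y g g - 2 * t * aform N y g h + t\<^sup>2 * aform N y h h"
    using aform_nonneg[OF y, of ?k] by simp
qed

lemma anorm_triangle:
  assumes y: "\<forall>j\<in>{1..N}. 0 < y j" and g: "g \<in> L2_space (rect 0 (real N))" and h: "h \<in> L2_space (rect 0 (real N))"
  shows "anorm N y (\<lambda>x. g x + h x) \<le> anorm N y g + anorm N y h"
proof (rule power2_le_imp_le)
  note gh = L2_add[OF g h]
  have "aform N y (\<lambda>x. g x + h x) (\<lambda>x. g x + h x) = aform N y g g + 2 * aform N y g h + aform N y h h"
    unfolding aform_add_left[OF g h gh] aform_commute[of N y g "\<lambda>x. g x + h x"] aform_commute[of N y h "\<lambda>x. g x + h x"]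
      aform_add_left[OF g h g] aform_add_left[OF g h h] aform_commute[of N y h g] by simp
  then show "(anorm N y (\<lambda>x. g x + h x))\<^sup>2 \<le> (anorm N y g + anorm N y h)\<^sup>2"
    using aform_Cauchy_Schwarz[OF y g h] unfolding power2_sum anorm_power2(1)[OF y] by simp
qed (simp add: anorm_power2[OF y])

lemma anorm_le_L2_norm:
  assumes y: "\<forall>j\<in>{1..N}. 0 < y j" and g: "g \<in> L2_space (rect 0 (real N))"
  shows "anorm N y g \<le> sqrt (\<Sum>j=1..N. y j) * L2_norm (rect 0 N) g"
proof -
  have "aform N y g g \<le> (\<Sum>j=1..N. y j * L2_inner (rect 0 N) g g)"
    unfolding aform_def
  proof (intro sum_mono mult_left_mono)
    fix j assume j: "j \<in> {1..N}"
    have "L2_norm (rect (real j - 1) j) g \<le> L2_norm (rect 0 N) g"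
      using j by (intro L2_norm_subset subdomain_subset g) auto
    from power_mono[OF this L2_norm_nonneg, of 2]
    show "L2_inner (rect (real j - 1) j) g g \<le> L2_inner (rect 0 N) g g" by (simp add: L2_norm_power2)
  qed (use y in \<open>auto intro: less_imp_le\<close>)
  also have "\<dots> = (\<Sum>j=1..N. y j) * L2_inner (rect 0 N) g g" by (simp add: sum_distrib_right)
  finally have "sqrt (aform N y g g) \<le> sqrt ((\<Sum>j=1..N. y j) * L2_inner (rect 0 N) g g)" by (rule real_sqrt_le_mono)
  then show ?thesis by (simp add: anorm_def L2_norm_def real_sqrt_mult)
qed

lemma anorm_tendsto_zero:
  assumes y: "\<forall>j\<in>{1..N}. 0 < y j" and g: "\<And>k. g k \<in> L2_space (rect 0 (real N))"
    and lim: "(\<lambda>k. L2_norm (rect 0 N) (g k)) \<longlonglongrightarrow> 0"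
  shows "(\<lambda>k. anorm N y (g k)) \<longlonglongrightarrow> 0"
proof (rule Lim_null_comparison)
  show "\<forall>\<^sub>F k in sequentially. norm (anorm N y (g k)) \<le> sqrt (\<Sum>j=1..N. y j) * L2_norm (rect 0 N) (g k)"
    using anorm_le_L2_norm[OF y g] anorm_power2(2)[OF y] by simp
  show "(\<lambda>k. sqrt (\<Sum>j=1..N. y j) * L2_norm (rect 0 N) (g k)) \<longlonglongrightarrow> 0"
    using tendsto_mult[OF tendsto_const lim] by simp
qed

text \<open>The common factor of a frequency block: the scale \<pi> n / sinh (\<pi> n) of
  \<open>hc\<close>, halved because \<open>coef\<close> is twice the moment.\<close>

definition kappa :: "nat \<Rightarrow> real"
  where "kappa n = pi * real n / (2 * sinh (pi * real n))"

text \<open>Only the two cells next to interface i meet the support of the mode, and their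
  contributions add up to one row.\<close>

lemma aform_gmode:
  assumes u: "has_H10_grad 0 N u g" and n: "1 \<le> n" "1 \<le> i" "i + 1 \<le> N"
  shows "aform N y g (gmode n i) = kappa n * row y (cosh (pi * real n)) (\<lambda>j. coef N n j g) i"
proof -
  let ?t = "\<lambda>j. y j * L2_inner (rect (real j - 1) j) g (gmode n i)"
  have "?t j = 0" if "j \<in> {1..N} - {i, i + 1}" for j
    using inner_gmode[OF u _ _ n, of j] that by simp
  then have "aform N y g (gmode n i) = sum ?t {i, i + 1}"
    unfolding aform_def using n by (intro sum.mono_neutral_right) auto
  also have "\<dots> = ?t i + ?t (i + 1)" by simp
  also have "?t i = y i * (kappa n * (cosh (pi * real n) * coef N n i g - coef N n (i - 1) g))"
    using inner_gmode[OF u _ _ n, of i] n by (simp add: kappa_def)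
  also have "?t (i + 1) = y (i + 1) * (kappa n * (cosh (pi * real n) * coef N n i g - coef N n (i + 1) g))"
    using inner_gmode[OF u _ _ n, of "i + 1"] n by (simp only: kappa_def) simp
  finally show ?thesis by (simp add: row_def algebra_simps)
qed

lemma kappa_nonneg: "0 \<le> kappa n"
  by (simp add: kappa_def)

lemma kappa_pos: "1 \<le> n \<Longrightarrow> 0 < kappa n"
  by (simp add: kappa_def)

lemma coef_sum:
  assumes "\<And>i. i \<in> I \<Longrightarrow> g i \<in> L2_space (rect 0 (real N))" "j \<le> N"
  shows "coef N n j (\<lambda>x. \<Sum>i\<in>I. g i x) = (\<Sum>i\<in>I. coef N n j (g i))"
  unfolding coef_def using assms by (subst L2_inner_sum_left) (auto simp: cut_L2 sum_distrib_left)

lemma coef_scaleR: "coef N n j (\<lambda>x. c *\<^sub>R g x) = c * coef N n j g"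
  unfolding coef_def L2_inner_scaleR_left by simp

lemma coef_diff:
  assumes "g \<in> L2_space (rect 0 (real N))" "h \<in> L2_space (rect 0 (real N))" "j \<le> N"
  shows "coef N n j (\<lambda>x. g x - h x) = coef N n j g - coef N n j h"
  unfolding coef_def by (subst L2_inner_diff_left) (auto simp: assms cut_L2)

text \<open>By biorthogonality this projects gradients of H10 functions onto the modes of frequency
  at most K; the projection is orthogonal in the energy form, whatever the coefficients y.\<close>

definition trunc :: "nat \<Rightarrow> nat \<Rightarrow> (real \<times> real \<Rightarrow> real \<times> real) \<Rightarrow> real \<times> real \<Rightarrow> real \<times> real"
  where "trunc N K g x = (\<Sum>n=1..K. \<Sum>i=1..N-1. coef N n i g *\<^sub>R gmode n i x)"

lemma harm_trunc: "\<exists>u. harm N u (trunc N K g)"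
proof -
  have "harm N (\<lambda>x. \<Sum>n=1..K. \<Sum>i=1..N-1. coef N n i g * mode n i x) (\<lambda>x. \<Sum>n=1..K. \<Sum>i=1..N-1. coef N n i g *\<^sub>R gmode n i x)"
    by (intro harm_sum harm_scaleR harm_mode) auto
  then show ?thesis unfolding trunc_def[abs_def] by blast
qed

lemma coef_trunc:
  assumes g: "has_H10_grad 0 N u g" and m: "m \<in> {1..K}" and j: "j \<le> N"
  shows "coef N m j (trunc N K g) = coef N m j g"
proof -
  have gm: "gmode n i \<in> L2_space (rect 0 N)" if "n \<in> {1..K}" "i \<in> {1..N-1}" for n i
    using that by (intro has_H10_gradD(2)[OF mode_H10]) auto
  have "coef N m j (trunc N K g) = (\<Sum>n=1..K. coef N m j (\<lambda>x. \<Sum>i=1..N-1. coef N n i g *\<^sub>R gmode n i x))"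
    unfolding trunc_def[abs_def] by (rule coef_sum) (auto intro!: L2_sum L2_scaleR gm j)
  also have "\<dots> = (\<Sum>n=1..K. \<Sum>i=1..N-1. coef N m j (\<lambda>x. coef N n i g *\<^sub>R gmode n i x))"
    by (intro sum.cong refl coef_sum j) (auto intro!: L2_scaleR gm)
  also have "\<dots> = (\<Sum>n=1..K. \<Sum>i=1..N-1. if n = m then (if i = j then coef N m j g else 0) else 0)"
  proof (intro sum.cong refl)
    fix n i assume "n \<in> {1..K}" "i \<in> {1..N-1}"
    then have "coef N m j (gmode n i) = (if m = n \<and> j = i then 1 else 0)"
      using m j by (intro coef_gmode) auto
    then show "coef N m j (\<lambda>x. coef N n i g *\<^sub>R gmode n i x) = (if n = m then (if i = j then coef N m j g else 0) else 0)"
      unfolding coef_scaleR by auto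
  qed
  also have "\<dots> = (\<Sum>n=1..K. if n = m then (\<Sum>i=1..N-1. if i = j then coef N m j g else 0) else 0)"
    by (intro sum.cong refl) auto
  also have "\<dots> = (\<Sum>i=1..N-1. if i = j then coef N m j g else 0)"
    using m by (simp add: sum.delta)
  also have "\<dots> = coef N m j g"
  proof (cases "j \<in> {1..N-1}")
    case True
    then show ?thesis by (simp add: sum.delta)
  next
    case False
    then have "j = 0 \<or> j = N" using j by auto
    then show ?thesis using coef_boundary[OF g, of m] by (auto simp: sum.delta)
  qed
  finally show ?thesis .
qed

text \<open>A mode of frequency n sees only the coefficients of h of the same frequency, so the form
  splits into blocks.\<close>

lemma aform_trunc:
  assumes g: "has_H10_grad 0 N u g" and h: "has_H10_grad 0 N v h"
  shows "aform N y h (trunc N K g) =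
    (\<Sum>n=1..K. kappa n * (\<Sum>i=1..N-1. coef N n i g * row y (cosh (pi * real n)) (\<lambda>j. coef N n j h) i))"
proof -
  have gm: "gmode n i \<in> L2_space (rect 0 N)" if "n \<in> {1..K}" "i \<in> {1..N-1}" for n i
    using that by (intro has_H10_gradD(2)[OF mode_H10]) auto
  note hL = has_H10_gradD(2)[OF h]
  have "aform N y (trunc N K g) h = (\<Sum>n=1..K. aform N y (\<lambda>x. \<Sum>i=1..N-1. coef N n i g *\<^sub>R gmode n i x) h)"
    unfolding trunc_def[abs_def] by (rule aform_sum_left[OF _ hL]) (auto intro!: L2_sum L2_scaleR gm)
  also have "\<dots> = (\<Sum>n=1..K. \<Sum>i=1..N-1. aform N y (\<lambda>x. coef N n i g *\<^sub>R gmode n i x) h)"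
    by (intro sum.cong refl aform_sum_left[OF _ hL]) (auto intro!: L2_scaleR gm)
  also have "\<dots> = (\<Sum>n=1..K. \<Sum>i=1..N-1. coef N n i g * (kappa n * row y (cosh (pi * real n)) (\<lambda>j. coef N n j h) i))"
  proof (intro sum.cong refl)
    fix n i assume ni: "n \<in> {1..K}" "i \<in> {1..N-1}"
    have "aform N y h (gmode n i) = kappa n * row y (cosh (pi * real n)) (\<lambda>j. coef N n j h) i"
      by (rule aform_gmode[OF h]) (use ni in auto)
    then show "aform N y (\<lambda>x. coef N n i g *\<^sub>R gmode n i x) h =
        coef N n i g * (kappa n * row y (cosh (pi * real n)) (\<lambda>j. coef N n j h) i)"
      unfolding aform_scaleR_left by (simp add: aform_commute[of N y "gmode n i"])
  qed
  finally show ?thesis unfolding aform_commute[of N y h] by (simp add: sum_distrib_left mult.left_commute)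
qed

text \<open>Truncation preserves the coefficients of frequency at most K, and a pairing with
  \<open>trunc N K g\<close> depends on nothing else.\<close>

lemma aform_trunc_trunc:
  assumes g: "has_H10_grad 0 N u g"
  shows "aform N y (trunc N K g) (trunc N K g) = aform N y g (trunc N K g)"
proof -
  obtain v where "harm N v (trunc N K g)" using harm_trunc by blast
  then have h: "has_H10_grad 0 N v (trunc N K g)" by (simp add: harm_def)
  have "row y C (\<lambda>j. coef N n j (trunc N K g)) i = row y C (\<lambda>j. coef N n j g) i"
    if "n \<in> {1..K}" "i \<in> {1..N-1}" for n i C
  proof -
    have "i - 1 \<le> N" "i \<le> N" "i + 1 \<le> N" using that by auto
    then show ?thesis unfolding row_def by (simp only: coef_trunc[OF g that(1)])
  qed
  then show ?thesis unfolding aform_trunc[OF g h] aform_trunc[OF g g]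
    by (intro sum.cong refl arg_cong2[where f = "(*)"]) auto
qed

lemma anorm_trunc_le:
  assumes y: "\<forall>j\<in>{1..N}. 0 < y j" and g: "has_H10_grad 0 N u g"
  shows "anorm N y (trunc N K g) \<le> anorm N y g"
proof -
  obtain v where "harm N v (trunc N K g)" using harm_trunc by blast
  then have t: "trunc N K g \<in> L2_space (rect 0 N)" by (rule harm_L2)
  note gL = has_H10_gradD(2)[OF g]
  have "(anorm N y (trunc N K g))\<^sup>2 = aform N y g (trunc N K g)"
    unfolding anorm_power2(1)[OF y] by (rule aform_trunc_trunc[OF g])
  also have "\<dots> \<le> anorm N y g * anorm N y (trunc N K g)"
    using aform_Cauchy_Schwarz[OF y gL t] by simp
  finally have *: "anorm N y (trunc N K g) * anorm N y (trunc N K g) \<le> anorm N y g * anorm N y (trunc N K g)"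
    by (simp add: power2_eq_square)
  show ?thesis
  proof (cases "anorm N y (trunc N K g) = 0")
    case True
    then show ?thesis using anorm_power2(2)[OF y] by simp
  next
    case False
    then have "0 < anorm N y (trunc N K g)" using anorm_power2(2)[OF y, of "trunc N K g"] by simp
    then show ?thesis using * by simp
  qed
qed

section \<open>The error estimate\<close>

definition separated :: "nat \<Rightarrow> (nat \<Rightarrow> real \<Rightarrow> real) \<Rightarrow> real \<times> real \<Rightarrow> real \<times> real"
  where "separated K \<psi> x = (\<Sum>n=1..K. (deriv (\<psi> n) (fst x) * sin (pi * real n * snd x),
    \<psi> n (fst x) * (pi * real n * cos (pi * real n * snd x))))"

lemma separated_term_L2:
  assumes "smooth \<psi>"
  shows "(\<lambda>x. (deriv \<psi> (fst x) * sin (pi * real n * snd x), \<psi> (fst x) * (pi * real n * cos (pi * real n * snd x))))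
    \<in> L2_space (rect a b)"
proof -
  have "continuous_on UNIV (\<lambda>x::real\<times>real. deriv \<psi> (fst x))" "continuous_on UNIV (\<lambda>x::real\<times>real. \<psi> (fst x))"
    by (rule smooth_continuous[OF smooth_fst[OF smooth_deriv(2)[OF assms]]], rule smooth_continuous[OF smooth_fst[OF assms]])
  then show ?thesis by (intro L2_continuous continuous_intros)
qed

lemma separated_L2: "(\<And>n. smooth (\<psi> n)) \<Longrightarrow> separated K \<psi> \<in> L2_space (rect a b)"
  unfolding separated_def[abs_def] by (intro L2_sum separated_term_L2)

lemma harm_orthogonal_sum_separated:
  assumes v: "harm N v g" and c: "\<And>n j. n \<in> {1..K} \<Longrightarrow> j \<le> N \<Longrightarrow> coef N n j g = 0"
    and \<psi>: "\<And>n. smooth (\<psi> n)"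
  shows "aform N y g (separated K \<psi>) = 0"
proof -
  let ?T = "\<lambda>n x. (deriv (\<psi> n) (fst x) * sin (pi * real n * snd x), \<psi> n (fst x) * (pi * real n * cos (pi * real n * snd x)))"
  have "aform N y g (?T n) = 0" if n: "n \<in> {1..K}" for n
  proof -
    have "L2_inner (rect (real j - 1) j) g (?T n) = 0" if "j \<in> {1..N}" for j
      using that n c[of n "j - 1"] c[of n j] by (intro harm_orthogonal_separated[OF v] \<psi>) auto
    then show ?thesis by (simp add: aform_def)
  qed
  then have "(\<Sum>n=1..K. aform N y (?T n) g) = 0"
    by (intro sum.neutral) (simp add: aform_commute[of N y _ g])
  moreover have "aform N y (separated K \<psi>) g = (\<Sum>n=1..K. aform N y (?T n) g)"
    unfolding separated_def[abs_def] by (rule aform_sum_left[OF separated_term_L2[OF \<psi>] harm_L2(1)[OF v]])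
  ultimately show ?thesis by (simp add: aform_commute[of N y g])
qed

text \<open>The uniform approximation of the gradient becomes L2 convergence because the rectangle
  has finite measure.\<close>

lemma test_separated_limit:
  assumes \<phi>: "\<phi> \<in> test_functions (rect 0 N)" and N: "0 < N"
  shows "\<exists>K \<psi>. (\<forall>k n. smooth (\<psi> k n)) \<and>
    (\<lambda>k. L2_norm (rect 0 N) (\<lambda>x. separated (K k) (\<psi> k) x - grad \<phi> x)) \<longlonglongrightarrow> 0"
proof -
  let ?R = "rect 0 N" and ?e = "\<lambda>k. inverse (real (Suc k))"
  have "\<forall>k. \<exists>K \<psi>. (\<forall>n. smooth (\<psi> n)) \<and> (\<forall>x\<in>?R. norm (separated K \<psi> x - grad \<phi> x) \<le> 2 * ?e k)"
  proof
    fix k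
    obtain K \<psi> where s: "\<forall>n. smooth (\<psi> n) \<and> \<psi> n 0 = 0 \<and> \<psi> n N = 0" and
      a: "\<forall>x\<in>?R. \<bar>fst (grad \<phi> x) - (\<Sum>n=1..K. deriv (\<psi> n) (fst x) * sin (pi * real n * snd x))\<bar> \<le> ?e k \<and>
        \<bar>snd (grad \<phi> x) - (\<Sum>n=1..K. \<psi> n (fst x) * (pi * real n * cos (pi * real n * snd x)))\<bar> \<le> ?e k"
      using test_approximation[OF \<phi> N, of "?e k"] by auto
    have "norm (separated K \<psi> x - grad \<phi> x) \<le> 2 * ?e k" if "x \<in> ?R" for x
    proof -
      have "norm (separated K \<psi> x - grad \<phi> x) \<le> \<bar>fst (separated K \<psi> x - grad \<phi> x)\<bar> + \<bar>snd (separated K \<psi> x - grad \<phi> x)\<bar>"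
        using norm_Pair_le[of "fst (separated K \<psi> x - grad \<phi> x)" "snd (separated K \<psi> x - grad \<phi> x)"]
        by (simp only: prod.collapse real_norm_def)
      also have "\<dots> \<le> ?e k + ?e k"
        using a that unfolding separated_def fst_diff snd_diff fst_sum snd_sum fst_conv snd_conv
        by (intro add_mono) (simp_all only: abs_minus_commute)
      finally show ?thesis by simp
    qed
    then show "\<exists>K \<psi>. (\<forall>n. smooth (\<psi> n)) \<and> (\<forall>x\<in>?R. norm (separated K \<psi> x - grad \<phi> x) \<le> 2 * ?e k)" using s by blast
  qed
  then obtain K \<psi> where s: "\<And>k n. smooth (\<psi> k n)" and
    b: "\<And>k x. x \<in> ?R \<Longrightarrow> norm (separated (K k) (\<psi> k) x - grad \<phi> x) \<le> 2 * ?e k" by metis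
  have L: "(\<lambda>x. separated (K k) (\<psi> k) x - grad \<phi> x) \<in> L2_space ?R" for k
    by (intro L2_diff separated_L2 s test_L2(2)[OF \<phi>]) auto
  have lim: "(\<lambda>k. separated (K k) (\<psi> k) x - grad \<phi> x) \<longlonglongrightarrow> 0" if "x \<in> ?R" for x
  proof (rule Lim_null_comparison)
    show "\<forall>\<^sub>F k in sequentially. norm (separated (K k) (\<psi> k) x - grad \<phi> x) \<le> 2 * ?e k" using b[OF that] by simp
    show "(\<lambda>k. 2 * ?e k) \<longlonglongrightarrow> 0"
      using tendsto_mult[OF tendsto_const LIMSEQ_inverse_real_of_nat, of 2] by simp
  qed
  have b2: "norm (separated (K k) (\<psi> k) x - grad \<phi> x) \<le> 2" if "x \<in> ?R" for k x
  proof -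
    have "?e k \<le> 1" by (rule inverse_le_1_iff[THEN iffD2]) simp
    then show ?thesis using b[OF that, of k] by linarith
  qed
  have "(\<lambda>k. L2_norm ?R (\<lambda>x. (separated (K k) (\<psi> k) x - grad \<phi> x) - 0)) \<longlonglongrightarrow> 0"
    by (rule L2_dominated_convergence(2)[OF rect_measurable(2) L2_measurable[OF L] _ b2])
      (auto intro!: AE_I2 lim)
  then show ?thesis using s by (intro exI[of _ K] exI[of _ \<psi>]) simp
qed

text \<open>A discrete harmonic function is orthogonal to the functions that vanish on the interfaces, so
  on the dense set of separated functions the form only sees its sine coefficients.\<close>

lemma anorm_le_if_trunc_le:
  assumes y: "\<forall>j\<in>{1..N}. 0 < y j" and v: "harm N v g" and N: "0 < N"
    and B: "\<And>K. anorm N y (trunc N K g) \<le> B"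
  shows "anorm N y g \<le> B"
proof -
  let ?R = "rect 0 (real N)"
  note gL = harm_L2(1)[OF v]
  have H: "has_H10_grad 0 N v g" using v by (simp add: harm_def)
  have a0: "0 \<le> anorm N y h" for h using anorm_power2(2)[OF y] .
  have B0: "0 \<le> B" using B[of 0] a0[of "trunc N 0 g"] by linarith
  have test: "aform N y g (grad \<phi>) \<le> B * anorm N y (grad \<phi>)" if \<phi>: "\<phi> \<in> test_functions ?R" for \<phi>
  proof -
    have dL: "grad \<phi> \<in> L2_space ?R" by (rule test_L2(2)[OF \<phi>]) simp
    obtain K \<psi> where s: "\<And>k n. smooth (\<psi> k n)" and
      lim: "(\<lambda>k. L2_norm ?R (\<lambda>x. separated (K k) (\<psi> k) x - grad \<phi> x)) \<longlonglongrightarrow> 0"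
      using test_separated_limit[OF \<phi>] N by auto
    let ?\<Phi> = "\<lambda>k. separated (K k) (\<psi> k)"
    let ?d = "\<lambda>k x. ?\<Phi> k x - grad \<phi> x"
    have PL: "?\<Phi> k \<in> L2_space ?R" for k by (intro separated_L2 s)
    have DL: "?d k \<in> L2_space ?R" for k by (intro L2_diff PL dL)
    have "aform N y g (grad \<phi>) \<le> B * anorm N y (grad \<phi>) + (B + anorm N y g) * anorm N y (?d k)" for k
    proof -
      obtain w where w: "harm N w (trunc N (K k) g)" using harm_trunc by blast
      note tL = harm_L2(1)[OF w]
      \<comment> \<open>The difference has zero coefficients at all frequencies up to
        \<open>K k\<close>, the only ones present in the separated field. Hence g can be replaced by
        its truncation, for which the bound B is available.\<close>
      have "aform N y (\<lambda>x. g x - trunc N (K k) g x) (?\<Phi> k) = 0"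
        by (rule harm_orthogonal_sum_separated[OF harm_diff[OF v w] _ s])
          (simp add: coef_diff[OF gL tL] coef_trunc[OF H])
      then have "aform N y g (?\<Phi> k) = aform N y (trunc N (K k) g) (?\<Phi> k)"
        using aform_diff_left[OF gL tL PL, of y k] by simp
      also have "\<dots> \<le> anorm N y (trunc N (K k) g) * anorm N y (?\<Phi> k)"
        using aform_Cauchy_Schwarz[OF y tL PL, of k] by simp
      also have "\<dots> \<le> B * anorm N y (?\<Phi> k)" by (rule mult_right_mono[OF B a0])
      also have "\<dots> \<le> B * (anorm N y (grad \<phi>) + anorm N y (?d k))"
        using anorm_triangle[OF y dL DL, of k] by (intro mult_left_mono B0) simp
      finally have 1: "aform N y g (?\<Phi> k) \<le> B * (anorm N y (grad \<phi>) + anorm N y (?d k))" .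
      have "aform N y g (?d k) = aform N y g (?\<Phi> k) - aform N y g (grad \<phi>)"
        unfolding aform_commute[of N y g "?d k"] aform_commute[of N y g "?\<Phi> k"] aform_commute[of N y g "grad \<phi>"]
        by (rule aform_diff_left[OF PL dL gL])
      moreover have "\<bar>aform N y g (?d k)\<bar> \<le> anorm N y g * anorm N y (?d k)"
        by (rule aform_Cauchy_Schwarz[OF y gL DL])
      ultimately show ?thesis using 1 by (simp add: algebra_simps)
    qed
    moreover have "(\<lambda>k. B * anorm N y (grad \<phi>) + (B + anorm N y g) * anorm N y (?d k)) \<longlonglongrightarrow>
        B * anorm N y (grad \<phi>) + (B + anorm N y g) * 0"
      by (intro tendsto_intros anorm_tendsto_zero[OF y DL lim])
    ultimately show ?thesis by (intro LIMSEQ_le_const) auto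
  qed
  \<comment> \<open>Second density step: g is itself a limit of gradients of test functions, so the
    bound on pairings turns into a bound on the norm of g.\<close>
  obtain \<phi> where \<phi>: "test_limit ?R \<phi> v g" using H by (auto simp: has_H10_grad_def)
  have t: "\<phi> k \<in> test_functions ?R" for k using \<phi> by (simp add: test_limit_def)
  have tL: "grad (\<phi> k) \<in> L2_space ?R" for k by (rule test_L2(2)[OF t]) simp
  let ?d = "\<lambda>k x. grad (\<phi> k) x - g x"
  have DL: "?d k \<in> L2_space ?R" for k by (intro L2_diff tL gL)
  have lim: "(\<lambda>k. anorm N y (?d k)) \<longlonglongrightarrow> 0"
    using \<phi> by (intro anorm_tendsto_zero[OF y DL]) (auto simp: test_limit_def)
  have "aform N y g g \<le> B * anorm N y g + (B + anorm N y g) * anorm N y (?d k)" for k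
  proof -
    have "aform N y g (grad (\<phi> k)) \<le> B * anorm N y (grad (\<phi> k))" by (rule test[OF t])
    also have "\<dots> \<le> B * (anorm N y g + anorm N y (?d k))"
      using anorm_triangle[OF y gL DL, of k] by (intro mult_left_mono B0) simp
    finally have 1: "aform N y g (grad (\<phi> k)) \<le> B * (anorm N y g + anorm N y (?d k))" .
    have "aform N y g (?d k) = aform N y g (grad (\<phi> k)) - aform N y g g"
      unfolding aform_commute[of N y g "?d k"] aform_commute[of N y g "grad (\<phi> k)"]
      by (rule aform_diff_left[OF tL gL gL])
    moreover have "\<bar>aform N y g (?d k)\<bar> \<le> anorm N y g * anorm N y (?d k)"
      by (rule aform_Cauchy_Schwarz[OF y gL DL])
    ultimately show ?thesis using 1 by (simp add: algebra_simps)
  qed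
  moreover have "(\<lambda>k. B * anorm N y g + (B + anorm N y g) * anorm N y (?d k)) \<longlonglongrightarrow>
      B * anorm N y g + (B + anorm N y g) * 0"
    by (intro tendsto_intros lim)
  ultimately have "aform N y g g \<le> B * anorm N y g" by (intro LIMSEQ_le_const) auto
  then have *: "anorm N y g * anorm N y g \<le> B * anorm N y g"
    using anorm_power2(1)[OF y, of g] by (simp add: power2_eq_square)
  show ?thesis
  proof (cases "anorm N y g = 0")
    case False
    then have "0 < anorm N y g" using a0[of g] by simp
    then show ?thesis using * by simp
  qed (simp add: B0)
qed

section \<open>Sine moments and modes of the slow and fast spaces\<close>

lemma Y_slow_moment:
  assumes "g \<in> Y_slow ns" "ns < m"
  shows "L2_inner {0<..<1} g (\<lambda>t. sin (pi * real m * t)) = 0"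
proof -
  obtain \<alpha> where g: "g = (\<lambda>t. \<Sum>n=1..ns. \<alpha> n * sin (pi * real n * t))" using assms(1) unfolding Y_slow_def by blast
  have sc: "(\<lambda>t. \<alpha> n *\<^sub>R sin (pi * real n * t)) \<in> L2_space {0<..<1}" for n by (rule L2_scaleR[OF sin_L2])
  have "L2_inner {0<..<1} g (\<lambda>t. sin (pi * real m * t))
      = (\<Sum>n=1..ns. L2_inner {0<..<1} (\<lambda>t. \<alpha> n *\<^sub>R sin (pi * real n * t)) (\<lambda>t. sin (pi * real m * t)))"
    using L2_inner_sum_left[OF sc sin_L2[of m], where I = "{1..ns}"] by (simp add: g)
  also have "\<dots> = 0"
    unfolding L2_inner_scaleR_left using assms(2) by (intro sum.neutral) (auto simp: sin_sin_moment)
  finally show ?thesis .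
qed

lemma Y_fast_moment:
  assumes "g \<in> Y_fast N ns i" "m \<le> ns" "1 \<le> m"
  shows "L2_inner {0<..<1} g (\<lambda>t. sin (pi * real m * t)) = 0"
proof -
  obtain \<alpha> where lim: "(\<lambda>k. L2_norm {0<..<1} (\<lambda>t. (\<Sum>n=ns+1..k. \<alpha> n * sin (pi * real n * t)) - g t)) \<longlonglongrightarrow> 0"
    and g: "g \<in> H_half_00 N i" using assms(1) unfolding Y_fast_def by blast
  have gL: "g \<in> L2_space {0<..<1}" using g unfolding H_half_00_def has_trace_def by blast
  have sc: "(\<lambda>t. \<alpha> n *\<^sub>R sin (pi * real n * t)) \<in> L2_space {0<..<1}" for n by (rule L2_scaleR[OF sin_L2])
  have S: "(\<lambda>t. \<Sum>n=ns+1..k. \<alpha> n * sin (pi * real n * t)) \<in> L2_space {0<..<1}" for k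
    using L2_sum[OF sc, where I = "{ns+1..k}"] by simp
  have "L2_inner {0<..<1} (\<lambda>t. \<Sum>n=ns+1..k. \<alpha> n * sin (pi * real n * t)) (\<lambda>t. sin (pi * real m * t)) = 0" for k
  proof -
    have "L2_inner {0<..<1} (\<lambda>t. \<Sum>n=ns+1..k. \<alpha> n * sin (pi * real n * t)) (\<lambda>t. sin (pi * real m * t))
        = (\<Sum>n=ns+1..k. L2_inner {0<..<1} (\<lambda>t. \<alpha> n *\<^sub>R sin (pi * real n * t)) (\<lambda>t. sin (pi * real m * t)))"
      using L2_inner_sum_left[OF sc sin_L2[of m], where I = "{ns+1..k}"] by simp
    also have "\<dots> = 0"
      unfolding L2_inner_scaleR_left using assms(2,3) by (intro sum.neutral) (auto simp: sin_sin_moment)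
    finally show ?thesis .
  qed
  then show ?thesis using L2_tendsto_inner[OF S gL sin_L2 lim, of m] by (simp add: LIMSEQ_const_iff)
qed

lemma coef_zero_trace: "has_trace N j u (\<lambda>_. 0) \<Longrightarrow> j \<le> N \<Longrightarrow> coef N n j (weak_gradient (rect 0 N) u) = 0"
  using coef_eq_trace_moment[of N j u "\<lambda>_. 0" n] by (simp add: L2_inner_def)

text \<open>The other interfaces carry zero trace, and on interface i the low moments vanish because
  a fast trace is an L2 limit of sine sums of frequency above \<open>ns\<close>.\<close>

lemma coef_V_fast:
  assumes v: "v \<in> V_fast_i N ns i" and i: "i \<in> {1..N-1}" and j: "j \<in> {1..N-1}" and n: "1 \<le> n" and z: "j \<noteq> i \<or> n \<le> ns"
  shows "coef N n j (weak_gradient (rect 0 N) v) = 0"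
proof (cases "j = i")
  case False
  then have "has_trace N j v (\<lambda>_. 0)" using v j unfolding V_fast_i_def by blast
  then show ?thesis using j by (intro coef_zero_trace) auto
next
  case True
  obtain g where g: "g \<in> Y_fast N ns i" "has_trace N i v g" using v unfolding V_fast_i_def by blast
  have "i \<le> N" using i by auto
  then show ?thesis using coef_eq_trace_moment[OF g(2), of n] Y_fast_moment[OF g(1) _ n] True z by simp
qed

lemma coef_V_slow:
  assumes v: "v \<in> V_slow_i N ns i" and i: "i \<in> {1..N-1}" and j: "j \<in> {1..N-1}" and n: "ns < n"
  shows "coef N n j (weak_gradient (rect 0 N) v) = 0"
proof (cases "j = i")
  case False
  then have "has_trace N j v (\<lambda>_. 0)" using v j unfolding V_slow_i_def by blast
  then show ?thesis using j by (intro coef_zero_trace) auto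
next
  case True
  obtain g where g: "g \<in> Y_slow ns" "has_trace N i v g" using v unfolding V_slow_i_def by blast
  have "i \<le> N" using i by auto
  then show ?thesis using coef_eq_trace_moment[OF g(2), of n] Y_slow_moment[OF g(1) n] True by simp
qed

text \<open>Makes the high modes of one interface admissible test functions in its fast problem, so
  that each of them yields one scalar equation.\<close>

lemma mode_V_fast:
  assumes n: "ns < n" and i: "i \<in> {1..N-1}"
  shows "mode n i \<in> V_fast_i N ns i"
proof -
  have ni: "1 \<le> n" "1 \<le> i" "i + 1 \<le> N" using n i by auto
  note tr = mode_trace[OF ni]
  let ?s = "\<lambda>t. sin (pi * real n * t)"
  have tri: "has_trace N i (mode n i) ?s" using tr[of i] by simp
  have "?s \<in> Y_fast N ns i"
    unfolding Y_fast_def mem_Collect_eq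
  proof (intro conjI exI)
    show "?s \<in> H_half_00 N i" unfolding H_half_00_def using tri by blast
    have S: "(\<Sum>k=ns+1..m. (if k = n then 1 else 0) * sin (pi * real k * t)) = ?s t" if "n \<le> m" for m t
    proof -
      have "(\<Sum>k=ns+1..m. (if k = n then 1 else 0) * sin (pi * real k * t)) = (\<Sum>k=ns+1..m. if k = n then ?s t else 0)"
        by (rule sum.cong) auto
      then show ?thesis using that n by (simp add: sum.delta)
    qed
    have "L2_norm {0<..<1} (\<lambda>t. (\<Sum>k=ns+1..m. (if k = n then 1 else 0) * sin (pi * real k * t)) - ?s t) = 0"
      if "n \<le> m" for m
      unfolding S[OF that] by (simp add: L2_norm_def L2_inner_def)
    then have "\<forall>\<^sub>F m in sequentially. L2_norm {0<..<1} (\<lambda>t. (\<Sum>k=ns+1..m. (if k = n then 1 else 0) * sin (pi * real k * t)) - ?s t) = 0"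
      by (rule eventually_mono[OF eventually_ge_at_top[of n]])
    then show "(\<lambda>m. L2_norm {0<..<1} (\<lambda>t. (\<Sum>k=ns+1..m. (if k = n then 1 else 0) * sin (pi * real k * t)) - ?s t)) \<longlonglongrightarrow> 0"
      by (rule tendsto_eventually)
  qed
  moreover have "has_trace N j (mode n i) (\<lambda>_. 0)" if "j \<noteq> i" for j using tr[of j] that by simp
  ultimately show ?thesis unfolding V_fast_i_def using V_GammaI[OF harm_mode[OF ni]] tri by blast
qed

text \<open>\<open>V_slow\<close> asks for a component on every interface; a single mode is
  completed by zero functions on the others.\<close>

lemma zero_V_slow: "(\<lambda>x. 0) \<in> V_slow_i N ns i"
proof -
  have z: "has_trace N j (\<lambda>x. 0) (\<lambda>_. 0)" for j
  proof (rule has_traceI[of N "\<lambda>k x. 0"])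
    have "grad (\<lambda>x. 0) = (\<lambda>x. 0)" by (rule ext, rule grad_eqI) simp
    moreover have "(\<lambda>x. 0) \<in> test_functions (rect 0 (real N))" by (rule test_functionsI[of _ "{}"]) auto
    ultimately show "test_limit (rect 0 N) (\<lambda>k x. 0) (\<lambda>x. 0) (\<lambda>x. 0)"
      by (simp add: test_limit_def L2_norm_def L2_inner_def)
  qed (simp_all add: L2_zero L2_norm_def L2_inner_def)
  have "(\<lambda>_. 0) \<in> Y_slow ns" unfolding Y_slow_def by (auto intro!: exI[of _ "\<lambda>_. 0"])
  then show ?thesis unfolding V_slow_i_def using z V_GammaI[OF harm_zero] by blast
qed

lemma mode_V_slow:
  assumes n: "1 \<le> n" "n \<le> ns" and i: "i \<in> {1..N-1}"
  shows "mode n i \<in> V_slow N ns"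
proof -
  have ni: "1 \<le> n" "1 \<le> i" "i + 1 \<le> N" using n i by auto
  note tr = mode_trace[OF ni]
  let ?s = "\<lambda>t. sin (pi * real n * t)"
  have "?s = (\<lambda>t. \<Sum>k=1..ns. (if k = n then 1 else 0) * sin (pi * real k * t))"
  proof
    fix t
    have "(\<Sum>k=1..ns. (if k = n then 1 else 0) * sin (pi * real k * t)) = (\<Sum>k=1..ns. if k = n then ?s t else 0)"
      by (rule sum.cong) auto
    then show "?s t = (\<Sum>k=1..ns. (if k = n then 1 else 0) * sin (pi * real k * t))" using n by (simp add: sum.delta)
  qed
  then have "?s \<in> Y_slow ns" unfolding Y_slow_def by (intro CollectI exI[of _ "\<lambda>k. if k = n then 1 else 0"])
  moreover have "has_trace N i (mode n i) ?s" using tr[of i] by simp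
  moreover have "has_trace N j (mode n i) (\<lambda>_. 0)" if "j \<noteq> i" for j using tr[of j] that by simp
  ultimately have s: "mode n i \<in> V_slow_i N ns i"
    unfolding V_slow_i_def using V_GammaI[OF harm_mode[OF ni]] by blast
  have "mode n i = (\<lambda>x. \<Sum>k=1..N-1. (if k = i then mode n i else (\<lambda>x. 0)) x)"
  proof
    fix x
    have "(\<Sum>k=1..N-1. (if k = i then mode n i else (\<lambda>x. 0)) x) = (\<Sum>k=1..N-1. if k = i then mode n i x else 0)"
      by (rule sum.cong) auto
    then show "mode n i x = (\<Sum>k=1..N-1. (if k = i then mode n i else (\<lambda>x. 0)) x)" using i by (simp add: sum.delta)
  qed
  then show ?thesis unfolding V_slow_def using s zero_V_slow
    by (intro CollectI exI[of _ "\<lambda>k. if k = i then mode n i else (\<lambda>x. 0)"]) auto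
qed

text \<open>The full, slow and fast Galerkin problems are tested with modes only, each test giving
  one row equation between coefficients. The error coefficients are then zero at low frequencies and
  solve a diagonal system at high ones; the block estimates are summed and the truncation is
  removed.\<close>

lemma error_estimate:
  fixes N :: nat
  assumes N: "2 < N" and y: "\<forall>j\<in>{1..N}. 0 < y j"
    and u: "interface_solution N y f u" and ut: "approx_interface_solution N ns y f ut"
  shows "energy_norm N y (\<lambda>x. u x - ut x) \<le> 4 * exp (- pi * (real ns + 1)) * energy_norm N y u"
proof -
  let ?G = "weak_gradient (rect 0 (real N))"
  have u1: "u \<in> V_Gamma N" and u2: "\<And>v. v \<in> V_Gamma N \<Longrightarrow> bilinear_form N y u v = L2_inner (Omega N) f v"
    using u unfolding interface_solution_def galerkin_solution_def by blast+
  obtain uf us where uf: "\<And>i. i \<in> {1..N-1} \<Longrightarrow> galerkin_solution N y f (V_fast_i N ns i) (uf i)"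
    and us: "galerkin_solution N y f (V_slow N ns) us" and ut': "ut = (\<lambda>x. (\<Sum>i=1..N-1. uf i x) + us x)"
    using ut unfolding approx_interface_solution_def by blast
  obtain w where w: "\<And>i. i \<in> {1..N-1} \<Longrightarrow> w i \<in> V_slow_i N ns i" and us': "us = (\<lambda>x. \<Sum>i=1..N-1. w i x)"
    using us unfolding galerkin_solution_def V_slow_def by blast
  define gs where "gs x = (\<Sum>i=1..N-1. ?G (w i) x)" for x
  have hu: "harm N u (?G u)" by (rule V_GammaD[OF u1])
  have hf: "harm N (uf i) (?G (uf i))" if "i \<in> {1..N-1}" for i
    using uf[OF that] by (intro V_GammaD) (auto simp: galerkin_solution_def V_fast_i_def)
  have hw: "harm N (w i) (?G (w i))" if "i \<in> {1..N-1}" for i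
    using w[OF that] by (intro V_GammaD) (auto simp: V_slow_i_def)
  have hs: "harm N us gs" unfolding us' gs_def[abs_def] by (intro harm_sum hw)
  define gt where "gt x = (\<Sum>i=1..N-1. ?G (uf i) x) + gs x" for x
  have ht: "harm N ut gt" unfolding ut' gt_def[abs_def] by (intro harm_add harm_sum hf hs)
  define ge where "ge x = ?G u x - gt x" for x
  have he: "harm N (\<lambda>x. u x - ut x) ge" unfolding ge_def[abs_def] by (rule harm_diff[OF hu ht])
  have H10: "harm N v g \<Longrightarrow> has_H10_grad 0 N v g" for v g by (simp add: harm_def)
  define cu where "cu n j = coef N n j (?G u)" for n j
  define cf where "cf i n j = coef N n j (?G (uf i))" for i n j
  define cs where "cs n j = coef N n j gs" for n j
  define ce where "ce n j = coef N n j ge" for n j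
  have bnd: "cu n 0 = 0" "cu n N = 0" "cs n 0 = 0" "cs n N = 0" "ce n 0 = 0" "ce n N = 0" for n
    unfolding cu_def cs_def ce_def
    by (simp_all add: coef_boundary[OF H10[OF hu]] coef_boundary[OF H10[OF hs]] coef_boundary[OF H10[OF he]])
  have bndf: "cf i n 0 = 0" "cf i n N = 0" if "i \<in> {1..N-1}" for i n
    unfolding cf_def by (simp_all add: coef_boundary[OF H10[OF hf[OF that]]])
  have N1: "N - 1 + 1 = N" using N by simp
  have range: "j = 0 \<or> j = N \<or> j \<in> {1..N-1}" if "j \<le> N" for j using that by auto
  have cf0: "cf i n j = 0" if "i \<in> {1..N-1}" "j \<le> N" "1 \<le> n" "j \<noteq> i \<or> n \<le> ns" for i n j
  proof -
    have "uf i \<in> V_fast_i N ns i" using uf[OF that(1)] by (simp add: galerkin_solution_def)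
    then show ?thesis
      using range[OF that(2)] bndf[OF that(1), of n] coef_V_fast[OF _ that(1) _ that(3,4)] by (auto simp: cf_def)
  qed
  have cs0: "cs n j = 0" if "j \<le> N" "ns < n" for n j
  proof -
    have "cs n j = (\<Sum>i=1..N-1. coef N n j (?G (w i)))"
      unfolding cs_def gs_def[abs_def] by (rule coef_sum[OF harm_L2(1)[OF hw] that(1)])
    also have "\<dots> = 0" if "j \<in> {1..N-1}"
      using coef_V_slow[OF w _ that \<open>ns < n\<close>] by (intro sum.neutral) auto
    finally show ?thesis using range[OF that(1)] bnd(3,4)[of n] by auto
  qed
  have ce: "ce n j = cu n j - (\<Sum>i=1..N-1. cf i n j) - cs n j" if "j \<le> N" for n j
  proof -
    have F: "(\<lambda>x. \<Sum>i=1..N-1. ?G (uf i) x) \<in> L2_space (rect 0 N)" by (intro L2_sum harm_L2(1)[OF hf])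
    have D: "(\<lambda>x. ?G u x - (\<Sum>i=1..N-1. ?G (uf i) x)) \<in> L2_space (rect 0 N)"
      by (intro L2_diff F harm_L2(1)[OF hu])
    have ge: "ge = (\<lambda>x. (?G u x - (\<Sum>i=1..N-1. ?G (uf i) x)) - gs x)"
      by (simp add: ge_def[abs_def] gt_def diff_diff_eq)
    show ?thesis unfolding ce_def cu_def cf_def cs_def ge
      by (simp only: coef_diff[OF D harm_L2(1)[OF hs] that] coef_diff[OF harm_L2(1)[OF hu] F that]
          coef_sum[OF harm_L2(1)[OF hf] that])
  qed

  have au: "bilinear_form N y v (mode n i) = kappa n * row y (cosh (pi * real n)) (\<lambda>j. coef N n j g) i"
    if "harm N v g" "1 \<le> n" "i \<in> {1..N-1}" for v g n i
  proof -
    have ni: "1 \<le> i" "i + 1 \<le> N" using that by auto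
    show ?thesis
      unfolding bilinear_form_eq_aform[OF H10[OF that(1)] mode_H10[OF that(2) ni]]
      by (rule aform_gmode[OF H10[OF that(1)] that(2) ni])
  qed
  have gal: "bilinear_form N y u (mode n i) = L2_inner (Omega N) f (mode n i)" if "1 \<le> n" "i \<in> {1..N-1}" for n i
    using that by (intro u2 V_GammaI[OF harm_mode]) auto
  \<comment> \<open>u and the slow solution satisfy the same equation for the test function
    \<open>mode n i\<close>; the positive factor \<open>kappa n\<close> cancels.\<close>
  have slow: "row y (cosh (pi * real n)) (cs n) i = row y (cosh (pi * real n)) (cu n) i"
    if n: "1 \<le> n" "n \<le> ns" and i: "i \<in> {1..N-1}" for n i
  proof -
    have "bilinear_form N y us (mode n i) = L2_inner (Omega N) f (mode n i)"
      using us mode_V_slow[OF n i] unfolding galerkin_solution_def by blast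
    then have "kappa n * row y (cosh (pi * real n)) (cs n) i = kappa n * row y (cosh (pi * real n)) (cu n) i"
      using gal[OF n(1) i] unfolding au[OF hs n(1) i] au[OF hu n(1) i] cs_def[abs_def] cu_def[abs_def] by simp
    then show ?thesis using kappa_pos[OF n(1)] by simp
  qed
  have fast: "row y (cosh (pi * real n)) (cf i n) i = row y (cosh (pi * real n)) (cu n) i"
    if n: "1 \<le> n" "ns < n" and i: "i \<in> {1..N-1}" for n i
  proof -
    have "bilinear_form N y (uf i) (mode n i) = L2_inner (Omega N) f (mode n i)"
      using uf[OF i] mode_V_fast[OF n(2) i] unfolding galerkin_solution_def by blast
    then have "kappa n * row y (cosh (pi * real n)) (cf i n) i = kappa n * row y (cosh (pi * real n)) (cu n) i"
      using gal[OF n(1) i] unfolding au[OF hf[OF i] n(1) i] au[OF hu n(1) i] cf_def[abs_def] cu_def[abs_def] by simp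
    then show ?thesis using kappa_pos[OF n(1)] by simp
  qed
  have y': "\<forall>i\<in>{1..N-1+1}. 0 < y i" using y unfolding N1 .

  \<comment> \<open>The coefficients of u minus those of the slow part lie in the kernel of a
    nonsingular block, and the fast parts contribute nothing at these frequencies.\<close>
  have ce_slow: "ce n j = 0" if n: "1 \<le> n" "n \<le> ns" and j: "j \<le> N" for n j
  proof -
    have C: "1 < cosh (pi * real n)" using cosh_bounds(1)[OF n(1)] by simp
    have "cu n i - cs n i = 0" if i: "i \<in> {1..N-1}" for i
    proof (rule row_kernel[where M = "N - 1" and c = "\<lambda>i. cu n i - cs n i", OF y' _ _ C _ i])
      show "cu n 0 - cs n 0 = 0" "cu n (N - 1 + 1) - cs n (N - 1 + 1) = 0" using bnd N1 by simp_all
      fix i assume i: "i \<in> {1..N-1}"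
      show "row y (cosh (pi * real n)) (\<lambda>i. cu n i - cs n i) i = 0"
        using slow[OF n i] by (simp add: row_def algebra_simps)
    qed
    then have "cu n j - cs n j = 0" using range[OF j] bnd[of n] by auto
    moreover have "(\<Sum>i=1..N-1. cf i n j) = 0" using cf0[OF _ j n(1)] n(2) by (intro sum.neutral) auto
    ultimately show ?thesis unfolding ce[OF j] by simp
  qed
  have ce_fast: "(y i + y (i + 1)) * cosh (pi * real n) * ce n i = y i * cu n (i - 1) + y (i + 1) * cu n (i + 1)"
    if n: "1 \<le> n" "ns < n" and i: "i \<in> {1..N-1}" for n i
  proof -
    have iN: "i \<le> N" "i - 1 \<le> N" "i + 1 \<le> N" "i - 1 \<noteq> i" "i + 1 \<noteq> i" using i by auto
    have "(\<Sum>k=1..N-1. cf k n i) = (\<Sum>k=1..N-1. if k = i then cf i n i else 0)"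
      using cf0[OF _ iN(1) n(1)] by (intro sum.cong) auto
    also have "\<dots> = cf i n i" using i by (simp add: sum.delta)
    finally have e: "ce n i = cu n i - cf i n i" unfolding ce[OF iN(1)] by (simp add: cs0[OF iN(1) n(2)])
    \<comment> \<open>The fast part of interface i has no coefficients on the neighbours, so its row
      is diagonal. Subtracting it from the row of u leaves the off-diagonal terms of u as the
      defect.\<close>
    have "cf i n (i - 1) = 0" "cf i n (i + 1) = 0"
      using cf0[OF i iN(2) n(1)] cf0[OF i iN(3) n(1)] iN(4,5) by blast+
    then have "(y i + y (i + 1)) * cosh (pi * real n) * cf i n i = row y (cosh (pi * real n)) (cu n) i"
      using fast[OF n i] by (simp only: row_def mult_zero_right diff_0_right)
    then show ?thesis unfolding e row_def by (simp add: algebra_simps)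
  qed

  define q where "q = 4 * exp (- pi * (real ns + 1))"
  have q4: "q = 4 / exp (pi * (real ns + 1))"
    unfolding q_def mult_minus_left exp_minus by (simp add: divide_inverse)
  have mode_bound: "(\<Sum>i=1..N-1. ce n i * row y (cosh (pi * real n)) (ce n) i)
      \<le> q\<^sup>2 * (\<Sum>i=1..N-1. cu n i * row y (cosh (pi * real n)) (cu n) i)" if n: "1 \<le> n" for n
  proof -
    let ?C = "cosh (pi * real n)"
    have bu: "cu n 0 = 0" "cu n (N - 1 + 1) = 0" and be: "ce n 0 = 0" "ce n (N - 1 + 1) = 0" using bnd N1 by simp_all
    have C: "5/3 \<le> ?C" by (rule cosh_bounds(1)[OF n])
    have "0 \<le> (?C - 1) * diag (N - 1) y (cu n)" using C diag_nonneg[of "N - 1" y "cu n", OF y'] by simp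
    also have "\<dots> \<le> (\<Sum>i=1..N-1. cu n i * row y ?C (cu n) i)" by (rule row_form_bounds(1)[OF y' bu])
    finally have pos: "0 \<le> (\<Sum>i=1..N-1. cu n i * row y ?C (cu n) i)" .
    show ?thesis
    proof (cases "n \<le> ns")
      case True
      then have "(\<Sum>i=1..N-1. ce n i * row y ?C (ce n) i) = 0"
        using ce_slow[OF n True] by (intro sum.neutral) auto
      then show ?thesis using pos by simp
    next
      case False
      then have n': "ns < n" by simp
      have "(\<Sum>i=1..N-1. ce n i * row y ?C (ce n) i) \<le> 4 / ?C\<^sup>2 * (\<Sum>i=1..N-1. cu n i * row y ?C (cu n) i)"
        by (rule diagonal_error[OF y' bu be C ce_fast[OF n n']])
      also have "\<dots> \<le> q\<^sup>2 * (\<Sum>i=1..N-1. cu n i * row y ?C (cu n) i)"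
      proof (rule mult_right_mono[OF _ pos])
        \<comment> \<open>Integrality: n > \<open>ns\<close> means n \<ge> \<open>ns\<close> + 1,
          the exponent of the claim.\<close>
        have "exp (pi * (real ns + 1)) \<le> exp (pi * real n)" using n' by simp
        then have "exp (pi * (real ns + 1)) / 2 \<le> ?C" using cosh_bounds(2)[OF n] by linarith
        then have "(exp (pi * (real ns + 1)) / 2)\<^sup>2 \<le> ?C\<^sup>2" by (rule power_mono) simp
        then have "4 / ?C\<^sup>2 \<le> 4 / (exp (pi * (real ns + 1)) / 2)\<^sup>2"
          by (intro divide_left_mono) (use C in auto)
        also have "\<dots> = q\<^sup>2" unfolding q4 by (simp add: power_divide)
        finally show "4 / ?C\<^sup>2 \<le> q\<^sup>2" .
      qed
      finally show ?thesis .
    qed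
  qed
  have q0: "0 \<le> q" by (simp add: q_def)
  have a0: "0 \<le> anorm N y h" for h using anorm_power2(2)[OF y] .
  have "anorm N y (trunc N K ge) \<le> q * anorm N y (?G u)" for K
  proof (rule power2_le_imp_le)
    have "(anorm N y (trunc N K ge))\<^sup>2 = (\<Sum>n=1..K. kappa n * (\<Sum>i=1..N-1. ce n i * row y (cosh (pi * real n)) (ce n) i))"
      unfolding anorm_power2(1)[OF y] aform_trunc_trunc[OF H10[OF he]] aform_trunc[OF H10[OF he] H10[OF he]] ce_def[abs_def] ..
    also have "\<dots> \<le> (\<Sum>n=1..K. kappa n * (q\<^sup>2 * (\<Sum>i=1..N-1. cu n i * row y (cosh (pi * real n)) (cu n) i)))"
      by (intro sum_mono mult_left_mono mode_bound kappa_nonneg) auto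
    also have "\<dots> = q\<^sup>2 * (anorm N y (trunc N K (?G u)))\<^sup>2"
      unfolding anorm_power2(1)[OF y] aform_trunc_trunc[OF H10[OF hu]] aform_trunc[OF H10[OF hu] H10[OF hu]] cu_def[abs_def]
      by (simp add: sum_distrib_left mult.left_commute)
    also have "\<dots> \<le> q\<^sup>2 * (anorm N y (?G u))\<^sup>2"
      by (intro mult_left_mono power_mono anorm_trunc_le[OF y H10[OF hu]] a0) simp
    finally show "(anorm N y (trunc N K ge))\<^sup>2 \<le> (q * anorm N y (?G u))\<^sup>2" by (simp add: power_mult_distrib)
  qed (intro mult_nonneg_nonneg q0 a0)
  \<comment> \<open>The bound is uniform in K, so completeness of the modes removes the
    truncation.\<close>
  then have "anorm N y ge \<le> q * anorm N y (?G u)"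
    using N by (intro anorm_le_if_trunc_le[OF y he]) auto
  moreover have "energy_norm N y (\<lambda>x. u x - ut x) = anorm N y ge" "energy_norm N y u = anorm N y (?G u)"
    unfolding energy_norm_def anorm_def
    by (simp_all only: bilinear_form_eq_aform[OF H10[OF he] H10[OF he]] bilinear_form_eq_aform[OF H10[OF hu] H10[OF hu]])
  ultimately show ?thesis by (simp add: q_def)
qed

theorem theorem4p2:
  fixes N :: nat and m M :: real and D :: "(nat \<Rightarrow> real) set"
  assumes "N > 2" and "m > 0" and "M > 0"
    and "D \<subseteq> {1..N} \<rightarrow>\<^sub>E {m<..<M}"
  shows "\<exists>C>0. \<forall>ns::nat. \<forall>f\<in>L2_space (Omega N). \<forall>y\<in>D. \<forall>u ut.
    interface_solution N y f u \<longrightarrow> approx_interface_solution N ns y f ut \<longrightarrow>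
    energy_norm N y (\<lambda>x. u x - ut x) \<le> C * exp (- pi * (real ns + 1)) * energy_norm N y u"
proof (intro exI[of _ 4] conjI allI ballI impI)
  fix ns f y u ut
  assume y: "y \<in> D" and u: "interface_solution N y f u" "approx_interface_solution N ns y f ut"
  have "0 < y j" if "j \<in> {1..N}" for j
  proof -
    have "y \<in> {1..N} \<rightarrow>\<^sub>E {m<..<M}" using y assms(4) by blast
    then have "y j \<in> {m<..<M}" using that by (rule PiE_mem)
    then show ?thesis using assms(2) by simp
  qed
  then have "\<forall>j\<in>{1..N}. 0 < y j" by blast
  then show "energy_norm N y (\<lambda>x. u x - ut x) \<le> 4 * exp (- pi * (real ns + 1)) * energy_norm N y u"
    by (rule error_estimate[OF assms(1) _ u])
qed simp

end
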